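(* Let assumptions (A1)–(A5) of the context hold, let $\beta\ge4$, and let $\bar u(\cdot)\in\mathcal U^\beta$ be a singular optimal control in the classical sense (as defined in the context). Then there exists $\lambda^*\in\Lambda^{\bar u}$ such that for every $u(\cdot)\in\mathcal U^4$, with $v(\cdot):=u(\cdot)-\bar u(\cdot)$, $$\int_\Gamma \mathbb E\int_0^T\big\langle \mathbb S_\gamma(t)\,y_{1,\gamma}(t),\,v(t)\big\rangle\,\mathrm dt\;\lambda^*(\mathrm d\gamma)\le 0 ,$$ where $y_{1,\gamma}=y_{1,\gamma}(\cdot;v)$ is the solution of the first-order linearized equation driven by $v$, and $\mathbb S_\gamma(t)$ is defined in the context.
   Context: **Probability setting.** $(\Omega,\mathcal F,\mathbb F,\mathbb P)$ is a complete filtered probability space carrying a one-dimensional standard Brownian motion $W$; $T>0$ is fixed; $\mathbb F=\{\mathcal F_t\}_{t\in[0,T]}$ is the natural filtration of $W$ augmented by the $\mathbb P$-null sets. $\mathbf S^n$ is the space of symmetric real $n\times n$ matrices. For $\alpha,\beta\in[1,\infty)$, $L^\beta_{\mathbb F}(\Omega;L^\alpha([0,T];\mathbb R^k))$ is the space of $\mathbb F$-adapted measurable processes $\varphi$ with $\mathbb E(\int_0^T|\varphi|^\alpha dt)^{\beta/\alpha}<\infty$. For $U\subset\mathbb R^m$, $\mathcal U^\beta$ is the set of $U$-valued $\mathbb F$-progressively measurable processes $u(\cdot)\in L^\beta_{\mathbb F}(\Omega;L^\beta([0,T];\mathbb R^m))$. **Derivatives.** For scalar $\varphi$, $\partial_x\varphi,\partial_u\varphi$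 are column gradients, $\partial_{xx}\varphi$ ($n\times n$) and $\partial_{uu}\varphi$ ($m\times m$) are Hessians, $\partial_{xu}\varphi$ is the $m\times n$ matrix of mixed derivatives, and $\partial_{(x,u)^2}\varphi$ is the full Hessian in $(x,u)$. For $\mathbb R^n$-valued $\varphi$, $\partial_x\varphi$ ($n\times n$) and $\partial_u\varphi$ ($n\times m$) are Jacobians; second derivatives are taken componentwise. **Assumptions.** (A1) $U\subset\mathbb R^m$ is nonempty and convex. (A2) $\Gamma$ is a locally compact Polish space with distance $\mathsf d$; $\Lambda$ is a weakly compact and convex set of probability measures on $(\Gamma,\mathcal B(\Gamma))$. (A3) (i) For each $\gamma\in\Gamma$, $b_\gamma,\sigma_\gamma:[0,T]\times\mathbb R^n\times U\to\mathbb R^n$, $f_\gamma:[0,T]\times\mathbb R^n\times U\to\mathbb R$, $h_\gamma:\mathbb R^n\to\mathbb R$ are Borel measurable. (ii) For each $\gamma,t$ these functions are twice continuously differentiable in $(x,u)$; $b,\sigma$ and their partial derivatives are uniformly bounded. (iii) There is $L>0$ such that for all $t,x,x',u,u',\gamma$: $|b_\gamma(t,x,u)-b_\gamma(t,x',u')|+|\sigma_\gamma(t,x,u)-\sigma_\gamma(t,x',u')|\le L(|x-x'|+|u-u'|)$, and $|\partial_{(x,u)^2}\varphi_\gamma(t,x,u)-\partial_{(x,u)^2}\varphi_\gamma(t,x',u')|\le L(|x-x'|+|u-u'|)$ for $\varphi=b,\sigma$. (iv) There is $L>0$ such that for all $t,x,x',u,u',\gamma$: $|f_\gamma(t,x,u)|\le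 L(1+|x|^2+|u|^2)$, $|h_\gamma(x)|\le L(1+|x|^2)$, $|\partial_xf_\gamma|+|\partial_uf_\gamma|\le L(1+|x|+|u|)$, $|\partial_{xx}f_\gamma|+|\partial_{xu}f_\gamma|+|\partial_{uu}f_\gamma|\le L$, $|\partial_{(x,u)^2}f_\gamma(t,x,u)-\partial_{(x,u)^2}f_\gamma(t,x',u')|\le L(|x-x'|+|u-u'|)$, $|\partial_xh_\gamma(x)|\le L(1+|x|)$, $|\partial_{xx}h_\gamma(x)|\le L$. (A4) For each $N>0$ there is a modulus of continuity $\overline\omega_N:[0,\infty)\to[0,\infty)$ with $|\varphi_\gamma(t,x,u)-\varphi_{\gamma'}(t,x,u)|\le\overline\omega_N(\mathsf d(\gamma,\gamma'))$ for all $t\in[0,T]$, $|x|\le N$, $u\in U$, $\gamma,\gamma'\in\Gamma$, where $\varphi$ is any of $b,\sigma,f,h$ or their derivatives in $(x,u)$ up to second order. (A5) (monotonicity; $\mathbb S_\gamma$ and $y_{1,\gamma}(\cdot;\cdot)$ as defined below) For any $u_1,u_2\in L^4_{\mathbb F}(\Omega;L^4([0,T];\mathbb R^m))$ and any $\gamma\in\Gamma$, $$-\mathbb E\int_0^T\langle\mathbb S_\gamma(t)y_{1,\gamma}(t;u_1-u_2),u_1(t)-u_2(t)\rangle dt\ge0.$$ **Control problem.** Fix $x_0\in\mathbb R^n$. For $u\in\mathcal U^\beta$, $x_\gamma$ solves $dx_\gamma=b_\gamma(t,x_\gamma,u)dt+\sigma_\gamma(t,x_\gamma,u)dW$, $x_\gamma(0)=x_0$.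 The robust cost is $$J(u)=\sup_{\lambda\in\Lambda}\int_\Gamma\mathbb E\Big[\int_0^Tf_\gamma(t,x_\gamma,u)dt+h_\gamma(x_\gamma(T))\Big]\lambda(d\gamma).$$ $\bar u\in\mathcal U^\beta$ is optimal if $J(\bar u)=\inf_{u\in\mathcal U^\beta}J(u)$; $\bar x_\gamma$ is its state. $\Lambda^{u}$ is the set of $\lambda\in\Lambda$ attaining the supremum in $J(u)$. For $\varphi=b,\sigma,f$, write $\partial_x\varphi_\gamma(t):=\partial_x\varphi_\gamma(t,\bar x_\gamma(t),\bar u(t))$ and similarly for the other derivatives. **Linearized equation.** For a given process $v$, $y_{1,\gamma}=y_{1,\gamma}(\cdot;v)$ solves $$dy_{1,\gamma}=[\partial_xb_\gamma(t)y_{1,\gamma}+\partial_ub_\gamma(t)v]dt+[\partial_x\sigma_\gamma(t)y_{1,\gamma}+\partial_u\sigma_\gamma(t)v]dW,\quad y_{1,\gamma}(0)=0.$$ **Hamiltonian and adjoint equations.** $H_\gamma(t,x,u,p,q)=\langle p,b_\gamma(t,x,u)\rangle+\langle q,\sigma_\gamma(t,x,u)\rangle-f_\gamma(t,x,u)$. $(P_{1,\gamma},Q_{1,\gamma})$ ($\mathbb R^n$-valued) and $(P_{2,\gamma},Q_{2,\gamma})$ ($\mathbf S^n$-valued) are the unique adapted solutions of $$dP_{1,\gamma}=-[\partial_xb_\gamma(t)^\top P_{1,\gamma}+\partial_x\sigma_\gamma(t)^\top Q_{1,\gamma}-\partial_xf_\gamma(t)]dt+Q_{1,\gamma}dW,\quad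 P_{1,\gamma}(T)=-\partial_xh_\gamma(\bar x_\gamma(T)),$$ $$dP_{2,\gamma}=-[\partial_xb_\gamma(t)^\top P_{2,\gamma}+P_{2,\gamma}\partial_xb_\gamma(t)+\partial_x\sigma_\gamma(t)^\top P_{2,\gamma}\partial_x\sigma_\gamma(t)+\partial_x\sigma_\gamma(t)^\top Q_{2,\gamma}+Q_{2,\gamma}\partial_x\sigma_\gamma(t)+\partial_{xx}H_\gamma(t)]dt+Q_{2,\gamma}dW,$$ $P_{2,\gamma}(T)=-\partial_{xx}h_\gamma(\bar x_\gamma(T))$, where $\partial_{xx}H_\gamma(t)=\partial_{xx}H_\gamma(t,\bar x_\gamma(t),\bar u(t),P_{1,\gamma}(t),Q_{1,\gamma}(t))$ (and similarly $\partial_uH_\gamma(t),\partial_{uu}H_\gamma(t),\partial_{xu}H_\gamma(t)$). **The process $\mathbb S$.** $$\mathbb S_\gamma(t)=\partial_{xu}H_\gamma(t)+\partial_ub_\gamma(t)^\top P_{2,\gamma}(t)+\partial_u\sigma_\gamma(t)^\top Q_{2,\gamma}(t)+\partial_u\sigma_\gamma(t)^\top P_{2,\gamma}(t)\partial_x\sigma_\gamma(t)\in\mathbb R^{m\times n}.$$ **Singular optimal control.** $\bar u\in\mathcal U^\beta$ is a singular optimal control in the classical sense if it is optimal and, for every $\lambda\in\Lambda^{\bar u}$, a.s. for a.e. $t\in[0,T]$, $$\int_\Gamma\partial_uH_\gamma(t)\lambda(d\gamma)=0,\qquad \int_\Gamma\big[\partial_{uu}H_\gamma(t)+\partial_u\sigma_\gamma(t)^\top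 P_{2,\gamma}(t)\partial_u\sigma_\gamma(t)\big]\lambda(d\gamma)=0.$$ *)

theory Defs
  imports "HOL-Probability.Probability"
begin

section \<open>Brownian motion, filtrations and spaces of processes\<close>

definition brownian_motion :: "'w measure \<Rightarrow> real \<Rightarrow> (real \<Rightarrow> 'w \<Rightarrow> real) \<Rightarrow> bool" where
  "brownian_motion M T W \<longleftrightarrow>
     (\<forall>t\<in>{0..T}. W t \<in> borel_measurable M) \<and>
     (AE \<omega> in M. W 0 \<omega> = 0) \<and>
     (AE \<omega> in M. continuous_on {0..T} (\<lambda>t. W t \<omega>)) \<and>
     (\<forall>s t. 0 \<le> s \<and> s < t \<and> t \<le> T \<longrightarrow>
        distributed M lborel (\<lambda>\<omega>. W t \<omega> - W s \<omega>) (\<lambda>r. ennreal (normal_density 0 (sqrt (t - s)) r))) \<and>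
     (\<forall>(k::nat) \<tau>. (\<forall>i\<le>k. \<tau> i \<in> {0..T}) \<and> (\<forall>i<k. \<tau> i \<le> \<tau> (Suc i)) \<longrightarrow>
        prob_space.indep_vars M (\<lambda>_. borel) (\<lambda>i \<omega>. W (\<tau> (Suc i)) \<omega> - W (\<tau> i) \<omega>) {..<k})"

definition augmented_filtration :: "'w measure \<Rightarrow> (real \<Rightarrow> 'w \<Rightarrow> real) \<Rightarrow> real \<Rightarrow> 'w measure" where
  "augmented_filtration M W t =
     sigma (space M) ({W s -` B \<inter> space M |s B. 0 \<le> s \<and> s \<le> t \<and> B \<in> sets borel} \<union> null_sets M)"

definition adapted_measurable ::
    "'w measure \<Rightarrow> (real \<Rightarrow> 'w measure) \<Rightarrow> real \<Rightarrow> (real \<Rightarrow> 'w \<Rightarrow> 'a::euclidean_space) \<Rightarrow> bool" where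
  "adapted_measurable M F T X \<longleftrightarrow>
     (\<forall>t\<in>{0..T}. X t \<in> borel_measurable (F t)) \<and>
     (\<lambda>(t, \<omega>). X t \<omega>) \<in> borel_measurable (restrict_space borel {0..T} \<Otimes>\<^sub>M M)"

definition progressively_measurable ::
    "(real \<Rightarrow> 'w measure) \<Rightarrow> real \<Rightarrow> (real \<Rightarrow> 'w \<Rightarrow> 'a::euclidean_space) \<Rightarrow> bool" where
  "progressively_measurable F T X \<longleftrightarrow>
     (\<forall>t\<in>{0..T}. (\<lambda>(s, \<omega>). X s \<omega>) \<in> borel_measurable (restrict_space borel {0..t} \<Otimes>\<^sub>M F t))"

text \<open>The space $L^\beta_F(\Omega; L^\alpha([0,T]; V))$; as usual, functions are not identified with
  their almost-everywhere classes.\<close>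

definition LF_space ::
    "'w measure \<Rightarrow> (real \<Rightarrow> 'w measure) \<Rightarrow> real \<Rightarrow> real \<Rightarrow> real \<Rightarrow> (real \<Rightarrow> 'w \<Rightarrow> 'a::euclidean_space) set" where
  "LF_space M F T \<beta> \<alpha> =
     {X. adapted_measurable M F T X \<and>
         (AE \<omega> in M. set_integrable lborel {0..T} (\<lambda>t. norm (X t \<omega>) powr \<alpha>)) \<and>
         integrable M (\<lambda>\<omega>. (LINT t:{0..T}|lborel. norm (X t \<omega>) powr \<alpha>) powr (\<beta> / \<alpha>))}"

definition continuous_adapted ::
    "'w measure \<Rightarrow> (real \<Rightarrow> 'w measure) \<Rightarrow> real \<Rightarrow> (real \<Rightarrow> 'w \<Rightarrow> 'a::euclidean_space) \<Rightarrow> bool" where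
  "continuous_adapted M F T X \<longleftrightarrow>
     adapted_measurable M F T X \<and> (AE \<omega> in M. continuous_on {0..T} (\<lambda>t. X t \<omega>))"

text \<open>Continuous adapted processes whose supremum over $[0,T]$ is square integrable: the class in
  which linear (backward) equations are uniquely solvable.\<close>

definition S2_space ::
    "'w measure \<Rightarrow> (real \<Rightarrow> 'w measure) \<Rightarrow> real \<Rightarrow> (real \<Rightarrow> 'w \<Rightarrow> 'a::euclidean_space) set" where
  "S2_space M F T =
     {X. continuous_adapted M F T X \<and>
         (\<integral>\<^sup>+\<omega>. (SUP t\<in>{0..T}. ennreal ((norm (X t \<omega>))\<^sup>2)) \<partial>M) < \<infinity>}"

definition controls ::
    "'w measure \<Rightarrow> (real \<Rightarrow> 'w measure) \<Rightarrow> real \<Rightarrow> (real^'m) set \<Rightarrow> real \<Rightarrow> (real \<Rightarrow> 'w \<Rightarrow> real^'m) set" where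
  "controls M F T U \<beta> =
     {u \<in> LF_space M F T \<beta> \<beta>. progressively_measurable F T u \<and>
        (\<forall>t\<in>{0..T}. \<forall>\<omega>\<in>space M. u t \<omega> \<in> U)}"

section \<open>The It\^o integral\<close>

definition elementary_data ::
    "'w measure \<Rightarrow> (real \<Rightarrow> 'w measure) \<Rightarrow> real \<Rightarrow> nat \<Rightarrow> (nat \<Rightarrow> real) \<Rightarrow> (nat \<Rightarrow> 'w \<Rightarrow> 'a::euclidean_space) \<Rightarrow> bool" where
  "elementary_data M F t k \<tau> \<xi> \<longleftrightarrow>
     (\<forall>i\<le>k. \<tau> i \<in> {0..t}) \<and> (\<forall>i<k. \<tau> i \<le> \<tau> (Suc i)) \<and>
     (\<forall>i<k. \<xi> i \<in> borel_measurable (F (\<tau> i)) \<and> bounded (\<xi> i ` space M))"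

definition elementary_process ::
    "nat \<Rightarrow> (nat \<Rightarrow> real) \<Rightarrow> (nat \<Rightarrow> 'w \<Rightarrow> 'a::euclidean_space) \<Rightarrow> real \<Rightarrow> 'w \<Rightarrow> 'a" where
  "elementary_process k \<tau> \<xi> s \<omega> = (\<Sum>i<k. indicator {\<tau> i<..\<tau> (Suc i)} s *\<^sub>R \<xi> i \<omega>)"

definition elementary_integral ::
    "(real \<Rightarrow> 'w \<Rightarrow> real) \<Rightarrow> nat \<Rightarrow> (nat \<Rightarrow> real) \<Rightarrow> (nat \<Rightarrow> 'w \<Rightarrow> 'a::euclidean_space) \<Rightarrow> 'w \<Rightarrow> 'a" where
  "elementary_integral W k \<tau> \<xi> \<omega> = (\<Sum>i<k. (W (\<tau> (Suc i)) \<omega> - W (\<tau> i) \<omega>) *\<^sub>R \<xi> i \<omega>)"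

text \<open>\<open>has_ito_integral M F W t \<phi> Z\<close>: the random variable \<open>Z\<close> is (a version of)
  $\int_0^t \varphi\, dW$, for square integrable adapted integrands. All integrands below are of
  this kind, so no localisation is needed.\<close>

definition has_ito_integral ::
    "'w measure \<Rightarrow> (real \<Rightarrow> 'w measure) \<Rightarrow> (real \<Rightarrow> 'w \<Rightarrow> real) \<Rightarrow> real \<Rightarrow>
     (real \<Rightarrow> 'w \<Rightarrow> 'a::euclidean_space) \<Rightarrow> ('w \<Rightarrow> 'a) \<Rightarrow> bool" where
  "has_ito_integral M F W t \<phi> Z \<longleftrightarrow>
     \<phi> \<in> LF_space M F t 2 2 \<and> Z \<in> borel_measurable M \<and>
     (\<exists>k \<tau> \<xi>.
        (\<forall>n::nat. elementary_data M F t (k n) (\<tau> n) (\<xi> n)) \<and>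
        (\<lambda>n. \<integral>\<^sup>+\<omega>. (\<integral>\<^sup>+s\<in>{0..t}. ennreal ((norm (elementary_process (k n) (\<tau> n) (\<xi> n) s \<omega> - \<phi> s \<omega>))\<^sup>2) \<partial>lborel) \<partial>M)
          \<longlonglongrightarrow> 0 \<and>
        (\<lambda>n. \<integral>\<^sup>+\<omega>. ennreal ((norm (elementary_integral W (k n) (\<tau> n) (\<xi> n) \<omega> - Z \<omega>))\<^sup>2) \<partial>M)
          \<longlonglongrightarrow> 0)"

text \<open>\<open>ito_dynamics M F W T X a c\<close> is $dX = a\,dt + c\,dW$ on $[0,T]$. For almost surely
  continuous \<open>X\<close>, the identity for each \<open>t\<close> almost surely is the same as almost surely for all \<open>t\<close>.\<close>

definition ito_dynamics ::
    "'w measure \<Rightarrow> (real \<Rightarrow> 'w measure) \<Rightarrow> (real \<Rightarrow> 'w \<Rightarrow> real) \<Rightarrow> real \<Rightarrow>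
     (real \<Rightarrow> 'w \<Rightarrow> 'a::euclidean_space) \<Rightarrow> (real \<Rightarrow> 'w \<Rightarrow> 'a) \<Rightarrow> (real \<Rightarrow> 'w \<Rightarrow> 'a) \<Rightarrow> bool" where
  "ito_dynamics M F W T X a c \<longleftrightarrow>
     (AE \<omega> in M. set_integrable lborel {0..T} (\<lambda>s. a s \<omega>)) \<and>
     (\<forall>t\<in>{0..T}. has_ito_integral M F W t c
        (\<lambda>\<omega>. X t \<omega> - X 0 \<omega> - (LINT s:{0..t}|lborel. a s \<omega>)))"

section \<open>Twice continuously differentiable coefficients\<close>

text \<open>The control set need not be open, so derivatives are taken within \<open>UNIV \<times> U\<close>. A
  coefficient is therefore carried together with its first and second derivative. They are
  determined by the function when \<open>U\<close> has nonempty interior; for a degenerate \<open>U\<close> any choice is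
  admitted (for instance the one coming from an extension of the function to a neighbourhood).\<close>

record (overloaded) ('z, 'a) c2_fun =
  val :: "'z::real_normed_vector \<Rightarrow> 'a::real_normed_vector"
  deriv1 :: "'z \<Rightarrow> ('z \<Rightarrow>\<^sub>L 'a)"
  deriv2 :: "'z \<Rightarrow> ('z \<Rightarrow>\<^sub>L ('z \<Rightarrow>\<^sub>L 'a))"

definition C2_on :: "'z::real_normed_vector set \<Rightarrow> ('z, 'a::real_normed_vector) c2_fun \<Rightarrow> bool" where
  "C2_on S \<phi> \<longleftrightarrow>
     (\<forall>z\<in>S. (val \<phi> has_derivative blinfun_apply (deriv1 \<phi> z)) (at z within S)) \<and>
     (\<forall>z\<in>S. (deriv1 \<phi> has_derivative blinfun_apply (deriv2 \<phi> z)) (at z within S)) \<and>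
     continuous_on S (deriv2 \<phi>)"

text \<open>A coefficient is a function of the pair $(x,u)$. The Jacobians are those of vector-valued
  functions, gradients and Hessian blocks those of scalar ones.\<close>

definition jac_x :: "((real^'n) \<times> (real^'m), real^'k) c2_fun \<Rightarrow> (real^'n) \<times> (real^'m) \<Rightarrow> real^'n^'k" where
  "jac_x \<phi> z = matrix (\<lambda>d. blinfun_apply (deriv1 \<phi> z) (d, 0))"

definition jac_u :: "((real^'n) \<times> (real^'m), real^'k) c2_fun \<Rightarrow> (real^'n) \<times> (real^'m) \<Rightarrow> real^'m^'k" where
  "jac_u \<phi> z = matrix (\<lambda>d. blinfun_apply (deriv1 \<phi> z) (0, d))"

definition grad_x :: "((real^'n) \<times> (real^'m), real) c2_fun \<Rightarrow> (real^'n) \<times> (real^'m) \<Rightarrow> real^'n" where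
  "grad_x \<phi> z = (\<chi> i. blinfun_apply (deriv1 \<phi> z) (axis i 1, 0))"

definition grad_u :: "((real^'n) \<times> (real^'m), real) c2_fun \<Rightarrow> (real^'n) \<times> (real^'m) \<Rightarrow> real^'m" where
  "grad_u \<phi> z = (\<chi> i. blinfun_apply (deriv1 \<phi> z) (0, axis i 1))"

definition hess_xx :: "((real^'n) \<times> (real^'m), real) c2_fun \<Rightarrow> (real^'n) \<times> (real^'m) \<Rightarrow> real^'n^'n" where
  "hess_xx \<phi> z = (\<chi> i j. blinfun_apply (blinfun_apply (deriv2 \<phi> z) (axis i 1, 0)) (axis j 1, 0))"

definition hess_xu :: "((real^'n) \<times> (real^'m), real) c2_fun \<Rightarrow> (real^'n) \<times> (real^'m) \<Rightarrow> real^'n^'m" where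
  "hess_xu \<phi> z = (\<chi> i j. blinfun_apply (blinfun_apply (deriv2 \<phi> z) (0, axis i 1)) (axis j 1, 0))"

definition hess_uu :: "((real^'n) \<times> (real^'m), real) c2_fun \<Rightarrow> (real^'n) \<times> (real^'m) \<Rightarrow> real^'m^'m" where
  "hess_uu \<phi> z = (\<chi> i j. blinfun_apply (blinfun_apply (deriv2 \<phi> z) (0, axis i 1)) (0, axis j 1))"

definition grad :: "(real^'n, real) c2_fun \<Rightarrow> real^'n \<Rightarrow> real^'n" where
  "grad \<phi> x = (\<chi> i. blinfun_apply (deriv1 \<phi> x) (axis i 1))"

definition hess :: "(real^'n, real) c2_fun \<Rightarrow> real^'n \<Rightarrow> real^'n^'n" where
  "hess \<phi> x = (\<chi> i j. blinfun_apply (blinfun_apply (deriv2 \<phi> x) (axis i 1)) (axis j 1))"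

definition hamiltonian ::
    "('z::real_normed_vector, 'a::real_inner) c2_fun \<Rightarrow> ('z, 'a) c2_fun \<Rightarrow> ('z, real) c2_fun \<Rightarrow> 'a \<Rightarrow> 'a \<Rightarrow> ('z, real) c2_fun" where
  "hamiltonian b \<sigma> f p q =
     \<lparr>val = (\<lambda>z. inner p (val b z) + inner q (val \<sigma> z) - val f z),
      deriv1 = (\<lambda>z. (blinfun_inner_right p o\<^sub>L deriv1 b z) + (blinfun_inner_right q o\<^sub>L deriv1 \<sigma> z) - deriv1 f z),
      deriv2 = (\<lambda>z. Blinfun (\<lambda>d. (blinfun_inner_right p o\<^sub>L blinfun_apply (deriv2 b z) d)
                               + (blinfun_inner_right q o\<^sub>L blinfun_apply (deriv2 \<sigma> z) d)
                               - blinfun_apply (deriv2 f z) d))\<rparr>"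

lemma hamiltonian_deriv2_apply:
  "blinfun_apply (blinfun_apply (deriv2 (hamiltonian b \<sigma> f p q) z) d) e =
     inner p (blinfun_apply (blinfun_apply (deriv2 b z) d) e)
     + inner q (blinfun_apply (blinfun_apply (deriv2 \<sigma> z) d) e)
     - blinfun_apply (blinfun_apply (deriv2 f z) d) e"
proof -
  have "bounded_linear (\<lambda>d. (blinfun_inner_right p o\<^sub>L blinfun_apply (deriv2 b z) d)
                               + (blinfun_inner_right q o\<^sub>L blinfun_apply (deriv2 \<sigma> z) d)
                               - blinfun_apply (deriv2 f z) d)"
    by (intro bounded_linear_add bounded_linear_sub
          bounded_linear_compose[OF bounded_bilinear.bounded_linear_right[OF bounded_bilinear_blinfun_compose]] blinfun.bounded_linear_right)
  then show ?thesis
    by (simp add: hamiltonian_def bounded_linear_Blinfun_apply blinfun.bilinear_simps)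
qed

lemma C2_on_hamiltonian:
  fixes b :: "('z::real_normed_vector, 'a::real_inner) c2_fun"
  assumes b: "C2_on S b" and \<sigma>: "C2_on S \<sigma>" and f: "C2_on S f"
  shows "C2_on S (hamiltonian b \<sigma> f p q)"
proof -
  let ?H = "hamiltonian b \<sigma> f p q"
  have comp: "(\<lambda>d. (blinfun_inner_right p o\<^sub>L blinfun_apply (deriv2 b z) d)
               + (blinfun_inner_right q o\<^sub>L blinfun_apply (deriv2 \<sigma> z) d)
               - blinfun_apply (deriv2 f z) d) = blinfun_apply (deriv2 ?H z)" for z
    by (intro ext blinfun_eqI) (simp add: hamiltonian_deriv2_apply blinfun.bilinear_simps)
  have 1: "(val ?H has_derivative blinfun_apply (deriv1 ?H z)) (at z within S)" if "z \<in> S" for z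
  proof -
    have "((\<lambda>z. inner p (val b z) + inner q (val \<sigma> z) - val f z) has_derivative
          (\<lambda>d. inner p (blinfun_apply (deriv1 b z) d) + inner q (blinfun_apply (deriv1 \<sigma> z) d)
               - blinfun_apply (deriv1 f z) d)) (at z within S)"
      using that b \<sigma> f unfolding C2_on_def
      by (intro has_derivative_diff has_derivative_add has_derivative_inner_right) auto
    moreover have "(\<lambda>d. inner p (blinfun_apply (deriv1 b z) d) + inner q (blinfun_apply (deriv1 \<sigma> z) d)
               - blinfun_apply (deriv1 f z) d) = blinfun_apply (deriv1 ?H z)"
      by (rule ext) (simp add: hamiltonian_def blinfun.bilinear_simps)
    ultimately show ?thesis by (simp add: hamiltonian_def)
  qed
  have 2: "(deriv1 ?H has_derivative blinfun_apply (deriv2 ?H z)) (at z within S)" if "z \<in> S" for z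
  proof -
    have "((\<lambda>z. (blinfun_inner_right p o\<^sub>L deriv1 b z) + (blinfun_inner_right q o\<^sub>L deriv1 \<sigma> z) - deriv1 f z)
           has_derivative (\<lambda>d. (blinfun_inner_right p o\<^sub>L blinfun_apply (deriv2 b z) d)
               + (blinfun_inner_right q o\<^sub>L blinfun_apply (deriv2 \<sigma> z) d)
               - blinfun_apply (deriv2 f z) d)) (at z within S)"
      using that b \<sigma> f unfolding C2_on_def
      by (intro has_derivative_diff has_derivative_add
            bounded_linear.has_derivative[OF bounded_bilinear.bounded_linear_right[OF bounded_bilinear_blinfun_compose]]) auto
    then show ?thesis unfolding comp by (simp add: hamiltonian_def)
  qed
  define A :: "'a \<Rightarrow> ('z \<Rightarrow>\<^sub>L 'a) \<Rightarrow>\<^sub>L ('z \<Rightarrow>\<^sub>L real)"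
    where "A = (\<lambda>p'. Blinfun (\<lambda>B. blinfun_inner_right p' o\<^sub>L B))"
  have A: "blinfun_apply (A p') B = blinfun_inner_right p' o\<^sub>L B"
    for p' B
    unfolding A_def by (simp add: bounded_linear_Blinfun_apply
        bounded_bilinear.bounded_linear_right[OF bounded_bilinear_blinfun_compose])
  have "continuous_on S (\<lambda>z. (A p o\<^sub>L deriv2 b z) + (A q o\<^sub>L deriv2 \<sigma> z) - deriv2 f z)"
    using b \<sigma> f unfolding C2_on_def
    by (intro continuous_intros
          bounded_linear.continuous_on[OF bounded_bilinear.bounded_linear_right[OF bounded_bilinear_blinfun_compose]]) auto
  moreover have "(\<lambda>z. (A p o\<^sub>L deriv2 b z) + (A q o\<^sub>L deriv2 \<sigma> z) - deriv2 f z) = deriv2 ?H"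
    by (intro ext blinfun_eqI) (simp add: hamiltonian_deriv2_apply A blinfun.bilinear_simps)
  ultimately have "continuous_on S (deriv2 ?H)" by metis
  then show ?thesis using 1 2 by (simp add: C2_on_def)
qed

section \<open>The set of models\<close>

definition prob_measures :: "'g::topological_space measure set" where
  "prob_measures = {\<mu>. prob_space \<mu> \<and> sets \<mu> = sets borel}"

definition weak_topology :: "'g::topological_space measure topology" where
  "weak_topology = topology_generated_by
     {{\<mu> \<in> prob_measures. (\<integral>\<gamma>. \<phi> \<gamma> \<partial>\<mu>) \<in> V} |\<phi> V.
        continuous_on UNIV \<phi> \<and> bounded (range \<phi>) \<and> open (V :: real set)}"

definition convex_measures :: "'g::topological_space measure set \<Rightarrow> bool" where
  "convex_measures \<Lambda> \<longleftrightarrow>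
     (\<forall>\<mu>\<in>\<Lambda>. \<forall>\<nu>\<in>\<Lambda>. \<forall>\<theta>\<in>{0..1::real}. \<exists>\<kappa>\<in>\<Lambda>. \<forall>A\<in>sets borel.
        measure \<kappa> A = \<theta> * measure \<mu> A + (1 - \<theta>) * measure \<nu> A)"

section \<open>Assumptions on the coefficients\<close>

definition coefficients_regular ::
    "real \<Rightarrow> (real^'m) set \<Rightarrow>
     ('g \<Rightarrow> real \<Rightarrow> ((real^'n) \<times> (real^'m), real^'n) c2_fun) \<Rightarrow>
     ('g \<Rightarrow> real \<Rightarrow> ((real^'n) \<times> (real^'m), real^'n) c2_fun) \<Rightarrow>
     ('g \<Rightarrow> real \<Rightarrow> ((real^'n) \<times> (real^'m), real) c2_fun) \<Rightarrow>
     ('g \<Rightarrow> (real^'n, real) c2_fun) \<Rightarrow> bool" where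
  "coefficients_regular T U b \<sigma> f h \<longleftrightarrow>
     (\<forall>\<gamma>. (\<lambda>(t, z). val (b \<gamma> t) z) \<in> borel_measurable (restrict_space borel ({0..T} \<times> UNIV \<times> U)) \<and>
          (\<lambda>(t, z). val (\<sigma> \<gamma> t) z) \<in> borel_measurable (restrict_space borel ({0..T} \<times> UNIV \<times> U)) \<and>
          (\<lambda>(t, z). val (f \<gamma> t) z) \<in> borel_measurable (restrict_space borel ({0..T} \<times> UNIV \<times> U)) \<and>
          val (h \<gamma>) \<in> borel_measurable borel) \<and>
     (\<forall>\<gamma>. \<forall>t\<in>{0..T}. C2_on (UNIV \<times> U) (b \<gamma> t) \<and> C2_on (UNIV \<times> U) (\<sigma> \<gamma> t) \<and>
          C2_on (UNIV \<times> U) (f \<gamma> t) \<and> C2_on UNIV (h \<gamma>)) \<and>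
     (\<exists>K. \<forall>\<gamma>. \<forall>t\<in>{0..T}. \<forall>x. \<forall>u\<in>U. \<forall>\<phi>\<in>{b \<gamma> t, \<sigma> \<gamma> t}.
          norm (val \<phi> (x, u)) \<le> K \<and> norm (deriv1 \<phi> (x, u)) \<le> K \<and> norm (deriv2 \<phi> (x, u)) \<le> K) \<and>
     (\<exists>L>0. \<forall>\<gamma>. \<forall>t\<in>{0..T}. \<forall>x x'. \<forall>u\<in>U. \<forall>u'\<in>U.
          norm (val (b \<gamma> t) (x, u) - val (b \<gamma> t) (x', u'))
            + norm (val (\<sigma> \<gamma> t) (x, u) - val (\<sigma> \<gamma> t) (x', u')) \<le> L * (norm (x - x') + norm (u - u')) \<and>
          (\<forall>\<phi>\<in>{b \<gamma> t, \<sigma> \<gamma> t}.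
            norm (deriv2 \<phi> (x, u) - deriv2 \<phi> (x', u')) \<le> L * (norm (x - x') + norm (u - u')))) \<and>
     (\<exists>L>0. \<forall>\<gamma>. \<forall>t\<in>{0..T}. \<forall>x x'. \<forall>u\<in>U. \<forall>u'\<in>U.
          \<bar>val (f \<gamma> t) (x, u)\<bar> \<le> L * (1 + (norm x)\<^sup>2 + (norm u)\<^sup>2) \<and>
          \<bar>val (h \<gamma>) x\<bar> \<le> L * (1 + (norm x)\<^sup>2) \<and>
          norm (grad_x (f \<gamma> t) (x, u)) + norm (grad_u (f \<gamma> t) (x, u)) \<le> L * (1 + norm x + norm u) \<and>
          norm (hess_xx (f \<gamma> t) (x, u)) + norm (hess_xu (f \<gamma> t) (x, u)) + norm (hess_uu (f \<gamma> t) (x, u)) \<le> L \<and>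
          norm (deriv2 (f \<gamma> t) (x, u) - deriv2 (f \<gamma> t) (x', u')) \<le> L * (norm (x - x') + norm (u - u')) \<and>
          norm (grad (h \<gamma>) x) \<le> L * (1 + norm x) \<and>
          norm (hess (h \<gamma>) x) \<le> L)"

definition modulus_of_continuity :: "(real \<Rightarrow> real) \<Rightarrow> bool" where
  "modulus_of_continuity \<omega> \<longleftrightarrow> (\<forall>r\<ge>0. \<omega> r \<ge> 0) \<and> \<omega> 0 = 0 \<and> (\<omega> \<longlongrightarrow> 0) (at_right 0)"

definition c2_close ::
    "('z::real_normed_vector, 'a::real_normed_vector) c2_fun \<Rightarrow> ('z, 'a) c2_fun \<Rightarrow> 'z \<Rightarrow> real \<Rightarrow> bool" where
  "c2_close \<phi> \<psi> z r \<longleftrightarrow> norm (val \<phi> z - val \<psi> z) \<le> r \<and> norm (deriv1 \<phi> z - deriv1 \<psi> z) \<le> r \<and>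
     norm (deriv2 \<phi> z - deriv2 \<psi> z) \<le> r"

definition coefficients_equicontinuous ::
    "real \<Rightarrow> (real^'m) set \<Rightarrow>
     ('g::metric_space \<Rightarrow> real \<Rightarrow> ((real^'n) \<times> (real^'m), real^'n) c2_fun) \<Rightarrow>
     ('g \<Rightarrow> real \<Rightarrow> ((real^'n) \<times> (real^'m), real^'n) c2_fun) \<Rightarrow>
     ('g \<Rightarrow> real \<Rightarrow> ((real^'n) \<times> (real^'m), real) c2_fun) \<Rightarrow>
     ('g \<Rightarrow> (real^'n, real) c2_fun) \<Rightarrow> bool" where
  "coefficients_equicontinuous T U b \<sigma> f h \<longleftrightarrow>
     (\<forall>N>0. \<exists>\<omega>. modulus_of_continuity \<omega> \<and>
        (\<forall>t\<in>{0..T}. \<forall>x. norm x \<le> N \<longrightarrow> (\<forall>u\<in>U. \<forall>\<gamma> \<gamma>'.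
           c2_close (b \<gamma> t) (b \<gamma>' t) (x, u) (\<omega> (dist \<gamma> \<gamma>')) \<and>
           c2_close (\<sigma> \<gamma> t) (\<sigma> \<gamma>' t) (x, u) (\<omega> (dist \<gamma> \<gamma>')) \<and>
           c2_close (f \<gamma> t) (f \<gamma>' t) (x, u) (\<omega> (dist \<gamma> \<gamma>')) \<and>
           c2_close (h \<gamma>) (h \<gamma>') x (\<omega> (dist \<gamma> \<gamma>')))))"

section \<open>State, linearised and adjoint equations for a fixed model\<close>

definition solves_state ::
    "'w measure \<Rightarrow> (real \<Rightarrow> 'w measure) \<Rightarrow> (real \<Rightarrow> 'w \<Rightarrow> real) \<Rightarrow> real \<Rightarrow> real^'n \<Rightarrow>
     (real \<Rightarrow> ((real^'n) \<times> (real^'m), real^'n) c2_fun) \<Rightarrow> (real \<Rightarrow> ((real^'n) \<times> (real^'m), real^'n) c2_fun) \<Rightarrow>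
     (real \<Rightarrow> 'w \<Rightarrow> real^'m) \<Rightarrow> (real \<Rightarrow> 'w \<Rightarrow> real^'n) \<Rightarrow> bool" where
  "solves_state M F W T x0 b \<sigma> u X \<longleftrightarrow>
     continuous_adapted M F T X \<and> (AE \<omega> in M. X 0 \<omega> = x0) \<and>
     ito_dynamics M F W T X
       (\<lambda>t \<omega>. val (b t) (X t \<omega>, u t \<omega>))
       (\<lambda>t \<omega>. val (\<sigma> t) (X t \<omega>, u t \<omega>))"

text \<open>In the following equations \<open>z t \<omega>\<close> stands for the optimal pair
  $(\bar x(t), \bar u(t))$ around which one linearises.\<close>

definition solves_linearized ::
    "'w measure \<Rightarrow> (real \<Rightarrow> 'w measure) \<Rightarrow> (real \<Rightarrow> 'w \<Rightarrow> real) \<Rightarrow> real \<Rightarrow>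
     (real \<Rightarrow> ((real^'n) \<times> (real^'m), real^'n) c2_fun) \<Rightarrow> (real \<Rightarrow> ((real^'n) \<times> (real^'m), real^'n) c2_fun) \<Rightarrow>
     (real \<Rightarrow> 'w \<Rightarrow> (real^'n) \<times> (real^'m)) \<Rightarrow> (real \<Rightarrow> 'w \<Rightarrow> real^'m) \<Rightarrow> (real \<Rightarrow> 'w \<Rightarrow> real^'n) \<Rightarrow> bool" where
  "solves_linearized M F W T b \<sigma> z v Y \<longleftrightarrow>
     Y \<in> S2_space M F T \<and> (AE \<omega> in M. Y 0 \<omega> = 0) \<and>
     ito_dynamics M F W T Y
       (\<lambda>t \<omega>. jac_x (b t) (z t \<omega>) *v Y t \<omega> + jac_u (b t) (z t \<omega>) *v v t \<omega>)
       (\<lambda>t \<omega>. jac_x (\<sigma> t) (z t \<omega>) *v Y t \<omega> + jac_u (\<sigma> t) (z t \<omega>) *v v t \<omega>)"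

definition solves_first_adjoint ::
    "'w measure \<Rightarrow> (real \<Rightarrow> 'w measure) \<Rightarrow> (real \<Rightarrow> 'w \<Rightarrow> real) \<Rightarrow> real \<Rightarrow>
     (real \<Rightarrow> ((real^'n) \<times> (real^'m), real^'n) c2_fun) \<Rightarrow> (real \<Rightarrow> ((real^'n) \<times> (real^'m), real^'n) c2_fun) \<Rightarrow>
     (real \<Rightarrow> ((real^'n) \<times> (real^'m), real) c2_fun) \<Rightarrow> (real^'n, real) c2_fun \<Rightarrow>
     (real \<Rightarrow> 'w \<Rightarrow> (real^'n) \<times> (real^'m)) \<Rightarrow> (real \<Rightarrow> 'w \<Rightarrow> real^'n) \<Rightarrow> (real \<Rightarrow> 'w \<Rightarrow> real^'n) \<Rightarrow> bool" where
  "solves_first_adjoint M F W T b \<sigma> f h z P Q \<longleftrightarrow>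
     P \<in> S2_space M F T \<and> Q \<in> LF_space M F T 2 2 \<and>
     (AE \<omega> in M. P T \<omega> = - grad h (fst (z T \<omega>))) \<and>
     ito_dynamics M F W T P
       (\<lambda>t \<omega>. - (transpose (jac_x (b t) (z t \<omega>)) *v P t \<omega>
                 + transpose (jac_x (\<sigma> t) (z t \<omega>)) *v Q t \<omega>
                 - grad_x (f t) (z t \<omega>)))
       Q"

definition solves_second_adjoint ::
    "'w measure \<Rightarrow> (real \<Rightarrow> 'w measure) \<Rightarrow> (real \<Rightarrow> 'w \<Rightarrow> real) \<Rightarrow> real \<Rightarrow>
     (real \<Rightarrow> ((real^'n) \<times> (real^'m), real^'n) c2_fun) \<Rightarrow> (real \<Rightarrow> ((real^'n) \<times> (real^'m), real^'n) c2_fun) \<Rightarrow>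
     (real \<Rightarrow> ((real^'n) \<times> (real^'m), real) c2_fun) \<Rightarrow> (real^'n, real) c2_fun \<Rightarrow>
     (real \<Rightarrow> 'w \<Rightarrow> (real^'n) \<times> (real^'m)) \<Rightarrow> (real \<Rightarrow> 'w \<Rightarrow> real^'n) \<Rightarrow> (real \<Rightarrow> 'w \<Rightarrow> real^'n) \<Rightarrow>
     (real \<Rightarrow> 'w \<Rightarrow> real^'n^'n) \<Rightarrow> (real \<Rightarrow> 'w \<Rightarrow> real^'n^'n) \<Rightarrow> bool" where
  "solves_second_adjoint M F W T b \<sigma> f h z P1 Q1 P2 Q2 \<longleftrightarrow>
     P2 \<in> S2_space M F T \<and> Q2 \<in> LF_space M F T 2 2 \<and>
     (\<forall>t\<in>{0..T}. \<forall>\<omega>\<in>space M. transpose (P2 t \<omega>) = P2 t \<omega> \<and> transpose (Q2 t \<omega>) = Q2 t \<omega>) \<and>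
     (AE \<omega> in M. P2 T \<omega> = - hess h (fst (z T \<omega>))) \<and>
     ito_dynamics M F W T P2
       (\<lambda>t \<omega>. let B = jac_x (b t) (z t \<omega>); S = jac_x (\<sigma> t) (z t \<omega>) in
          - (transpose B ** P2 t \<omega> + P2 t \<omega> ** B + transpose S ** P2 t \<omega> ** S
             + transpose S ** Q2 t \<omega> + Q2 t \<omega> ** S
             + hess_xx (hamiltonian (b t) (\<sigma> t) (f t) (P1 t \<omega>) (Q1 t \<omega>)) (z t \<omega>)))
       Q2"

text \<open>The matrix $\mathbb S$ as a function of the coefficients and of the values of the optimal pair
  and of the adjoint processes at one point $(t, \omega)$.\<close>

definition S_matrix ::
    "((real^'n) \<times> (real^'m), real^'n) c2_fun \<Rightarrow> ((real^'n) \<times> (real^'m), real^'n) c2_fun \<Rightarrow> ((real^'n) \<times> (real^'m), real) c2_fun \<Rightarrow>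
     (real^'n) \<times> (real^'m) \<Rightarrow> real^'n \<Rightarrow> real^'n \<Rightarrow> real^'n^'n \<Rightarrow> real^'n^'n \<Rightarrow> real^'n^'m" where
  "S_matrix b \<sigma> f z p1 q1 p2 q2 =
     hess_xu (hamiltonian b \<sigma> f p1 q1) z + transpose (jac_u b z) ** p2
     + transpose (jac_u \<sigma> z) ** q2 + transpose (jac_u \<sigma> z) ** p2 ** jac_x \<sigma> z"

section \<open>The robust control problem\<close>

text \<open>\<open>x u \<gamma>\<close> is the state under the control \<open>u\<close> in the model \<open>\<gamma>\<close>.\<close>

definition expected_cost ::
    "'w measure \<Rightarrow> real \<Rightarrow> ('g \<Rightarrow> real \<Rightarrow> ((real^'n) \<times> (real^'m), real) c2_fun) \<Rightarrow> ('g \<Rightarrow> (real^'n, real) c2_fun) \<Rightarrow>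
     ((real \<Rightarrow> 'w \<Rightarrow> real^'m) \<Rightarrow> 'g \<Rightarrow> real \<Rightarrow> 'w \<Rightarrow> real^'n) \<Rightarrow> (real \<Rightarrow> 'w \<Rightarrow> real^'m) \<Rightarrow> 'g \<Rightarrow> real" where
  "expected_cost M T f h x u \<gamma> =
     (\<integral>\<omega>. (LINT t:{0..T}|lborel. val (f \<gamma> t) (x u \<gamma> t \<omega>, u t \<omega>)) + val (h \<gamma>) (x u \<gamma> T \<omega>) \<partial>M)"

text \<open>Extended reals make the infimum over all controls below meaningful without an a priori lower
  bound.\<close>

definition robust_cost ::
    "'w measure \<Rightarrow> real \<Rightarrow> ('g \<Rightarrow> real \<Rightarrow> ((real^'n) \<times> (real^'m), real) c2_fun) \<Rightarrow> ('g \<Rightarrow> (real^'n, real) c2_fun) \<Rightarrow>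
     'g measure set \<Rightarrow> ((real \<Rightarrow> 'w \<Rightarrow> real^'m) \<Rightarrow> 'g \<Rightarrow> real \<Rightarrow> 'w \<Rightarrow> real^'n) \<Rightarrow>
     (real \<Rightarrow> 'w \<Rightarrow> real^'m) \<Rightarrow> ereal" where
  "robust_cost M T f h \<Lambda> x u = (SUP \<mu>\<in>\<Lambda>. ereal (\<integral>\<gamma>. expected_cost M T f h x u \<gamma> \<partial>\<mu>))"

definition worst_case_measures ::
    "'w measure \<Rightarrow> real \<Rightarrow> ('g \<Rightarrow> real \<Rightarrow> ((real^'n) \<times> (real^'m), real) c2_fun) \<Rightarrow> ('g \<Rightarrow> (real^'n, real) c2_fun) \<Rightarrow>
     'g measure set \<Rightarrow> ((real \<Rightarrow> 'w \<Rightarrow> real^'m) \<Rightarrow> 'g \<Rightarrow> real \<Rightarrow> 'w \<Rightarrow> real^'n) \<Rightarrow>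
     (real \<Rightarrow> 'w \<Rightarrow> real^'m) \<Rightarrow> 'g measure set" where
  "worst_case_measures M T f h \<Lambda> x u =
     {\<mu>\<in>\<Lambda>. ereal (\<integral>\<gamma>. expected_cost M T f h x u \<gamma> \<partial>\<mu>) = robust_cost M T f h \<Lambda> x u}"

definition optimal_control ::
    "'w measure \<Rightarrow> (real \<Rightarrow> 'w measure) \<Rightarrow> real \<Rightarrow> (real^'m) set \<Rightarrow> real \<Rightarrow>
     ('g \<Rightarrow> real \<Rightarrow> ((real^'n) \<times> (real^'m), real) c2_fun) \<Rightarrow> ('g \<Rightarrow> (real^'n, real) c2_fun) \<Rightarrow>
     'g measure set \<Rightarrow> ((real \<Rightarrow> 'w \<Rightarrow> real^'m) \<Rightarrow> 'g \<Rightarrow> real \<Rightarrow> 'w \<Rightarrow> real^'n) \<Rightarrow>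
     (real \<Rightarrow> 'w \<Rightarrow> real^'m) \<Rightarrow> bool" where
  "optimal_control M F T U \<beta> f h \<Lambda> x ubar \<longleftrightarrow>
     ubar \<in> controls M F T U \<beta> \<and>
     robust_cost M T f h \<Lambda> x ubar = (INF u\<in>controls M F T U \<beta>. robust_cost M T f h \<Lambda> x u)"

text \<open>\<open>z \<gamma> t \<omega>\<close> is the optimal pair in the model \<open>\<gamma>\<close>.\<close>

definition singular_optimal_control ::
    "'w measure \<Rightarrow> (real \<Rightarrow> 'w measure) \<Rightarrow> real \<Rightarrow> (real^'m) set \<Rightarrow> real \<Rightarrow>
     ('g \<Rightarrow> real \<Rightarrow> ((real^'n) \<times> (real^'m), real^'n) c2_fun) \<Rightarrow> ('g \<Rightarrow> real \<Rightarrow> ((real^'n) \<times> (real^'m), real^'n) c2_fun) \<Rightarrow>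
     ('g \<Rightarrow> real \<Rightarrow> ((real^'n) \<times> (real^'m), real) c2_fun) \<Rightarrow> ('g \<Rightarrow> (real^'n, real) c2_fun) \<Rightarrow>
     'g measure set \<Rightarrow> ((real \<Rightarrow> 'w \<Rightarrow> real^'m) \<Rightarrow> 'g \<Rightarrow> real \<Rightarrow> 'w \<Rightarrow> real^'n) \<Rightarrow>
     ('g \<Rightarrow> real \<Rightarrow> 'w \<Rightarrow> real^'n) \<Rightarrow> ('g \<Rightarrow> real \<Rightarrow> 'w \<Rightarrow> real^'n) \<Rightarrow> ('g \<Rightarrow> real \<Rightarrow> 'w \<Rightarrow> real^'n^'n) \<Rightarrow>
     (real \<Rightarrow> 'w \<Rightarrow> real^'m) \<Rightarrow> bool" where
  "singular_optimal_control M F T U \<beta> b \<sigma> f h \<Lambda> x P1 Q1 P2 ubar \<longleftrightarrow>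
     optimal_control M F T U \<beta> f h \<Lambda> x ubar \<and>
     (let z = (\<lambda>\<gamma> t \<omega>. (x ubar \<gamma> t \<omega>, ubar t \<omega>));
          H = (\<lambda>\<gamma> t \<omega>. hamiltonian (b \<gamma> t) (\<sigma> \<gamma> t) (f \<gamma> t) (P1 \<gamma> t \<omega>) (Q1 \<gamma> t \<omega>)) in
      \<forall>\<mu>\<in>worst_case_measures M T f h \<Lambda> x ubar.
        AE \<omega> in M. AE t in lborel. t \<in> {0..T} \<longrightarrow>
          (\<integral>\<gamma>. grad_u (H \<gamma> t \<omega>) (z \<gamma> t \<omega>) \<partial>\<mu>) = 0 \<and>
          (\<integral>\<gamma>. hess_uu (H \<gamma> t \<omega>) (z \<gamma> t \<omega>)
               + transpose (jac_u (\<sigma> \<gamma> t) (z \<gamma> t \<omega>)) ** P2 \<gamma> t \<omega> ** jac_u (\<sigma> \<gamma> t) (z \<gamma> t \<omega>) \<partial>\<mu>) = 0)"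

text \<open>Adjoint processes are determined for each \<open>\<gamma>\<close> only up to null sets, so integrating them over
  \<open>\<gamma>\<close> at fixed $(t,\omega)$ makes sense only for versions that are jointly measurable.\<close>

definition jointly_measurable ::
    "'w measure \<Rightarrow> real \<Rightarrow> ('g::topological_space \<Rightarrow> real \<Rightarrow> 'w \<Rightarrow> 'a::euclidean_space) \<Rightarrow> bool" where
  "jointly_measurable M T X \<longleftrightarrow>
     (\<lambda>(\<gamma>, t, \<omega>). X \<gamma> t \<omega>) \<in> borel_measurable (borel \<Otimes>\<^sub>M (restrict_space borel {0..T} \<Otimes>\<^sub>M M))"

end

theory Submission
  imports Defs
begin

text \<open>
  Let \<open>\<ell>(\<gamma>, v)\<close> be the inner integral
  $\mathbb E\int_0^T\langle \mathbb S_\gamma y_{1,\gamma}(\cdot;v), v\rangle\,dt$. The monotonicity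
  assumption, applied to the pair \<open>u\<close>, \<open>ubar\<close> (both lie in $L^4$, because $\beta \ge 4$ and the
  time horizon is finite), says \<open>\<ell>(\<gamma>, u - ubar) \<le> 0\<close> for every single model \<open>\<gamma>\<close>. Hence every
  measure gives a nonpositive average, and one \<open>\<mu>\<close> serves all controls \<open>u\<close> at once. What has to be
  proved is that a worst-case measure for \<open>ubar\<close> exists, that is, that the supremum defining the
  robust cost is attained.

  The set of measures is weakly compact, so it suffices that the expected cost is a bounded
  continuous function of the model \<open>\<gamma>\<close> (\<open>worst_case_measures_nonempty\<close>). Boundedness is a uniform
  second moment bound for the states. Continuity rests on the stability of the state equation in
  the model: if \<open>\<gamma>\<^sub>n \<longlonglongrightarrow> \<gamma>\<close>, the coefficients along the limiting state converge pointwise and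
  boundedly, hence in $L^2$, and Gronwall's inequality transports this to the states uniformly in
  time (\<open>state_continuous\<close>). The costs grow quadratically and their derivatives linearly, so they
  pass to the limit under $L^2$ convergence of the states (\<open>quadratic_growth_integral_tendsto\<close>).

  The stability estimate needs one fact about stochastic integration, an $L^2$ bound for the
  difference of two It\^o integrals (\<open>ito_integral_diff_estimate\<close>). It comes from the isometry for
  elementary integrands, which in turn reduces to the independence of a Brownian increment from
  the augmented filtration at its left end point (\<open>indep_set_F_increment\<close>).
\<close>

section \<open>Brownian increments are independent of the past\<close>

lemma (in prob_space) indep_set_mono: "indep_set A B \<Longrightarrow> A' \<subseteq> A \<Longrightarrow> B' \<subseteq> B \<Longrightarrow> indep_set A' B'"
  unfolding indep_sets2_eq by blast

locale brownian_space = prob_space M for M :: "'w measure" +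
  fixes T :: real and W :: "real \<Rightarrow> 'w \<Rightarrow> real"
  assumes bm: "brownian_motion M T W"
begin

abbreviation F :: "real \<Rightarrow> 'w measure" where
  "F \<equiv> augmented_filtration M W"

lemma W_measurable [measurable (raw)]: "0 \<le> t \<Longrightarrow> t \<le> T \<Longrightarrow> W t \<in> borel_measurable M"
  using bm by (simp add: brownian_motion_def)

lemma W_0: "AE \<omega> in M. W 0 \<omega> = 0"
  using bm by (simp add: brownian_motion_def)

lemma W_increment_normal:
  "0 \<le> s \<Longrightarrow> s < t \<Longrightarrow> t \<le> T \<Longrightarrow>
    distributed M lborel (\<lambda>\<omega>. W t \<omega> - W s \<omega>) (normal_density 0 (sqrt (t - s)))"
  using bm by (simp add: brownian_motion_def)

lemma space_F [simp]: "space (F t) = space M"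
  unfolding augmented_filtration_def
  by (rule space_measure_of) (auto dest: sets.sets_into_space)

lemma sets_F:
  "sets (F t) = sigma_sets (space M)
     ({W s -` B \<inter> space M |s B. 0 \<le> s \<and> s \<le> t \<and> B \<in> sets borel} \<union> null_sets M)"
  unfolding augmented_filtration_def
  by (rule sets_measure_of) (auto dest: sets.sets_into_space)

lemma F_mono: "s \<le> t \<Longrightarrow> sets (F s) \<subseteq> sets (F t)"
  unfolding sets_F by (rule sigma_sets_subseteq) (blast intro: order_trans)

lemma W_vimage_events: "0 \<le> s \<Longrightarrow> s \<le> T \<Longrightarrow> B \<in> sets borel \<Longrightarrow> W s -` B \<inter> space M \<in> events"
  by (rule measurable_sets[OF W_measurable])

lemma sets_F_subset_events:
  assumes "t \<le> T" shows "sets (F t) \<subseteq> events"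
proof -
  let ?G = "{W s -` B \<inter> space M |s B. 0 \<le> s \<and> s \<le> t \<and> B \<in> sets borel}"
  have "?G \<subseteq> events"
  proof
    fix A assume "A \<in> ?G"
    then obtain s and B :: "real set" where A: "A = W s -` B \<inter> space M" "0 \<le> s" "s \<le> t" "B \<in> sets borel"
      by blast
    have "s \<le> T" using A assms by linarith
    then show "A \<in> events" unfolding A(1) using A by (intro W_vimage_events)
  qed
  moreover have "null_sets M \<subseteq> events" by (rule subsetI) (rule null_setsD2)
  ultimately have "?G \<union> null_sets M \<subseteq> events" by (rule Un_least)
  from sets.sigma_sets_subset[OF this] show ?thesis by (simp only: sets_F)
qed

lemma measurable_F_mono: "g \<in> borel_measurable (F s) \<Longrightarrow> s \<le> t \<Longrightarrow> g \<in> borel_measurable (F t)"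
  by (rule subsetD[OF measurable_mono[OF order_refl refl F_mono]]) simp_all

lemma measurable_F_M: "g \<in> borel_measurable (F s) \<Longrightarrow> s \<le> T \<Longrightarrow> g \<in> borel_measurable M"
  by (rule subsetD[OF measurable_mono[OF order_refl refl sets_F_subset_events]]) simp_all

lemma W_measurable_F:
  assumes "0 \<le> s" "s \<le> t" shows "W s \<in> borel_measurable (F t)"
proof (rule measurableI)
  fix B :: "real set" assume "B \<in> sets borel"
  then show "W s -` B \<inter> space (F t) \<in> sets (F t)"
    unfolding sets_F space_F using assms by (intro sigma_sets.Basic) blast
qed simp

text \<open>Events that agree, up to a null set, with a condition on finitely many values of the path up to
  time \<open>s\<close>. Working modulo null sets makes the null sets of the augmentation members of this family
  and lets \<open>W 0\<close> be treated as zero.\<close>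

definition cylinder_events :: "real \<Rightarrow> 'w set set" where
  "cylinder_events s =
     {A \<in> events. \<exists>S B. finite S \<and> S \<subseteq> {0..s} \<and> (\<forall>r\<in>S. B r \<in> sets borel) \<and>
        (AE \<omega> in M. \<omega> \<in> A \<longleftrightarrow> (\<forall>r\<in>S. W r \<omega> \<in> B r))}"

lemma Int_stable_cylinder_events: "Int_stable (cylinder_events s)"
proof (rule Int_stableI)
  fix A A' assume "A \<in> cylinder_events s" "A' \<in> cylinder_events s"
  then obtain S B S' B' where
    1: "A \<in> events" "finite S" "S \<subseteq> {0..s}" "\<forall>r\<in>S. B r \<in> sets borel"
       "AE \<omega> in M. \<omega> \<in> A \<longleftrightarrow> (\<forall>r\<in>S. W r \<omega> \<in> B r)" and
    2: "A' \<in> events" "finite S'" "S' \<subseteq> {0..s}" "\<forall>r\<in>S'. B' r \<in> sets borel"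
       "AE \<omega> in M. \<omega> \<in> A' \<longleftrightarrow> (\<forall>r\<in>S'. W r \<omega> \<in> B' r)"
    unfolding cylinder_events_def by auto
  define C where "C r = (if r \<in> S then B r else UNIV) \<inter> (if r \<in> S' then B' r else UNIV)" for r
  have "AE \<omega> in M. \<omega> \<in> A \<inter> A' \<longleftrightarrow> (\<forall>r\<in>S \<union> S'. W r \<omega> \<in> C r)"
    using 1(5) 2(5) by eventually_elim (auto simp: C_def)
  moreover have "\<forall>r\<in>S \<union> S'. C r \<in> sets borel"
    using 1(4) 2(4) by (auto simp: C_def)
  ultimately show "A \<inter> A' \<in> cylinder_events s"
    using 1(1-3) 2(1-3) unfolding cylinder_events_def
    by (intro CollectI conjI exI[of _ "S \<union> S'"] exI[of _ C]) simp_all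
qed

lemma sets_F_cylinder:
  assumes "0 \<le> s" "s \<le> T" shows "sets (F s) \<subseteq> sigma_sets (space M) (cylinder_events s)"
  unfolding sets_F
proof (rule sigma_sets_subseteq, intro Un_least subsetI)
  fix A assume "A \<in> {W r -` B \<inter> space M |r B. 0 \<le> r \<and> r \<le> s \<and> B \<in> sets borel}"
  then obtain r and B :: "real set" where A: "A = W r -` B \<inter> space M" "0 \<le> r" "r \<le> s" "B \<in> sets borel" by auto
  then have "A \<in> events" using assms W_vimage_events[of r B] by simp
  then show "A \<in> cylinder_events s" using A
    unfolding cylinder_events_def
    by (intro CollectI conjI exI[of _ "{r}"] exI[of _ "\<lambda>_. B"]) (auto intro!: AE_I2)
next
  fix A assume A: "A \<in> null_sets M"
  then have "AE \<omega> in M. \<omega> \<notin> A" by (rule AE_not_in)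
  then show "A \<in> cylinder_events s" using A assms
    unfolding cylinder_events_def
    by (intro CollectI conjI exI[of _ "{0}"] exI[of _ "\<lambda>_. {}"]) auto
qed

text \<open>Order the finitely many times of a cylinder event into a chain from \<open>0\<close> to \<open>s\<close> and append \<open>t\<close>.
  The values of the path along the chain are partial sums of the increments, so the event depends
  only on the increments before the last one, and joint independence of the increments applies.\<close>

lemma cylinder_event_indep_increment:
  assumes st: "0 \<le> s" "s \<le> t" "t \<le> T" and A: "A \<in> cylinder_events s" and D: "D \<in> sets borel"
  shows "prob (A \<inter> ((\<lambda>\<omega>. W t \<omega> - W s \<omega>) -` D \<inter> space M)) =
    prob A * prob ((\<lambda>\<omega>. W t \<omega> - W s \<omega>) -` D \<inter> space M)"
proof -
  obtain S B where S: "finite S" "S \<subseteq> {0..s}" "\<forall>r\<in>S. B r \<in> sets borel"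
    and AE_A: "AE \<omega> in M. \<omega> \<in> A \<longleftrightarrow> (\<forall>r\<in>S. W r \<omega> \<in> B r)" and A_M: "A \<in> events"
    using A unfolding cylinder_events_def by auto
  \<comment> \<open>Adding \<open>0\<close> makes the partial sums start at a known value; adding \<open>s\<close> makes the last increment
      of the chain exactly the one of the claim.\<close>
  define S0 where "S0 = insert 0 (insert s S)"
  define l where "l = sorted_list_of_set S0"
  define n where "n = length l - 1"
  have fin: "finite S0" using S by (simp add: S0_def)
  have set_l: "set l = S0" using fin by (simp add: l_def)
  have sorted: "sorted l" by (simp add: l_def)
  have len: "length l = Suc n" using set_l by (cases l) (auto simp: n_def S0_def)
  have range: "l ! i \<in> {0..s}" if "i \<le> n" for i
    using nth_mem[of i l] that len set_l S st by (auto simp: S0_def)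
  have l0: "l ! 0 = 0"
  proof -
    obtain i where "i \<le> n" "l ! i = 0"
      using set_l len by (metis S0_def in_set_conv_nth insertI1 less_Suc_eq_le)
    then have "l ! 0 \<le> 0" using sorted len by (metis le0 less_Suc_eq_le sorted_nth_mono)
    then show ?thesis using range[of 0] by auto
  qed
  have ln: "l ! n = s"
  proof -
    obtain i where "i \<le> n" "l ! i = s"
      using set_l len by (metis S0_def in_set_conv_nth insertI1 insertI2 less_Suc_eq_le)
    then have "s \<le> l ! n" using sorted len by (metis lessI sorted_nth_mono)
    then show ?thesis using range[of n] by auto
  qed
  define \<tau> where "\<tau> i = (if i \<le> n then l ! i else t)" for i
  define X where "X i \<omega> = W (\<tau> (Suc i)) \<omega> - W (\<tau> i) \<omega>" for i \<omega>
  have "\<forall>i\<le>Suc n. \<tau> i \<in> {0..T}"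
    using range st by (force simp: \<tau>_def)
  moreover have "\<forall>i<Suc n. \<tau> i \<le> \<tau> (Suc i)"
    using sorted len ln st by (auto simp: \<tau>_def less_Suc_eq intro!: sorted_nth_mono)
  ultimately have ind: "indep_vars (\<lambda>_. borel) X {..<Suc n}"
    using bm unfolding brownian_motion_def X_def[abs_def] by blast
  have X_n: "X n = (\<lambda>\<omega>. W t \<omega> - W s \<omega>)"
    by (auto simp: X_def \<tau>_def ln)
  have ind2: "indep_var (PiM {..<n} (\<lambda>_. borel)) (\<lambda>\<omega>. restrict (\<lambda>i. X i \<omega>) {..<n})
     (PiM {n} (\<lambda>_. borel)) (\<lambda>\<omega>. restrict (\<lambda>i. X i \<omega>) {n})"
    by (rule indep_var_restrict[OF ind]) auto
  define C where "C = {g \<in> space (PiM {..<n} (\<lambda>_. borel :: real measure)).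
      \<forall>j\<in>{j. j \<le> n \<and> l ! j \<in> S}. (\<Sum>i<j. g i) \<in> B (l ! j)}"
  have [measurable]: "C \<in> sets (PiM {..<n} (\<lambda>_. borel))"
    unfolding C_def
  proof (rule sets.sets_Collect_finite_All)
    fix j assume j: "j \<in> {j. j \<le> n \<and> l ! j \<in> S}"
    have "(\<lambda>g. \<Sum>i<j. g i) \<in> borel_measurable (PiM {..<n} (\<lambda>_. borel :: real measure))"
      using j by (intro borel_measurable_sum measurable_component_singleton) auto
    moreover have "B (l ! j) \<in> sets borel" using j S by auto
    ultimately show "{g \<in> space (PiM {..<n} (\<lambda>_. borel :: real measure)). (\<Sum>i<j. g i) \<in> B (l ! j)}
        \<in> sets (PiM {..<n} (\<lambda>_. borel))"
      by (auto simp: vimage_def Int_def conj_commute dest!: measurable_sets)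
  qed simp
  define D' where "D' = {g \<in> space (PiM {n} (\<lambda>_. borel :: real measure)). g n \<in> D}"
  have [measurable]: "D' \<in> sets (PiM {n} (\<lambda>_. borel))"
    using D unfolding D'_def by measurable
  let ?A = "(\<lambda>\<omega>. restrict (\<lambda>i. X i \<omega>) {..<n}) -` C \<inter> space M"
  let ?D = "(\<lambda>\<omega>. restrict (\<lambda>i. X i \<omega>) {n}) -` D' \<inter> space M"
  have D_eq: "?D = (\<lambda>\<omega>. W t \<omega> - W s \<omega>) -` D \<inter> space M"
    by (auto simp: D'_def space_PiM X_n)
  have A_eq: "AE \<omega> in M. \<omega> \<in> A \<longleftrightarrow> \<omega> \<in> ?A"
    using AE_A W_0 AE_space
  proof eventually_elim
    fix \<omega> assume w: "\<omega> \<in> A \<longleftrightarrow> (\<forall>r\<in>S. W r \<omega> \<in> B r)" and "W 0 \<omega> = 0" "\<omega> \<in> space M"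
    have sum: "(\<Sum>i<j. X i \<omega>) = W (l ! j) \<omega>" if "j \<le> n" for j
    proof -
      have "(\<Sum>i<j. X i \<omega>) = (\<Sum>i<j. W (\<tau> (Suc i)) \<omega> - W (\<tau> i) \<omega>)" by (simp add: X_def)
      also have "\<dots> = W (\<tau> j) \<omega> - W (\<tau> 0) \<omega>" by (rule sum_lessThan_telescope)
      finally show ?thesis using that \<open>W 0 \<omega> = 0\<close> by (simp add: \<tau>_def l0)
    qed
    have "(\<forall>r\<in>S. W r \<omega> \<in> B r) \<longleftrightarrow> (\<forall>j\<le>n. l ! j \<in> S \<longrightarrow> W (l ! j) \<omega> \<in> B (l ! j))"
    proof safe
      fix r assume r: "\<forall>j\<le>n. l ! j \<in> S \<longrightarrow> W (l ! j) \<omega> \<in> B (l ! j)" "r \<in> S"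
      then obtain j where "j \<le> n" "r = l ! j"
        using set_l len by (metis S0_def in_set_conv_nth insertCI less_Suc_eq_le)
      then show "W r \<omega> \<in> B r" using r by auto
    qed blast
    also have "\<dots> \<longleftrightarrow> (\<forall>j\<le>n. l ! j \<in> S \<longrightarrow> (\<Sum>i<j. restrict (\<lambda>i. X i \<omega>) {..<n} i) \<in> B (l ! j))"
      by (simp add: sum[symmetric])
    finally have "(\<forall>r\<in>S. W r \<omega> \<in> B r) \<longleftrightarrow> (\<lambda>i\<in>{..<n}. X i \<omega>) \<in> C"
      by (auto simp: C_def space_PiM)
    then show "\<omega> \<in> A \<longleftrightarrow> \<omega> \<in> ?A" using w \<open>\<omega> \<in> space M\<close> by simp
  qed
  have [measurable]: "(\<lambda>\<omega>. restrict (\<lambda>i. X i \<omega>) {..<n}) \<in> measurable M (PiM {..<n} (\<lambda>_. borel))"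
    "(\<lambda>\<omega>. restrict (\<lambda>i. X i \<omega>) {n}) \<in> measurable M (PiM {n} (\<lambda>_. borel))"
    using ind2 by (auto simp: indep_var_eq)
  have "prob (A \<inter> ?D) = prob (?A \<inter> ?D)"
    using A_eq A_M by (intro measure_eq_AE) auto
  also have "?A \<inter> ?D = (\<lambda>\<omega>. (restrict (\<lambda>i. X i \<omega>) {..<n}, restrict (\<lambda>i. X i \<omega>) {n})) -` (C \<times> D') \<inter> space M"
    by auto
  also have "prob \<dots> = prob ?A * prob ?D"
    by (rule indep_varD[OF ind2]) measurable
  also have "prob ?A = prob A"
    using A_eq A_M by (intro measure_eq_AE) auto
  finally show ?thesis unfolding D_eq .
qed

text \<open>Both families are closed under intersection, so independence extends to the generated
  sigma algebras by Dynkin's lemma.\<close>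

lemma indep_set_F_increment:
  assumes st: "0 \<le> s" "s \<le> t" "t \<le> T"
  shows "indep_set (sets (F s))
    (sigma_sets (space M) {(\<lambda>\<omega>. W t \<omega> - W s \<omega>) -` D \<inter> space M |D. D \<in> sets borel})"
proof -
  let ?V = "{(\<lambda>\<omega>. W t \<omega> - W s \<omega>) -` D \<inter> space M |D. D \<in> sets borel}"
  have m: "(\<lambda>\<omega>. W t \<omega> - W s \<omega>) \<in> borel_measurable M"
    using st by (intro borel_measurable_diff W_measurable) auto
  have "indep_set (sigma_sets (space M) (cylinder_events s)) (sigma_sets (space M) ?V)"
  proof (rule indep_set_sigma_sets[OF _ Int_stable_cylinder_events])
    show "indep_set (cylinder_events s) ?V"
    proof (rule indep_setI)
      show "cylinder_events s \<subseteq> events" by (auto simp: cylinder_events_def)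
      show "?V \<subseteq> events" using m by (auto intro: measurable_sets)
    qed (auto intro: cylinder_event_indep_increment[OF st])
    show "Int_stable ?V"
      unfolding Int_stable_def
    proof safe
      fix D D' :: "real set" assume "D \<in> sets borel" "D' \<in> sets borel"
      then show "\<exists>E. ((\<lambda>\<omega>. W t \<omega> - W s \<omega>) -` D \<inter> space M) \<inter> ((\<lambda>\<omega>. W t \<omega> - W s \<omega>) -` D' \<inter> space M)
          = (\<lambda>\<omega>. W t \<omega> - W s \<omega>) -` E \<inter> space M \<and> E \<in> sets borel"
        by (intro exI[of _ "D \<inter> D'"]) auto
    qed
  qed
  then show ?thesis
    by (rule indep_set_mono[OF _ sets_F_cylinder order_refl]) (use st in simp_all)
qed

lemma indep_var_F_increment:
  fixes g :: "'w \<Rightarrow> real"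
  assumes st: "0 \<le> s" "s \<le> t" "t \<le> T" and g: "g \<in> borel_measurable (F s)"
  shows "indep_var borel g borel (\<lambda>\<omega>. W t \<omega> - W s \<omega>)"
proof -
  have "sigma_sets (space M) {g -` A \<inter> space M |A. A \<in> sets borel} \<subseteq> sets (F s)"
    by (rule sets.sigma_sets_subset[of _ "F s", unfolded space_F])
      (use measurable_sets[OF g] in auto)
  then have "indep_set (sigma_sets (space M) {g -` A \<inter> space M |A. A \<in> sets borel})
      (sigma_sets (space M) {(\<lambda>\<omega>. W t \<omega> - W s \<omega>) -` D \<inter> space M |D. D \<in> sets borel})"
    by (rule indep_set_mono[OF indep_set_F_increment[OF st] _ order_refl])
  moreover have "g \<in> borel_measurable M" "(\<lambda>\<omega>. W t \<omega> - W s \<omega>) \<in> borel_measurable M"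
    using st by (auto intro!: borel_measurable_diff W_measurable measurable_F_M[OF g])
  ultimately show ?thesis
    unfolding indep_var_eq by blast
qed

lemma increment_moments:
  assumes st: "0 \<le> s" "s \<le> t" "t \<le> T"
  shows "integrable M (\<lambda>\<omega>. W t \<omega> - W s \<omega>)" "expectation (\<lambda>\<omega>. W t \<omega> - W s \<omega>) = 0"
    "integrable M (\<lambda>\<omega>. (W t \<omega> - W s \<omega>)\<^sup>2)" "expectation (\<lambda>\<omega>. (W t \<omega> - W s \<omega>)\<^sup>2) = t - s"
proof -
  consider "s = t" | "s < t" using st by linarith
  then have "integrable M (\<lambda>\<omega>. W t \<omega> - W s \<omega>) \<and> expectation (\<lambda>\<omega>. W t \<omega> - W s \<omega>) = 0 \<and>
    integrable M (\<lambda>\<omega>. (W t \<omega> - W s \<omega>)\<^sup>2) \<and> expectation (\<lambda>\<omega>. (W t \<omega> - W s \<omega>)\<^sup>2) = t - s"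
  proof cases
    case 2
    have D: "distributed M lborel (\<lambda>\<omega>. W t \<omega> - W s \<omega>) (normal_density 0 (sqrt (t - s)))"
      using W_increment_normal 2 st by simp
    have E: "expectation (\<lambda>\<omega>. W t \<omega> - W s \<omega>) = 0"
      using normal_distributed_expectation[OF _ D] 2 by simp
    have V: "variance (\<lambda>\<omega>. W t \<omega> - W s \<omega>) = t - s"
      using normal_distributed_variance[OF _ D] 2 by simp
    have I1: "integrable M (\<lambda>\<omega>. W t \<omega> - W s \<omega>)"
      using distributed_integrable[OF D, of "\<lambda>x. x"] integrable_normal_moment[of "sqrt (t - s)" 0 1] 2 by simp
    have I2: "integrable M (\<lambda>\<omega>. (W t \<omega> - W s \<omega>)\<^sup>2)"
      using distributed_integrable[OF D, of "\<lambda>x. x\<^sup>2"] integrable_normal_moment[of "sqrt (t - s)" 0 2] 2 by simp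
    show ?thesis using I1 I2 V E by simp
  qed auto
  then show "integrable M (\<lambda>\<omega>. W t \<omega> - W s \<omega>)" "expectation (\<lambda>\<omega>. W t \<omega> - W s \<omega>) = 0"
    "integrable M (\<lambda>\<omega>. (W t \<omega> - W s \<omega>)\<^sup>2)" "expectation (\<lambda>\<omega>. (W t \<omega> - W s \<omega>)\<^sup>2) = t - s" by blast+
qed


text \<open>The last increment is independent of the product of everything before it and has mean zero.\<close>

lemma increment_mult_zero:
  assumes ord: "0 \<le> p" "p \<le> q" "q \<le> s" "s \<le> t" "t \<le> T"
    and G: "G \<in> borel_measurable (F s)" "\<And>\<omega>. \<omega> \<in> space M \<Longrightarrow> \<bar>G \<omega>\<bar> \<le> K"
  shows "has_bochner_integral M (\<lambda>\<omega>. (W q \<omega> - W p \<omega>) * (W t \<omega> - W s \<omega>) * G \<omega>) (0::real)"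
proof -
  have "G \<in> borel_measurable M" using measurable_F_M[OF G(1)] ord by simp
  have i1: "integrable M (\<lambda>\<omega>. G \<omega> * (W q \<omega> - W p \<omega>))"
  proof (rule Bochner_Integration.integrable_bound)
    show "integrable M (\<lambda>\<omega>. K * (W q \<omega> - W p \<omega>))"
      using increment_moments(1)[of p q] ord by simp
    show "AE \<omega> in M. norm (G \<omega> * (W q \<omega> - W p \<omega>)) \<le> norm (K * (W q \<omega> - W p \<omega>))"
      using G(2) by (intro AE_I2) (fastforce simp: abs_mult intro!: mult_right_mono)
  qed (use ord \<open>G \<in> borel_measurable M\<close> in \<open>auto intro!: borel_measurable_times borel_measurable_diff W_measurable\<close>)
  have "indep_var borel (\<lambda>\<omega>. G \<omega> * (W q \<omega> - W p \<omega>)) borel (\<lambda>\<omega>. W t \<omega> - W s \<omega>)"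
    using ord G by (intro indep_var_F_increment borel_measurable_times borel_measurable_diff W_measurable_F) auto
  from indep_var_lebesgue_integral[OF this i1] indep_var_integrable[OF this i1] increment_moments[of s t] ord
  show ?thesis by (simp add: has_bochner_integral_iff mult_ac)
qed

lemma increment_square:
  assumes ord: "0 \<le> s" "s \<le> t" "t \<le> T"
    and G: "G \<in> borel_measurable (F s)" "\<And>\<omega>. \<omega> \<in> space M \<Longrightarrow> \<bar>G \<omega>\<bar> \<le> K"
  shows "has_bochner_integral M (\<lambda>\<omega>. (W t \<omega> - W s \<omega>)\<^sup>2 * G \<omega>) ((t - s) * expectation G)"
proof -
  have G_M: "G \<in> borel_measurable M" using measurable_F_M[OF G(1)] ord by simp
  have i1: "integrable M G"
    by (rule integrable_const_bound[of _ K]) (use G G_M in auto)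
  have "indep_var borel ((\<lambda>x. x) \<circ> G) borel ((\<lambda>x. x\<^sup>2) \<circ> (\<lambda>\<omega>. W t \<omega> - W s \<omega>))"
    by (rule indep_var_compose[OF indep_var_F_increment[OF ord G(1)]]) auto
  then have "indep_var borel G borel (\<lambda>\<omega>. (W t \<omega> - W s \<omega>)\<^sup>2)" by (simp add: comp_def)
  from indep_var_lebesgue_integral[OF this i1] indep_var_integrable[OF this i1] increment_moments[of s t] ord
  show ?thesis by (simp add: has_bochner_integral_iff mult_ac)
qed

text \<open>Pieces of the two intervals that lie apart are uncorrelated, so only the overlap contributes. The
  intervals may be in arbitrary position, so that elementary integrands on different partitions can
  be compared without passing to a common refinement.\<close>

lemma increment_covariance:
  assumes ab: "0 \<le> a" "a \<le> b" "b \<le> T" and cd: "0 \<le> c" "c \<le> d" "d \<le> T"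
    and G: "G \<in> borel_measurable (F (max a c))" "\<And>\<omega>. \<omega> \<in> space M \<Longrightarrow> \<bar>G \<omega>\<bar> \<le> K"
  shows "has_bochner_integral M (\<lambda>\<omega>. (W b \<omega> - W a \<omega>) * (W d \<omega> - W c \<omega>) * G \<omega>)
    (max 0 (min b d - max a c) * expectation G)"
  using assms
proof (induction a c arbitrary: b d rule: linorder_wlog)
  case (le a c)
  have G: "G \<in> borel_measurable (F c)" using le by (simp add: max_absorb2)
  note ord = le(1-7)
  show ?case
  proof (cases "b \<le> c")
    case True
    then have "min b d - max a c \<le> 0" by auto
    then have "max 0 (min b d - max a c) = 0" by (rule max_absorb1)
    then show ?thesis using increment_mult_zero[of a b c d G K] G le True by simp
  next
    case False
    define e where "e = min b d"
    have e: "c \<le> e" "e \<le> b" "e \<le> d" "0 \<le> e" "e \<le> T" "e = b \<or> e = d" using False le by (auto simp: e_def min_def)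
    have Ge: "G \<in> borel_measurable (F e)" using G e by (auto intro: measurable_F_mono)
    \<comment> \<open>Cut both intervals at \<open>c\<close> and at \<open>e\<close>: the overlap yields a square, all other pairs of pieces
        are disjoint; behind \<open>e\<close> only one of the two intervals continues.\<close>
    have "has_bochner_integral M
       (\<lambda>\<omega>. (W c \<omega> - W a \<omega>) * (W d \<omega> - W c \<omega>) * G \<omega> + (W e \<omega> - W c \<omega>)\<^sup>2 * G \<omega>
         + (W e \<omega> - W c \<omega>) * (W d \<omega> - W e \<omega>) * G \<omega> + (W e \<omega> - W c \<omega>) * (W b \<omega> - W e \<omega>) * G \<omega>)
       (0 + (e - c) * expectation G + 0 + 0)"
      using ord e by (intro has_bochner_integral_add increment_mult_zero[where K=K]
          increment_square[where K=K] G Ge le(9)) auto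
    moreover have "(W c \<omega> - W a \<omega>) * (W d \<omega> - W c \<omega>) * G \<omega> + (W e \<omega> - W c \<omega>)\<^sup>2 * G \<omega>
         + (W e \<omega> - W c \<omega>) * (W d \<omega> - W e \<omega>) * G \<omega> + (W e \<omega> - W c \<omega>) * (W b \<omega> - W e \<omega>) * G \<omega>
         = (W b \<omega> - W a \<omega>) * (W d \<omega> - W c \<omega>) * G \<omega>" for \<omega>
      using e(6) by (auto simp: algebra_simps power2_eq_square)
    moreover have "max 0 (min b d - max a c) = e - c"
      using e le(1) by (simp add: e_def max_def)
    ultimately show ?thesis by simp
  qed
next
  case (sym a c)
  from sym(1)[of d b] sym(2-) show ?case by (simp add: max.commute min.commute mult_ac)
qed

end

section \<open>An isometry estimate for the It\^o integral\<close>

context brownian_space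
begin

text \<open>Expanding the squared norms turns both sides into the same double sum, whose coefficients are the
  lengths of the pairwise overlaps.\<close>

lemma elementary_isometry:
  fixes \<xi> :: "'i \<Rightarrow> 'w \<Rightarrow> 'a::euclidean_space"
  assumes I: "finite I" and t: "t \<le> T"
    and ord: "\<And>i. i \<in> I \<Longrightarrow> 0 \<le> a i \<and> a i \<le> b i \<and> b i \<le> t"
    and \<xi>: "\<And>i. i \<in> I \<Longrightarrow> \<xi> i \<in> borel_measurable (F (a i)) \<and> bounded (\<xi> i ` space M)"
  shows "(\<integral>\<^sup>+\<omega>. ennreal ((norm (\<Sum>i\<in>I. (W (b i) \<omega> - W (a i) \<omega>) *\<^sub>R \<xi> i \<omega>))\<^sup>2) \<partial>M) =
    (\<integral>\<^sup>+\<omega>. (\<integral>\<^sup>+s\<in>{0..t}. ennreal ((norm (\<Sum>i\<in>I. indicator {a i<..b i} s *\<^sub>R \<xi> i \<omega>))\<^sup>2) \<partial>lborel) \<partial>M)"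
proof -
  define G where "G i j \<omega> = \<xi> i \<omega> \<bullet> \<xi> j \<omega>" for i j \<omega>
  define ov where "ov i j = max 0 (min (b i) (b j) - max (a i) (a j))" for i j
  have G_meas: "G i j \<in> borel_measurable (F (max (a i) (a j)))" if "i \<in> I" "j \<in> I" for i j
    unfolding G_def
    by (intro borel_measurable_inner measurable_F_mono[OF conjunct1[OF \<xi>]]) (use that in auto)
  have G_bd: "\<exists>K. \<forall>\<omega>\<in>space M. \<bar>G i j \<omega>\<bar> \<le> K" if "i \<in> I" "j \<in> I" for i j
  proof -
    obtain K1 K2 where "\<forall>\<omega>\<in>space M. norm (\<xi> i \<omega>) \<le> K1" "\<forall>\<omega>\<in>space M. norm (\<xi> j \<omega>) \<le> K2"
      using \<xi>[OF \<open>i \<in> I\<close>] \<xi>[OF \<open>j \<in> I\<close>] unfolding bounded_iff by auto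
    then have "\<forall>\<omega>\<in>space M. \<bar>G i j \<omega>\<bar> \<le> K1 * K2"
      unfolding G_def by (meson Cauchy_Schwarz_ineq2 mult_mono norm_ge_zero order_trans)
    then show ?thesis by blast
  qed
  have G_int: "integrable M (G i j)" if ij: "i \<in> I" "j \<in> I" for i j
  proof -
    have "max (a i) (a j) \<le> T" using ord[OF ij(1)] ord[OF ij(2)] t by auto
    moreover obtain K where "\<forall>\<omega>\<in>space M. \<bar>G i j \<omega>\<bar> \<le> K" using G_bd[OF ij] by blast
    ultimately show ?thesis
      using measurable_F_M[OF G_meas[OF ij]] by (intro integrable_const_bound[of _ K]) auto
  qed
  have norm_sum: "(norm (\<Sum>i\<in>I. c i *\<^sub>R \<xi> i \<omega>))\<^sup>2 = (\<Sum>i\<in>I. \<Sum>j\<in>I. c i * c j * G i j \<omega>)" for c \<omega>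
    by (simp add: power2_norm_eq_inner inner_sum_left inner_sum_right G_def sum_distrib_left
        mult_ac inner_commute)
  let ?v = "\<Sum>i\<in>I. \<Sum>j\<in>I. ov i j * expectation (G i j)"
  have 1: "has_bochner_integral M
      (\<lambda>\<omega>. (norm (\<Sum>i\<in>I. (W (b i) \<omega> - W (a i) \<omega>) *\<^sub>R \<xi> i \<omega>))\<^sup>2) ?v"
    unfolding norm_sum
  proof (intro has_bochner_integral_sum)
    fix i j assume ij: "i \<in> I" "j \<in> I"
    obtain K where K: "\<forall>\<omega>\<in>space M. \<bar>G i j \<omega>\<bar> \<le> K" using G_bd[OF ij] by blast
    show "has_bochner_integral M (\<lambda>\<omega>. (W (b i) \<omega> - W (a i) \<omega>) * (W (b j) \<omega> - W (a j) \<omega>) * G i j \<omega>)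
         (ov i j * expectation (G i j))"
      unfolding ov_def
      by (rule increment_covariance[where K=K]) (use ord[OF ij(1)] ord[OF ij(2)] t G_meas[OF ij] K in auto)
  qed
  have 2: "has_bochner_integral lborel (\<lambda>s. (norm (\<Sum>i\<in>I. indicator {a i<..b i} s *\<^sub>R \<xi> i \<omega>))\<^sup>2)
      (\<Sum>i\<in>I. \<Sum>j\<in>I. ov i j * G i j \<omega>)" for \<omega>
    unfolding norm_sum
  proof (intro has_bochner_integral_sum has_bochner_integral_mult_left)
    fix i j assume ij: "i \<in> I" "j \<in> I"
    have "indicator {a i<..b i} s * indicator {a j<..b j} s =
        (indicator {max (a i) (a j)<..min (b i) (b j)} s :: real)" for s
      by (auto simp: indicator_def)
    moreover have "has_bochner_integral lborel (indicator {max (a i) (a j)<..min (b i) (b j)}) (ov i j)"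
    proof (cases "max (a i) (a j) \<le> min (b i) (b j)")
      case True
      then show ?thesis
        unfolding ov_def has_bochner_integral_iff by (simp add: max_absorb2)
    next
      case False
      then have "{max (a i) (a j)<..min (b i) (b j)} = {}" "ov i j = 0"
        by (simp_all only: greaterThanAtMost_empty_iff ov_def max_def not_le not_less) auto
      then show ?thesis by (simp only:) (simp add: has_bochner_integral_iff)
    qed
    ultimately show "has_bochner_integral lborel
        (\<lambda>s. indicator {a i<..b i} s * indicator {a j<..b j} s) (ov i j)" by simp
  qed
  have 3: "has_bochner_integral M (\<lambda>\<omega>. \<Sum>i\<in>I. \<Sum>j\<in>I. ov i j * G i j \<omega>) ?v"
    using G_int by (intro has_bochner_integral_sum has_bochner_integral_mult_right)
      (auto simp: has_bochner_integral_iff)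
  have nonneg: "(\<Sum>i\<in>I. \<Sum>j\<in>I. ov i j * G i j \<omega>) \<ge> 0" for \<omega>
    using 2[of \<omega>] Bochner_Integration.integral_nonneg[of lborel
        "\<lambda>s. (norm (\<Sum>i\<in>I. indicator {a i<..b i} s *\<^sub>R \<xi> i \<omega>))\<^sup>2"]
    by (simp add: has_bochner_integral_iff)
  have inner: "(\<integral>\<^sup>+s\<in>{0..t}. ennreal ((norm (\<Sum>i\<in>I. indicator {a i<..b i} s *\<^sub>R \<xi> i \<omega>))\<^sup>2) \<partial>lborel)
      = ennreal (\<Sum>i\<in>I. \<Sum>j\<in>I. ov i j * G i j \<omega>)" for \<omega>
  proof -
    have "ennreal ((norm (\<Sum>i\<in>I. indicator {a i<..b i} s *\<^sub>R \<xi> i \<omega>))\<^sup>2) * indicator {0..t} s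
        = ennreal ((norm (\<Sum>i\<in>I. indicator {a i<..b i} s *\<^sub>R \<xi> i \<omega>))\<^sup>2)" for s
    proof (cases "s \<in> {0..t}")
      case False
      then have "indicator {a i<..b i} s = (0::real)" if "i \<in> I" for i
        using ord[OF that] by (auto simp: indicator_def)
      then show ?thesis by simp
    qed simp
    then show ?thesis
      using nn_integral_eq_integral[of lborel "\<lambda>s. (norm (\<Sum>i\<in>I. indicator {a i<..b i} s *\<^sub>R \<xi> i \<omega>))\<^sup>2"] 2[of \<omega>]
      by (simp add: has_bochner_integral_iff)
  qed
  show ?thesis
    unfolding inner
    using nn_integral_eq_integral[of M "\<lambda>\<omega>. \<Sum>i\<in>I. \<Sum>j\<in>I. ov i j * G i j \<omega>"] 3 nonneg
      nn_integral_eq_integral[of M "\<lambda>\<omega>. (norm (\<Sum>i\<in>I. (W (b i) \<omega> - W (a i) \<omega>) *\<^sub>R \<xi> i \<omega>))\<^sup>2"] 1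
    by (simp add: has_bochner_integral_iff)
qed

end

abbreviation time_interval :: "real \<Rightarrow> real measure" where
  "time_interval t \<equiv> restrict_space borel {0..t}"

text \<open>Joint measurability of processes is stated over the Borel sets of the time interval, while
  integration needs Lebesgue measure on it; the two product spaces have the same measurable sets.\<close>

abbreviation time_prob :: "'w measure \<Rightarrow> real \<Rightarrow> (real \<times> 'w) measure" where
  "time_prob M t \<equiv> restrict_space lborel {0..t} \<Otimes>\<^sub>M M"

lemma sets_time_prob: "sets (time_prob M t) = sets (time_interval t \<Otimes>\<^sub>M M)"
  by (intro sets_pair_measure_cong sets_restrict_space_cong) auto

lemma borel_measurable_time_prob:
  "borel_measurable (time_prob M t) = borel_measurable (time_interval t \<Otimes>\<^sub>M M)"
  by (intro measurable_cong_sets sets_time_prob refl)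

context prob_space
begin

lemma pair_sigma_finite_time_prob: "pair_sigma_finite (restrict_space lborel {0..t::real}) M"
  by (intro pair_sigma_finite.intro sigma_finite_measure_restrict_space) (auto intro: sigma_finite_measure_axioms lborel.sigma_finite_measure_axioms)

lemma nn_integral_time_prob:
  assumes f: "f \<in> borel_measurable (time_interval t \<Otimes>\<^sub>M M)"
  shows "(\<integral>\<^sup>+\<omega>. (\<integral>\<^sup>+s\<in>{0..t}. f (s, \<omega>) \<partial>lborel) \<partial>M) = (\<integral>\<^sup>+p. f p \<partial>time_prob M t)"
    and "(\<integral>\<^sup>+s\<in>{0..t}. (\<integral>\<^sup>+\<omega>. f (s, \<omega>) \<partial>M) \<partial>lborel) = (\<integral>\<^sup>+p. f p \<partial>time_prob M t)"
proof -
  interpret P: pair_sigma_finite "restrict_space lborel {0..t}" M by (rule pair_sigma_finite_time_prob)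
  have [measurable]: "f \<in> borel_measurable (time_prob M t)"
    using f by (simp add: borel_measurable_time_prob)
  have "(\<integral>\<^sup>+p. f p \<partial>time_prob M t) = (\<integral>\<^sup>+\<omega>. (\<integral>\<^sup>+s. f (s, \<omega>) \<partial>restrict_space lborel {0..t}) \<partial>M)"
    by (rule P.nn_integral_snd[symmetric]) measurable
  then show "(\<integral>\<^sup>+\<omega>. (\<integral>\<^sup>+s\<in>{0..t}. f (s, \<omega>) \<partial>lborel) \<partial>M) = (\<integral>\<^sup>+p. f p \<partial>time_prob M t)"
    by (simp add: nn_integral_restrict_space)
  have "(\<integral>\<^sup>+p. f p \<partial>time_prob M t) = (\<integral>\<^sup>+s. (\<integral>\<^sup>+\<omega>. f (s, \<omega>) \<partial>M) \<partial>restrict_space lborel {0..t})"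
    by (rule nn_integral_fst[symmetric]) measurable
  then show "(\<integral>\<^sup>+s\<in>{0..t}. (\<integral>\<^sup>+\<omega>. f (s, \<omega>) \<partial>M) \<partial>lborel) = (\<integral>\<^sup>+p. f p \<partial>time_prob M t)"
    by (simp add: nn_integral_restrict_space)
qed

end

lemma norm_sum3_square_le:
  fixes x y z :: "'a::real_normed_vector"
  assumes "norm w \<le> norm x + norm y + norm z"
  shows "(norm w)\<^sup>2 \<le> 3 * ((norm x)\<^sup>2 + (norm y)\<^sup>2 + (norm z)\<^sup>2)"
proof -
  have "(norm w)\<^sup>2 \<le> (norm x + norm y + norm z)\<^sup>2" using assms by (intro power_mono) auto
  also have "\<dots> = 3 * ((norm x)\<^sup>2 + (norm y)\<^sup>2 + (norm z)\<^sup>2)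
      - ((norm x - norm y)\<^sup>2 + (norm y - norm z)\<^sup>2 + (norm x - norm z)\<^sup>2)"
    by (simp add: power2_eq_square algebra_simps)
  also have "\<dots> \<le> 3 * ((norm x)\<^sup>2 + (norm y)\<^sup>2 + (norm z)\<^sup>2)"
    using zero_le_power2[of "norm x - norm y"] zero_le_power2[of "norm y - norm z"]
      zero_le_power2[of "norm x - norm z"] by linarith
  finally show ?thesis .
qed

text \<open>A substitute for Minkowski's inequality that stays within squared norms; the constant is
  immaterial for all uses below.\<close>

lemma nn_integral_norm_sum3:
  fixes f :: "'b \<Rightarrow> 'a::euclidean_space"
  assumes [measurable]: "g1 \<in> borel_measurable N" "g2 \<in> borel_measurable N" "g3 \<in> borel_measurable N"
    and g: "\<And>p. p \<in> space N \<Longrightarrow> norm (f p) \<le> norm (g1 p :: 'a) + norm (g2 p :: 'a) + norm (g3 p :: 'a)"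
  shows "(\<integral>\<^sup>+p. ennreal ((norm (f p))\<^sup>2) \<partial>N) \<le>
    3 * ((\<integral>\<^sup>+p. ennreal ((norm (g1 p))\<^sup>2) \<partial>N) + (\<integral>\<^sup>+p. ennreal ((norm (g2 p))\<^sup>2) \<partial>N) + (\<integral>\<^sup>+p. ennreal ((norm (g3 p))\<^sup>2) \<partial>N))"
proof -
  have "(\<integral>\<^sup>+p. ennreal ((norm (f p))\<^sup>2) \<partial>N) \<le>
      (\<integral>\<^sup>+p. 3 * (ennreal ((norm (g1 p))\<^sup>2) + ennreal ((norm (g2 p))\<^sup>2) + ennreal ((norm (g3 p))\<^sup>2)) \<partial>N)"
  proof (rule nn_integral_mono)
    fix p assume "p \<in> space N"
    have "(norm (f p))\<^sup>2 \<le> 3 * ((norm (g1 p))\<^sup>2 + (norm (g2 p))\<^sup>2 + (norm (g3 p))\<^sup>2)"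
      by (rule norm_sum3_square_le[OF g]) fact
    then show "ennreal ((norm (f p))\<^sup>2) \<le>
        3 * (ennreal ((norm (g1 p))\<^sup>2) + ennreal ((norm (g2 p))\<^sup>2) + ennreal ((norm (g3 p))\<^sup>2))"
      by (simp add: ennreal_mult[symmetric] ennreal_plus[symmetric] ennreal_numeral[symmetric]
          del: ennreal_plus ennreal_numeral)
  qed
  then show ?thesis by (simp add: nn_integral_cmult nn_integral_add)
qed

context brownian_space
begin

lemma elementary_process_measurable:
  assumes "elementary_data M F t k \<tau> \<xi>" "t \<le> T"
  shows "(\<lambda>(s, \<omega>). elementary_process k \<tau> \<xi> s \<omega>) \<in> borel_measurable (time_interval t \<Otimes>\<^sub>M M)"
proof -
  have [measurable]: "\<xi> i \<in> borel_measurable M" if "i < k" for i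
    using that assms
    by (intro measurable_F_M[of "\<xi> i" "\<tau> i"])
      (auto simp: elementary_data_def intro!: order_trans[OF _ assms(2)])
  have [measurable]: "(\<lambda>s. indicator {\<tau> i<..\<tau> (Suc i)} s :: real) \<in> borel_measurable (time_interval t)" for i
    by (intro measurable_restrict_space1) measurable
  show ?thesis unfolding elementary_process_def by measurable
qed

lemma elementary_integral_measurable:
  assumes "elementary_data M F t k \<tau> \<xi>" "t \<le> T"
  shows "elementary_integral W k \<tau> \<xi> \<in> borel_measurable M"
proof -
  have "\<xi> i \<in> borel_measurable M" if "i < k" for i
    using that assms
    by (intro measurable_F_M[of "\<xi> i" "\<tau> i"])
      (auto simp: elementary_data_def intro!: order_trans[OF _ assms(2)])
  moreover have "W (\<tau> i) \<in> borel_measurable M" if "i \<le> k" for i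
    using that assms by (intro W_measurable) (auto simp: elementary_data_def)
  ultimately show ?thesis unfolding elementary_integral_def[abs_def]
    by (intro borel_measurable_sum borel_measurable_scaleR borel_measurable_diff) auto
qed

text \<open>The difference of two elementary integrands is one family of weighted intervals, indexed by the
  disjoint sum of the two index sets.\<close>

lemma elementary_isometry_diff:
  fixes \<xi> \<xi>' :: "nat \<Rightarrow> 'w \<Rightarrow> 'a::euclidean_space"
  assumes e: "elementary_data M F t k \<tau> \<xi>" and e': "elementary_data M F t k' \<tau>' \<xi>'" and t: "t \<le> T"
  shows "(\<integral>\<^sup>+\<omega>. ennreal ((norm (elementary_integral W k \<tau> \<xi> \<omega> - elementary_integral W k' \<tau>' \<xi>' \<omega>))\<^sup>2) \<partial>M) =
    (\<integral>\<^sup>+\<omega>. (\<integral>\<^sup>+s\<in>{0..t}. ennreal ((norm (elementary_process k \<tau> \<xi> s \<omega> - elementary_process k' \<tau>' \<xi>' s \<omega>))\<^sup>2) \<partial>lborel) \<partial>M)"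
proof -
  define I where "I = {..<k} <+> {..<k'}"
  define a where "a = case_sum \<tau> \<tau>'"
  define b where "b = case_sum (\<lambda>i. \<tau> (Suc i)) (\<lambda>i. \<tau>' (Suc i))"
  define \<eta> where "\<eta> = case_sum \<xi> (\<lambda>i \<omega>. - \<xi>' i \<omega>)"
  have bounded_uminus: "bounded ((\<lambda>\<omega>. - g \<omega>) ` space M)" if "bounded (g ` space M)" for g :: "'w \<Rightarrow> 'a"
    using that by (simp add: bounded_iff)
  have sum: "(\<Sum>i\<in>I. c i *\<^sub>R \<eta> i \<omega>) = (\<Sum>i<k. c (Inl i) *\<^sub>R \<xi> i \<omega>) - (\<Sum>i<k'. c (Inr i) *\<^sub>R \<xi>' i \<omega>)" for c \<omega>
    by (simp add: I_def sum.Plus \<eta>_def sum_negf)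
  have "(\<integral>\<^sup>+\<omega>. ennreal ((norm (\<Sum>i\<in>I. (W (b i) \<omega> - W (a i) \<omega>) *\<^sub>R \<eta> i \<omega>))\<^sup>2) \<partial>M) =
    (\<integral>\<^sup>+\<omega>. (\<integral>\<^sup>+s\<in>{0..t}. ennreal ((norm (\<Sum>i\<in>I. indicator {a i<..b i} s *\<^sub>R \<eta> i \<omega>))\<^sup>2) \<partial>lborel) \<partial>M)"
    using e e' t
    by (intro elementary_isometry)
      (auto simp: I_def a_def b_def \<eta>_def elementary_data_def bounded_uminus)
  then show ?thesis
    unfolding sum by (simp add: a_def b_def elementary_integral_def elementary_process_def)
qed

lemma LF_space_measurable:
  "\<phi> \<in> LF_space M F t \<beta> \<alpha> \<Longrightarrow> (\<lambda>(s, \<omega>). \<phi> s \<omega>) \<in> borel_measurable (time_interval t \<Otimes>\<^sub>M M)"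
  by (simp add: LF_space_def adapted_measurable_def)

text \<open>The sharp constant is 1; splitting \<open>Z - Y\<close> and the integrands into three terms each by
  \<open>nn_integral_norm_sum3\<close> costs a factor 3 twice, hence 9.\<close>

lemma ito_integral_diff_estimate:
  fixes \<phi> \<psi> :: "real \<Rightarrow> 'w \<Rightarrow> 'a::euclidean_space"
  assumes t: "t \<le> T" and Z: "has_ito_integral M F W t \<phi> Z" and Y: "has_ito_integral M F W t \<psi> Y"
  shows "(\<integral>\<^sup>+\<omega>. ennreal ((norm (Z \<omega> - Y \<omega>))\<^sup>2) \<partial>M) \<le>
    9 * (\<integral>\<^sup>+p. ennreal ((norm (\<phi> (fst p) (snd p) - \<psi> (fst p) (snd p)))\<^sup>2) \<partial>time_prob M t)"
    (is "?A \<le> 9 * ?D")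
proof -
  obtain k \<tau> \<xi> where e: "\<And>n. elementary_data M F t (k n) (\<tau> n) (\<xi> n)"
    and p: "(\<lambda>n. \<integral>\<^sup>+\<omega>. (\<integral>\<^sup>+s\<in>{0..t}. ennreal ((norm (elementary_process (k n) (\<tau> n) (\<xi> n) s \<omega> - \<phi> s \<omega>))\<^sup>2) \<partial>lborel) \<partial>M) \<longlonglongrightarrow> 0"
    and z: "(\<lambda>n. \<integral>\<^sup>+\<omega>. ennreal ((norm (elementary_integral W (k n) (\<tau> n) (\<xi> n) \<omega> - Z \<omega>))\<^sup>2) \<partial>M) \<longlonglongrightarrow> 0"
    and [measurable]: "Z \<in> borel_measurable M" and \<phi>: "\<phi> \<in> LF_space M F t 2 2"
    using Z unfolding has_ito_integral_def by blast
  obtain k' \<tau>' \<xi>' where e': "\<And>n. elementary_data M F t (k' n) (\<tau>' n) (\<xi>' n)"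
    and p': "(\<lambda>n. \<integral>\<^sup>+\<omega>. (\<integral>\<^sup>+s\<in>{0..t}. ennreal ((norm (elementary_process (k' n) (\<tau>' n) (\<xi>' n) s \<omega> - \<psi> s \<omega>))\<^sup>2) \<partial>lborel) \<partial>M) \<longlonglongrightarrow> 0"
    and y: "(\<lambda>n. \<integral>\<^sup>+\<omega>. ennreal ((norm (elementary_integral W (k' n) (\<tau>' n) (\<xi>' n) \<omega> - Y \<omega>))\<^sup>2) \<partial>M) \<longlonglongrightarrow> 0"
    and [measurable]: "Y \<in> borel_measurable M" and \<psi>: "\<psi> \<in> LF_space M F t 2 2"
    using Y unfolding has_ito_integral_def by blast
  define E where "E n p = elementary_process (k n) (\<tau> n) (\<xi> n) (fst p) (snd p)" for n p
  define E' where "E' n p = elementary_process (k' n) (\<tau>' n) (\<xi>' n) (fst p) (snd p)" for n p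
  define I where "I n = elementary_integral W (k n) (\<tau> n) (\<xi> n)" for n
  define J where "J n = elementary_integral W (k' n) (\<tau>' n) (\<xi>' n)" for n
  define \<phi>0 where "\<phi>0 p = \<phi> (fst p) (snd p)" for p
  define \<psi>0 where "\<psi>0 p = \<psi> (fst p) (snd p)" for p
  have [measurable]: "E n \<in> borel_measurable (time_prob M t)" "E' n \<in> borel_measurable (time_prob M t)"
    "I n \<in> borel_measurable M" "J n \<in> borel_measurable M" for n
    using elementary_process_measurable[OF e t, of n] elementary_process_measurable[OF e' t, of n]
      elementary_integral_measurable[OF e t, of n] elementary_integral_measurable[OF e' t, of n]
    unfolding borel_measurable_time_prob E_def[abs_def] E'_def[abs_def] I_def J_def
    by (auto simp: case_prod_beta')
  have [measurable]: "\<phi>0 \<in> borel_measurable (time_prob M t)" "\<psi>0 \<in> borel_measurable (time_prob M t)"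
    using LF_space_measurable[OF \<phi>] LF_space_measurable[OF \<psi>]
    unfolding borel_measurable_time_prob \<phi>0_def[abs_def] \<psi>0_def[abs_def] by (auto simp: case_prod_beta')
  have swap: "(\<integral>\<^sup>+\<omega>. (\<integral>\<^sup>+s\<in>{0..t}. ennreal ((norm (g (s, \<omega>) - h (s, \<omega>) :: 'a))\<^sup>2) \<partial>lborel) \<partial>M)
      = (\<integral>\<^sup>+p. ennreal ((norm (g p - h p))\<^sup>2) \<partial>time_prob M t)"
    if [measurable]: "g \<in> borel_measurable (time_prob M t)" "h \<in> borel_measurable (time_prob M t)" for g h
    by (rule nn_integral_time_prob) (unfold borel_measurable_time_prob[symmetric], measurable)
  have z0: "(\<lambda>n. \<integral>\<^sup>+\<omega>. ennreal ((norm (I n \<omega> - Z \<omega>))\<^sup>2) \<partial>M) \<longlonglongrightarrow> 0"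
    and y0: "(\<lambda>n. \<integral>\<^sup>+\<omega>. ennreal ((norm (J n \<omega> - Y \<omega>))\<^sup>2) \<partial>M) \<longlonglongrightarrow> 0"
    using z y by (simp_all add: I_def J_def)
  have p0: "(\<lambda>n. \<integral>\<^sup>+p. ennreal ((norm (E n p - \<phi>0 p))\<^sup>2) \<partial>time_prob M t) \<longlonglongrightarrow> 0"
    using p swap[of "E _" \<phi>0] by (simp add: E_def \<phi>0_def)
  have p0': "(\<lambda>n. \<integral>\<^sup>+p. ennreal ((norm (E' n p - \<psi>0 p))\<^sup>2) \<partial>time_prob M t) \<longlonglongrightarrow> 0"
    using p' swap[of "E' _" \<psi>0] by (simp add: E'_def \<psi>0_def)
  let ?z = "\<lambda>n. \<integral>\<^sup>+\<omega>. ennreal ((norm (I n \<omega> - Z \<omega>))\<^sup>2) \<partial>M"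
  let ?y = "\<lambda>n. \<integral>\<^sup>+\<omega>. ennreal ((norm (J n \<omega> - Y \<omega>))\<^sup>2) \<partial>M"
  let ?p = "\<lambda>n. \<integral>\<^sup>+p. ennreal ((norm (E n p - \<phi>0 p))\<^sup>2) \<partial>time_prob M t"
  let ?q = "\<lambda>n. \<integral>\<^sup>+p. ennreal ((norm (E' n p - \<psi>0 p))\<^sup>2) \<partial>time_prob M t"
  have bound: "?A \<le> 3 * (?z n + ?y n + 3 * (?p n + ?q n + ?D))" for n
  proof -
    have "?A \<le> 3 * (?z n + ?y n + (\<integral>\<^sup>+\<omega>. ennreal ((norm (I n \<omega> - J n \<omega>))\<^sup>2) \<partial>M))"
      by (rule nn_integral_norm_sum3; (measurable)?) norm
    also have "(\<integral>\<^sup>+\<omega>. ennreal ((norm (I n \<omega> - J n \<omega>))\<^sup>2) \<partial>M) = (\<integral>\<^sup>+p. ennreal ((norm (E n p - E' n p))\<^sup>2) \<partial>time_prob M t)"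
      using elementary_isometry_diff[OF e e' t, of n n] swap[of "E n" "E' n"] by (simp add: I_def J_def E_def E'_def)
    also have "\<dots> \<le> 3 * (?p n + ?q n + ?D)"
      unfolding \<phi>0_def[symmetric] \<psi>0_def[symmetric]
      by (rule nn_integral_norm_sum3; (measurable)?) norm
    finally show ?thesis by (simp add: mult_left_mono)
  qed
  have "(\<lambda>n. 3 * (?z n + ?y n + 3 * (?p n + ?q n + ?D))) \<longlonglongrightarrow> 3 * (0 + 0 + 3 * (0 + 0 + ?D))"
    by (intro ennreal_tendsto_cmult tendsto_add z0 y0 p0 p0' tendsto_const) auto
  then have "?A \<le> 3 * (0 + 0 + 3 * (0 + 0 + ?D))"
    by (rule LIMSEQ_le_const) (use bound in blast)
  then show ?thesis by (simp add: mult.assoc[symmetric])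
qed

end

section \<open>Stability of It\^o processes\<close>

text \<open>The Cauchy--Schwarz inequality in time. Both sides are extended real numbers, so an integrand
  with infinite second moment is covered trivially, and a non-integrable one by the default value
  \<open>0\<close> of its integral.\<close>

lemma norm_time_integral_square_le:
  fixes g :: "real \<Rightarrow> 'a::euclidean_space"
  assumes t: "0 \<le> t"
  shows "ennreal ((norm (LINT s:{0..t}|lborel. g s))\<^sup>2) \<le>
    ennreal t * (\<integral>\<^sup>+s\<in>{0..t}. ennreal ((norm (g s))\<^sup>2) \<partial>lborel)"
proof (cases "set_integrable lborel {0..t} g \<and> t > 0")
  case False
  then have "(LINT s:{0..t}|lborel. g s) = 0"
  proof (cases "t > 0")
    case True
    then show ?thesis using False
      by (simp add: set_lebesgue_integral_def set_integrable_def not_integrable_integral_eq)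
  next
    case False
    then have "{0..t} \<in> null_sets lborel" using t by (simp add: null_sets_def)
    then show ?thesis
      unfolding set_lebesgue_integral_def
      by (intro integral_eq_zero_AE) (auto dest: AE_not_in elim!: eventually_mono)
  qed
  then show ?thesis by simp
next
  case True
  \<comment> \<open>With \<open>c\<close> the mean of the norm, integrate \<open>2 c \<bar>g\<bar> - c\<^sup>2 \<le> \<bar>g\<bar>\<^sup>2\<close>, whose left-hand side is
      integrable in any case.\<close>
  define I where "I = (LINT s:{0..t}|lborel. norm (g s))"
  define c where "c = I / t"
  have int: "set_integrable lborel {0..t} (\<lambda>s. norm (g s))"
    using True by (simp add: set_integrable_norm)
  have "I \<ge> 0" unfolding I_def set_lebesgue_integral_def by (rule integral_nonneg_AE) auto
  have le: "norm (LINT s:{0..t}|lborel. g s) \<le> I"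
    unfolding I_def using True by (intro set_integral_norm_bound) simp
  define h where "h s = indicator {0..t} s * (2 * c * norm (g s) - c\<^sup>2)" for s
  have h_int: "integrable lborel h" and h_eq: "(\<integral>s. h s \<partial>lborel) = 2 * c * I - c\<^sup>2 * t"
  proof -
    have "has_bochner_integral lborel (\<lambda>s. 2 * c * (indicator {0..t} s * norm (g s)) - c\<^sup>2 * indicator {0..t} s)
       (2 * c * I - c\<^sup>2 * t)"
      using int t
      by (intro has_bochner_integral_diff has_bochner_integral_mult_right)
        (auto simp: has_bochner_integral_iff I_def set_lebesgue_integral_def set_integrable_def)
    then have "has_bochner_integral lborel h (2 * c * I - c\<^sup>2 * t)"
      by (rule has_bochner_integral_cong[THEN iffD1, rotated -1]) (auto simp: h_def algebra_simps)
    then show "integrable lborel h" "(\<integral>s. h s \<partial>lborel) = 2 * c * I - c\<^sup>2 * t"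
      by (auto simp: has_bochner_integral_iff)
  qed
  have "ennreal (2 * c * I - c\<^sup>2 * t) \<le> ennreal (\<integral>s. max 0 (h s) \<partial>lborel)"
    unfolding h_eq[symmetric]
    by (intro ennreal_leI integral_mono h_int Bochner_Integration.integrable_max) auto
  also have "\<dots> = (\<integral>\<^sup>+s. ennreal (max 0 (h s)) \<partial>lborel)"
    by (rule nn_integral_eq_integral[symmetric]) (auto intro!: Bochner_Integration.integrable_max h_int)
  also have "\<dots> \<le> (\<integral>\<^sup>+s\<in>{0..t}. ennreal ((norm (g s))\<^sup>2) \<partial>lborel)"
  proof (rule nn_integral_mono)
    fix s
    have "2 * c * norm (g s) - c\<^sup>2 \<le> (norm (g s))\<^sup>2"
      using zero_le_power2[of "norm (g s) - c"] by (simp add: power2_diff algebra_simps)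
    then show "ennreal (max 0 (h s)) \<le> ennreal ((norm (g s))\<^sup>2) * indicator {0..t} s"
      by (auto simp: h_def indicator_def intro!: ennreal_leI)
  qed
  finally have *: "ennreal (2 * c * I - c\<^sup>2 * t) \<le> (\<integral>\<^sup>+s\<in>{0..t}. ennreal ((norm (g s))\<^sup>2) \<partial>lborel)" .
  have "ennreal ((norm (LINT s:{0..t}|lborel. g s))\<^sup>2) \<le> ennreal (I\<^sup>2)"
    using le by (intro ennreal_leI power_mono) auto
  also have "I\<^sup>2 = t * (2 * c * I - c\<^sup>2 * t)"
    using True by (simp add: c_def power2_eq_square field_simps)
  also have "ennreal \<dots> = ennreal t * ennreal (2 * c * I - c\<^sup>2 * t)"
    using True \<open>I \<ge> 0\<close> t by (intro ennreal_mult) (auto simp: c_def power2_eq_square)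
  also have "\<dots> \<le> ennreal t * (\<integral>\<^sup>+s\<in>{0..t}. ennreal ((norm (g s))\<^sup>2) \<partial>lborel)"
    by (rule mult_left_mono[OF *]) simp
  finally show ?thesis .
qed

text \<open>Weighting with \<open>exp (- 2 * C * t)\<close> makes the integral operator a contraction with factor
  one half, so the finite weighted supremum \<open>m\<close> satisfies \<open>m \<le> \<delta> + m / 2\<close>.\<close>

lemma gronwall_ennreal:
  fixes e :: "real \<Rightarrow> ennreal" and C T :: real
  assumes C: "C > 0" and B: "B < \<infinity>" "\<And>t. t \<in> {0..T} \<Longrightarrow> e t \<le> B"
    and e: "\<And>t. t \<in> {0..T} \<Longrightarrow> e t \<le> \<delta> + ennreal C * (\<integral>\<^sup>+s\<in>{0..t}. e s \<partial>lborel)"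
    and t: "t \<in> {0..T}"
  shows "e t \<le> 2 * \<delta> * ennreal (exp (2 * C * T))"
proof -
  define m where "m = (SUP t\<in>{0..T}. e t * ennreal (exp (- 2 * C * t)))"
  have e_le: "e t \<le> m * ennreal (exp (2 * C * t))" if "t \<in> {0..T}" for t
  proof -
    have "e t = e t * ennreal (exp (- 2 * C * t)) * ennreal (exp (2 * C * t))"
      by (simp add: mult.assoc ennreal_mult[symmetric] exp_add[symmetric])
    also have "\<dots> \<le> m * ennreal (exp (2 * C * t))"
      unfolding m_def using that by (intro mult_right_mono SUP_upper) auto
    finally show ?thesis .
  qed
  have "m \<le> B"
    unfolding m_def
  proof (rule SUP_least)
    fix t assume "t \<in> {0..T}"
    then have "e t * ennreal (exp (- 2 * C * t)) \<le> B * ennreal 1"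
      using C by (intro mult_mono B(2) ennreal_leI) auto
    then show "e t * ennreal (exp (- 2 * C * t)) \<le> B" by simp
  qed
  then have m_fin: "m < \<infinity>" using B(1) by (rule le_less_trans)
  have "(SUP t\<in>{0..T}. e t * ennreal (exp (- 2 * C * t))) \<le> \<delta> + m / 2"
  proof (rule SUP_least)
    fix t assume t: "t \<in> {0..T}"
    have "(\<integral>\<^sup>+s\<in>{0..t}. e s \<partial>lborel) \<le> (\<integral>\<^sup>+s. m * (ennreal (exp (2 * C * s)) * indicator {0..t} s) \<partial>lborel)"
      using e_le t by (intro nn_integral_mono) (auto simp: indicator_def)
    also have "\<dots> = m * (\<integral>\<^sup>+s. ennreal (exp (2 * C * s)) * indicator {0..t} s \<partial>lborel)"
      by (rule nn_integral_cmult) measurable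
    also have "(\<integral>\<^sup>+s. ennreal (exp (2 * C * s)) * indicator {0..t} s \<partial>lborel) =
        ennreal (exp (2 * C * t) / (2 * C) - exp (2 * C * 0) / (2 * C))"
      using t C by (intro nn_integral_FTC_Icc) (auto intro!: derivative_eq_intros)
    also have "m * \<dots> \<le> m * ennreal (exp (2 * C * t) / (2 * C))"
      using C by (intro mult_left_mono ennreal_leI) auto
    finally have "ennreal C * (\<integral>\<^sup>+s\<in>{0..t}. e s \<partial>lborel) \<le> ennreal C * (m * ennreal (exp (2 * C * t) / (2 * C)))"
      by (rule mult_left_mono) simp
    also have "\<dots> = m * ennreal (exp (2 * C * t) / 2)"
      using C by (simp add: mult.left_commute[of "ennreal C"] ennreal_mult[symmetric])
    finally have "e t \<le> \<delta> + m * ennreal (exp (2 * C * t) / 2)"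
      using e[OF t] by (meson add_left_mono order_trans)
    then have "e t * ennreal (exp (- 2 * C * t)) \<le> (\<delta> + m * ennreal (exp (2 * C * t) / 2)) * ennreal (exp (- 2 * C * t))"
      by (rule mult_right_mono) simp
    also have "\<dots> = \<delta> * ennreal (exp (- 2 * C * t)) + m * ennreal (1 / 2)"
      by (simp add: distrib_right mult.assoc ennreal_mult[symmetric] exp_add[symmetric])
    also have "\<dots> \<le> \<delta> * ennreal 1 + m * ennreal (1 / 2)"
      using C t by (intro add_mono mult_left_mono ennreal_leI) auto
    finally show "e t * ennreal (exp (- 2 * C * t)) \<le> \<delta> + m / 2"
      using ennreal_times_divide[of m 1 2] ennreal_divide_numeral[of 1 "num.Bit0 num.One"] by simp
  qed
  then have "m \<le> \<delta> + m / 2" unfolding m_def[symmetric] .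
  then have "m \<le> 2 * \<delta>"
  proof (cases "\<delta> = \<infinity>")
    case False
    obtain m' where m': "m = ennreal m'" "m' \<ge> 0" using m_fin by (cases m) auto
    obtain d where d: "\<delta> = ennreal d" "d \<ge> 0" using False by (cases \<delta>) auto
    have "ennreal m' \<le> ennreal (d + m' / 2)"
      using \<open>m \<le> \<delta> + m / 2\<close> m' d by (simp add: ennreal_divide_numeral)
    then have "m' \<le> 2 * d" using m' d by (simp add: ennreal_le_iff ennreal_plus[symmetric] del: ennreal_plus)
    then show ?thesis using m' d by (metis ennreal_leI ennreal_mult ennreal_numeral zero_le_numeral)
  qed (simp add: ennreal_mult_top)
  have "e t \<le> m * ennreal (exp (2 * C * t))" by (rule e_le) fact
  also have "\<dots> \<le> 2 * \<delta> * ennreal (exp (2 * C * T))"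
    using t C by (intro mult_mono \<open>m \<le> 2 * \<delta>\<close> ennreal_leI) auto
  finally show ?thesis .
qed


lemma measurable_time_interval_mono:
  assumes "f \<in> measurable (time_interval T \<Otimes>\<^sub>M M) N" "t \<le> T"
  shows "f \<in> measurable (time_interval t \<Otimes>\<^sub>M M) N"
proof -
  have "(\<lambda>s. s) \<in> measurable (time_interval t) (time_interval T)"
    using assms(2) by (intro measurable_restrict_space2 measurable_restrict_space1) (auto simp: space_restrict_space)
  from measurable_compose[OF measurable_fst this, of M]
  have "(\<lambda>p. (fst p, snd p)) \<in> measurable (time_interval t \<Otimes>\<^sub>M M) (time_interval T \<Otimes>\<^sub>M M)"
    by (rule measurable_Pair) simp
  from measurable_compose[OF this assms(1)] show ?thesis by simp
qed

lemma (in prob_space) emeasure_time_prob: "0 \<le> t \<Longrightarrow> emeasure (time_prob M t) (space (time_prob M t)) = ennreal t"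
  using emeasure_pair_measure_Times[of "{0..t}" "restrict_space lborel {0..t}" "space M"]
  by (simp add: space_pair_measure space_restrict_space sets_restrict_space_iff emeasure_restrict_space
      emeasure_space_1)

lemma (in prob_space) nn_integral_time_prob_mono:
  assumes "f \<in> borel_measurable (time_interval T \<Otimes>\<^sub>M M)" "t \<le> T"
  shows "(\<integral>\<^sup>+p. f p \<partial>time_prob M t) \<le> (\<integral>\<^sup>+p. f p \<partial>time_prob M T)"
  unfolding nn_integral_time_prob(2)[OF assms(1), symmetric]
    nn_integral_time_prob(2)[OF measurable_time_interval_mono[OF assms], symmetric]
  using assms(2) by (intro nn_integral_mono) (auto simp: indicator_def)

context brownian_space
begin

text \<open>The drift part is bounded by Cauchy--Schwarz in time, the martingale part by the estimate for
  It\^o integrals.\<close>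

lemma ito_dynamics_diff_estimate:
  fixes X Y a a' c c' :: "real \<Rightarrow> 'w \<Rightarrow> 'a::euclidean_space"
  assumes X: "ito_dynamics M F W T X a c" and Y: "ito_dynamics M F W T Y a' c'"
    and init: "AE \<omega> in M. X 0 \<omega> = Y 0 \<omega>"
    and [measurable]: "X 0 \<in> borel_measurable M" "Y 0 \<in> borel_measurable M" 
      "X t \<in> borel_measurable M" "Y t \<in> borel_measurable M"
    and a: "(\<lambda>p. a (fst p) (snd p) - a' (fst p) (snd p)) \<in> borel_measurable (time_interval t \<Otimes>\<^sub>M M)"
    and t: "t \<in> {0..T}"
  shows "(\<integral>\<^sup>+\<omega>. ennreal ((norm (X t \<omega> - Y t \<omega>))\<^sup>2) \<partial>M) \<le>
    3 * (ennreal t * (\<integral>\<^sup>+p. ennreal ((norm (a (fst p) (snd p) - a' (fst p) (snd p)))\<^sup>2) \<partial>time_prob M t)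
       + 9 * (\<integral>\<^sup>+p. ennreal ((norm (c (fst p) (snd p) - c' (fst p) (snd p)))\<^sup>2) \<partial>time_prob M t))"
proof -
  define Z where "Z \<omega> = X t \<omega> - X 0 \<omega> - (LINT s:{0..t}|lborel. a s \<omega>)" for \<omega>
  define Z' where "Z' \<omega> = Y t \<omega> - Y 0 \<omega> - (LINT s:{0..t}|lborel. a' s \<omega>)" for \<omega>
  have Z: "has_ito_integral M F W t c Z" "has_ito_integral M F W t c' Z'"
    using X Y t by (auto simp: ito_dynamics_def Z_def[abs_def] Z'_def[abs_def])
  then have [measurable]: "Z \<in> borel_measurable M" "Z' \<in> borel_measurable M"
    by (auto simp: has_ito_integral_def)
  define D where "D \<omega> = (X t \<omega> - Y t \<omega>) - (X 0 \<omega> - Y 0 \<omega>) - (Z \<omega> - Z' \<omega>)" for \<omega>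
  have [measurable]: "D \<in> borel_measurable M" unfolding D_def[abs_def] by measurable
  have D_eq: "AE \<omega> in M. ennreal ((norm (D \<omega>))\<^sup>2) \<le>
      ennreal t * (\<integral>\<^sup>+s\<in>{0..t}. ennreal ((norm (a s \<omega> - a' s \<omega>))\<^sup>2) \<partial>lborel)"
  proof -
    have "AE \<omega> in M. set_integrable lborel {0..T} (\<lambda>s. a s \<omega>)" "AE \<omega> in M. set_integrable lborel {0..T} (\<lambda>s. a' s \<omega>)"
      using X Y by (auto simp: ito_dynamics_def)
    then show ?thesis
    proof eventually_elim
      fix \<omega> assume "set_integrable lborel {0..T} (\<lambda>s. a s \<omega>)" "set_integrable lborel {0..T} (\<lambda>s. a' s \<omega>)"
      then have "set_integrable lborel {0..t} (\<lambda>s. a s \<omega>)" "set_integrable lborel {0..t} (\<lambda>s. a' s \<omega>)"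
        using t by (auto intro: set_integrable_subset)
      then have "D \<omega> = (LINT s:{0..t}|lborel. a s \<omega> - a' s \<omega>)"
        by (simp add: D_def Z_def Z'_def set_integral_diff(2))
      then show "ennreal ((norm (D \<omega>))\<^sup>2) \<le>
          ennreal t * (\<integral>\<^sup>+s\<in>{0..t}. ennreal ((norm (a s \<omega> - a' s \<omega>))\<^sup>2) \<partial>lborel)"
        using norm_time_integral_square_le[of t "\<lambda>s. a s \<omega> - a' s \<omega>"] t by simp
    qed
  qed
  have f: "(\<lambda>p. ennreal ((norm (a (fst p) (snd p) - a' (fst p) (snd p)))\<^sup>2)) \<in> borel_measurable (time_interval t \<Otimes>\<^sub>M M)"
    using a by measurable
  have D_le: "(\<integral>\<^sup>+\<omega>. ennreal ((norm (D \<omega>))\<^sup>2) \<partial>M) \<le>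
      ennreal t * (\<integral>\<^sup>+p. ennreal ((norm (a (fst p) (snd p) - a' (fst p) (snd p)))\<^sup>2) \<partial>time_prob M t)"
  proof -
    have "(\<integral>\<^sup>+\<omega>. ennreal ((norm (D \<omega>))\<^sup>2) \<partial>M) \<le>
        (\<integral>\<^sup>+\<omega>. ennreal t * (\<integral>\<^sup>+s\<in>{0..t}. ennreal ((norm (a s \<omega> - a' s \<omega>))\<^sup>2) \<partial>lborel) \<partial>M)"
      by (rule nn_integral_mono_AE[OF D_eq])
    also have "\<dots> = ennreal t * (\<integral>\<^sup>+\<omega>. (\<integral>\<^sup>+s\<in>{0..t}. ennreal ((norm (a s \<omega> - a' s \<omega>))\<^sup>2) \<partial>lborel) \<partial>M)"
    proof (rule nn_integral_cmult)
      interpret P: pair_sigma_finite "restrict_space lborel {0..t}" M by (rule pair_sigma_finite_time_prob)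
      have g: "(\<lambda>p. ennreal ((norm (a (fst p) (snd p) - a' (fst p) (snd p)))\<^sup>2)) \<in> borel_measurable (time_prob M t)"
        using f by (simp add: borel_measurable_time_prob)
      have "(\<lambda>\<omega>. \<integral>\<^sup>+s. ennreal ((norm (a s \<omega> - a' s \<omega>))\<^sup>2) \<partial>restrict_space lborel {0..t}) \<in> borel_measurable M"
        using P.M1.borel_measurable_nn_integral_fst[OF measurable_pair_swap[OF g]] by simp
      then show "(\<lambda>\<omega>. \<integral>\<^sup>+s\<in>{0..t}. ennreal ((norm (a s \<omega> - a' s \<omega>))\<^sup>2) \<partial>lborel) \<in> borel_measurable M"
        by (simp add: nn_integral_restrict_space)
    qed
    also have "\<dots> = ennreal t * (\<integral>\<^sup>+p. ennreal ((norm (a (fst p) (snd p) - a' (fst p) (snd p)))\<^sup>2) \<partial>time_prob M t)"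
      using nn_integral_time_prob(1)[OF f] by simp
    finally show ?thesis .
  qed
  have "(\<integral>\<^sup>+\<omega>. ennreal ((norm (X t \<omega> - Y t \<omega>))\<^sup>2) \<partial>M) =
      (\<integral>\<^sup>+\<omega>. ennreal ((norm ((X t \<omega> - Y t \<omega>) - (X 0 \<omega> - Y 0 \<omega>)))\<^sup>2) \<partial>M)"
    using init by (intro nn_integral_cong_AE) auto
  also have "\<dots> \<le> 3 * ((\<integral>\<^sup>+\<omega>. ennreal ((norm (D \<omega>))\<^sup>2) \<partial>M) + (\<integral>\<^sup>+\<omega>. ennreal ((norm (Z \<omega> - Z' \<omega>))\<^sup>2) \<partial>M)
      + (\<integral>\<^sup>+\<omega>. ennreal ((norm (0::'a))\<^sup>2) \<partial>M))"
    by (rule nn_integral_norm_sum3; (measurable)?) (unfold D_def, norm)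
  also have "\<dots> \<le> 3 * (ennreal t * (\<integral>\<^sup>+p. ennreal ((norm (a (fst p) (snd p) - a' (fst p) (snd p)))\<^sup>2) \<partial>time_prob M t)
       + 9 * (\<integral>\<^sup>+p. ennreal ((norm (c (fst p) (snd p) - c' (fst p) (snd p)))\<^sup>2) \<partial>time_prob M t) + 0)"
    using ito_integral_diff_estimate[OF _ Z] t
    by (intro mult_left_mono add_mono D_le) auto
  finally show ?thesis by simp
qed

lemma ito_dynamics_const: "ito_dynamics M F W T (\<lambda>_ _. x0) (\<lambda>_ _. 0) (\<lambda>_ _. 0 :: 'a::euclidean_space)"
proof -
  have "has_ito_integral M F W t (\<lambda>_ _. 0) (\<lambda>_. 0 :: 'a)" if t: "t \<in> {0..T}" for t
  proof -
    have "(\<lambda>_ _. 0 :: 'a) \<in> LF_space M F t 2 2"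
      by (simp add: LF_space_def adapted_measurable_def set_integrable_def set_lebesgue_integral_def)
    then show ?thesis unfolding has_ito_integral_def
      using t by (auto simp: elementary_data_def elementary_process_def elementary_integral_def
          intro!: exI[of _ "\<lambda>_. 0::nat"] exI[of _ "\<lambda>_ _. 0::real"])
  qed
  then show ?thesis
    by (simp add: ito_dynamics_def set_integrable_def set_lebesgue_integral_def)
qed

lemma adapted_measurable_joint:
  "adapted_measurable M F T X \<Longrightarrow> (\<lambda>p. X (fst p) (snd p)) \<in> borel_measurable (time_interval T \<Otimes>\<^sub>M M)"
  by (simp add: adapted_measurable_def case_prod_beta')

lemma adapted_measurable_at:
  "adapted_measurable M F T X \<Longrightarrow> t \<in> {0..T} \<Longrightarrow> X t \<in> borel_measurable M"
  by (auto simp: adapted_measurable_def intro: measurable_F_M)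

text \<open>Compare the process with the constant process at its initial value.\<close>

lemma ito_dynamics_moment_bound:
  fixes X a c :: "real \<Rightarrow> 'w \<Rightarrow> 'a::euclidean_space"
  assumes X: "ito_dynamics M F W T X a c" "adapted_measurable M F T X"
    and init: "AE \<omega> in M. X 0 \<omega> = x0"
    and a: "(\<lambda>p. a (fst p) (snd p)) \<in> borel_measurable (time_interval T \<Otimes>\<^sub>M M)"
    and K: "\<And>s \<omega>. s \<in> {0..T} \<Longrightarrow> \<omega> \<in> space M \<Longrightarrow> norm (a s \<omega>) \<le> K \<and> norm (c s \<omega>) \<le> K"
    and t: "t \<in> {0..T}"
  shows "(\<integral>\<^sup>+\<omega>. ennreal ((norm (X t \<omega> - x0))\<^sup>2) \<partial>M) \<le> ennreal (3 * (T * (K\<^sup>2 * T) + 9 * (K\<^sup>2 * T)))"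
proof -
  have a': "(\<lambda>p. a (fst p) (snd p) - 0) \<in> borel_measurable (time_interval t \<Otimes>\<^sub>M M)"
    using measurable_time_interval_mono[OF a] t by simp
  have bd: "(\<integral>\<^sup>+p. ennreal ((norm (g (fst p) (snd p)))\<^sup>2) \<partial>time_prob M t) \<le> ennreal (K\<^sup>2 * T)"
    if g: "\<And>s \<omega>. s \<in> {0..T} \<Longrightarrow> \<omega> \<in> space M \<Longrightarrow> norm (g s \<omega>) \<le> K" for g :: "real \<Rightarrow> 'w \<Rightarrow> 'a"
  proof -
    have "(\<integral>\<^sup>+p. ennreal ((norm (g (fst p) (snd p)))\<^sup>2) \<partial>time_prob M t) \<le> (\<integral>\<^sup>+p. ennreal (K\<^sup>2) \<partial>time_prob M t)"
      using g t by (intro nn_integral_mono ennreal_leI power_mono)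
        (auto simp: space_pair_measure space_restrict_space)
    also have "\<dots> = ennreal (K\<^sup>2 * t)"
      using t by (simp add: emeasure_time_prob ennreal_mult)
    also have "\<dots> \<le> ennreal (K\<^sup>2 * T)" using t by (intro ennreal_leI mult_left_mono) auto
    finally show ?thesis .
  qed
  have "(\<integral>\<^sup>+\<omega>. ennreal ((norm (X t \<omega> - x0))\<^sup>2) \<partial>M) \<le>
    3 * (ennreal t * (\<integral>\<^sup>+p. ennreal ((norm (a (fst p) (snd p) - 0))\<^sup>2) \<partial>time_prob M t)
       + 9 * (\<integral>\<^sup>+p. ennreal ((norm (c (fst p) (snd p) - 0))\<^sup>2) \<partial>time_prob M t))"
    using t by (intro ito_dynamics_diff_estimate[OF X(1) ito_dynamics_const] init a'
        adapted_measurable_at[OF X(2)]) auto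
  also have "\<dots> \<le> 3 * (ennreal T * ennreal (K\<^sup>2 * T) + 9 * ennreal (K\<^sup>2 * T))"
    using bd[of a] bd[of c] K t by (intro mult_left_mono add_mono mult_mono ennreal_leI) auto
  also have "\<dots> = ennreal (3 * (T * (K\<^sup>2 * T) + 9 * (K\<^sup>2 * T)))"
    using t by (simp add: ennreal_mult ennreal_plus)
  finally show ?thesis .
qed

text \<open>Here \<open>r\<close> is the discrepancy of the coefficients along \<open>Y\<close>, and \<open>L\<close> their Lipschitz constant. The
  bound \<open>K\<close> makes the mean square distance finite to begin with, as Gronwall's inequality demands.\<close>

lemma ito_dynamics_stability:
  fixes X Y a a' c c' :: "real \<Rightarrow> 'w \<Rightarrow> 'a::euclidean_space" and r :: "real \<Rightarrow> 'w \<Rightarrow> real"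
  assumes X: "ito_dynamics M F W T X a c" "adapted_measurable M F T X"
    and Y: "ito_dynamics M F W T Y a' c'" "adapted_measurable M F T Y"
    and init: "AE \<omega> in M. X 0 \<omega> = x0" "AE \<omega> in M. Y 0 \<omega> = x0"
    and a: "(\<lambda>p. a (fst p) (snd p)) \<in> borel_measurable (time_interval T \<Otimes>\<^sub>M M)"
      "(\<lambda>p. a' (fst p) (snd p)) \<in> borel_measurable (time_interval T \<Otimes>\<^sub>M M)"
    and c: "(\<lambda>p. c (fst p) (snd p)) \<in> borel_measurable (time_interval T \<Otimes>\<^sub>M M)"
      "(\<lambda>p. c' (fst p) (snd p)) \<in> borel_measurable (time_interval T \<Otimes>\<^sub>M M)"
    and r: "(\<lambda>p. r (fst p) (snd p)) \<in> borel_measurable (time_interval T \<Otimes>\<^sub>M M)"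
    and K: "\<And>s \<omega>. s \<in> {0..T} \<Longrightarrow> \<omega> \<in> space M \<Longrightarrow> norm (a s \<omega>) \<le> K \<and> norm (c s \<omega>) \<le> K"
      "\<And>s \<omega>. s \<in> {0..T} \<Longrightarrow> \<omega> \<in> space M \<Longrightarrow> norm (a' s \<omega>) \<le> K \<and> norm (c' s \<omega>) \<le> K"
    and L: "\<And>s \<omega>. s \<in> {0..T} \<Longrightarrow> \<omega> \<in> space M \<Longrightarrow>
      norm (a s \<omega> - a' s \<omega>) + norm (c s \<omega> - c' s \<omega>) \<le> L * norm (X s \<omega> - Y s \<omega>) + r s \<omega>"
    and t: "t \<in> {0..T}"
  shows "(\<integral>\<^sup>+\<omega>. ennreal ((norm (X t \<omega> - Y t \<omega>))\<^sup>2) \<partial>M) \<le>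
    2 * (ennreal (6 * (T + 9)) * (\<integral>\<^sup>+p. ennreal ((r (fst p) (snd p))\<^sup>2) \<partial>time_prob M T))
      * ennreal (exp (2 * (6 * (T + 9) * (L\<^sup>2 + 1)) * T))"
proof -
  have T: "0 \<le> T" using t by auto
  define e where "e t = (\<integral>\<^sup>+\<omega>. ennreal ((norm (X t \<omega> - Y t \<omega>))\<^sup>2) \<partial>M)" for t
  let ?B = "ennreal (3 * (T * (K\<^sup>2 * T) + 9 * (K\<^sup>2 * T)))"
  let ?R = "\<integral>\<^sup>+p. ennreal ((r (fst p) (snd p))\<^sup>2) \<partial>time_prob M T"
  have Xj: "(\<lambda>p. X (fst p) (snd p)) \<in> borel_measurable (time_interval T \<Otimes>\<^sub>M M)"
    and Yj: "(\<lambda>p. Y (fst p) (snd p)) \<in> borel_measurable (time_interval T \<Otimes>\<^sub>M M)"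
    using adapted_measurable_joint X(2) Y(2) by auto
  have init': "AE \<omega> in M. X 0 \<omega> = Y 0 \<omega>" using init by eventually_elim simp
  have "e t \<le> 2 * (ennreal (6 * (T + 9)) * ?R) * ennreal (exp (2 * (6 * (T + 9) * (L\<^sup>2 + 1)) * T))"
  proof (rule gronwall_ennreal[where B="3 * (?B + ?B + 0)"])
    show "6 * (T + 9) * (L\<^sup>2 + 1) > 0" using T by (intro mult_pos_pos add_nonneg_pos) auto
    show "3 * (?B + ?B + 0) < \<infinity>" by (simp add: ennreal_mult_less_top)
    fix t assume t: "t \<in> {0..T}"
    have [measurable]: "X t \<in> borel_measurable M" "Y t \<in> borel_measurable M"
      using adapted_measurable_at X(2) Y(2) t by auto
    have "e t \<le> 3 * ((\<integral>\<^sup>+\<omega>. ennreal ((norm (X t \<omega> - x0))\<^sup>2) \<partial>M) + (\<integral>\<^sup>+\<omega>. ennreal ((norm (Y t \<omega> - x0))\<^sup>2) \<partial>M)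
        + (\<integral>\<^sup>+\<omega>. ennreal ((norm (0::'a))\<^sup>2) \<partial>M))"
      unfolding e_def by (rule nn_integral_norm_sum3; (measurable)?) norm
    also have "\<dots> \<le> 3 * (?B + ?B + 0)"
      by (intro mult_left_mono add_mono ito_dynamics_moment_bound[OF X init(1) a(1) K(1) t]
          ito_dynamics_moment_bound[OF Y init(2) a(2) K(2) t]) auto
    finally show "e t \<le> 3 * (?B + ?B + 0)" .
    have tT: "t \<le> T" using t by auto
    have [measurable]: "(\<lambda>p. X (fst p) (snd p)) \<in> borel_measurable (time_interval t \<Otimes>\<^sub>M M)"
      "(\<lambda>p. Y (fst p) (snd p)) \<in> borel_measurable (time_interval t \<Otimes>\<^sub>M M)"
      "(\<lambda>p. r (fst p) (snd p)) \<in> borel_measurable (time_interval t \<Otimes>\<^sub>M M)"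
      "(\<lambda>p. a (fst p) (snd p)) \<in> borel_measurable (time_interval t \<Otimes>\<^sub>M M)"
      "(\<lambda>p. a' (fst p) (snd p)) \<in> borel_measurable (time_interval t \<Otimes>\<^sub>M M)"
      "(\<lambda>p. c (fst p) (snd p)) \<in> borel_measurable (time_interval t \<Otimes>\<^sub>M M)"
      "(\<lambda>p. c' (fst p) (snd p)) \<in> borel_measurable (time_interval t \<Otimes>\<^sub>M M)"
      by (rule measurable_time_interval_mono[OF Xj tT] measurable_time_interval_mono[OF Yj tT]
          measurable_time_interval_mono[OF r tT] measurable_time_interval_mono[OF a(1) tT]
          measurable_time_interval_mono[OF a(2) tT] measurable_time_interval_mono[OF c(1) tT]
          measurable_time_interval_mono[OF c(2) tT])+
    let ?N = "time_prob M t"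
    let ?A = "\<integral>\<^sup>+p. ennreal ((norm (a (fst p) (snd p) - a' (fst p) (snd p)))\<^sup>2) \<partial>?N"
    let ?C = "\<integral>\<^sup>+p. ennreal ((norm (c (fst p) (snd p) - c' (fst p) (snd p)))\<^sup>2) \<partial>?N"
    let ?E = "\<integral>\<^sup>+p. ennreal ((norm (X (fst p) (snd p) - Y (fst p) (snd p)))\<^sup>2) \<partial>?N"
    let ?Rt = "\<integral>\<^sup>+p. ennreal ((r (fst p) (snd p))\<^sup>2) \<partial>?N"
    have "e t \<le> 3 * (ennreal t * ?A + 9 * ?C)"
      unfolding e_def using t T
      by (intro ito_dynamics_diff_estimate[OF X(1) Y(1) init'] adapted_measurable_at[OF X(2)]
          adapted_measurable_at[OF Y(2)] borel_measurable_diff) auto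
    also have "\<dots> \<le> 3 * (ennreal (T + 9) * ?A + ennreal (T + 9) * ?C)"
      using T t ennreal_leI[of 9 "T + 9"]
      by (intro mult_left_mono add_mono mult_right_mono ennreal_leI) auto
    also have "\<dots> = ennreal (3 * (T + 9)) * (?A + ?C)"
      using T ennreal_mult[of 3 "T + 9"] by (simp add: distrib_left mult.assoc del: ennreal_plus)
    also have "?A + ?C = (\<integral>\<^sup>+p. ennreal ((norm (a (fst p) (snd p) - a' (fst p) (snd p)))\<^sup>2)
         + ennreal ((norm (c (fst p) (snd p) - c' (fst p) (snd p)))\<^sup>2) \<partial>?N)"
      by (rule nn_integral_add[symmetric]) (unfold borel_measurable_time_prob, measurable)
    also have "\<dots> \<le> (\<integral>\<^sup>+p. ennreal (2 * L\<^sup>2) * ennreal ((norm (X (fst p) (snd p) - Y (fst p) (snd p)))\<^sup>2)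
         + 2 * ennreal ((r (fst p) (snd p))\<^sup>2) \<partial>?N)"
    proof (rule nn_integral_mono)
      fix p assume "p \<in> space ?N"
      then have p: "fst p \<in> {0..T}" "snd p \<in> space M"
        using t by (auto simp: space_pair_measure space_restrict_space)
      define A where "A = norm (a (fst p) (snd p) - a' (fst p) (snd p))"
      define C where "C = norm (c (fst p) (snd p) - c' (fst p) (snd p))"
      define D where "D = norm (X (fst p) (snd p) - Y (fst p) (snd p))"
      define \<rho> where "\<rho> = r (fst p) (snd p)"
      have ge: "A \<ge> 0" "C \<ge> 0" by (auto simp: A_def C_def)
      have "A + C \<le> L * D + \<rho>" using L[OF p] by (simp add: A_def C_def D_def \<rho>_def)
      then have "(A + C)\<^sup>2 \<le> (L * D + \<rho>)\<^sup>2" using ge by (intro power_mono) auto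
      moreover have "A\<^sup>2 + C\<^sup>2 \<le> (A + C)\<^sup>2" using ge by (simp add: power2_sum)
      moreover have "(L * D + \<rho>)\<^sup>2 \<le> 2 * L\<^sup>2 * D\<^sup>2 + 2 * \<rho>\<^sup>2"
        using zero_le_power2[of "L * D - \<rho>"] by (simp add: power2_eq_square algebra_simps)
      ultimately have "A\<^sup>2 + C\<^sup>2 \<le> 2 * L\<^sup>2 * D\<^sup>2 + 2 * \<rho>\<^sup>2" by linarith
      then have "ennreal (A\<^sup>2 + C\<^sup>2) \<le> ennreal (2 * L\<^sup>2 * D\<^sup>2 + 2 * \<rho>\<^sup>2)" by (rule ennreal_leI)
      then show "ennreal ((norm (a (fst p) (snd p) - a' (fst p) (snd p)))\<^sup>2)
         + ennreal ((norm (c (fst p) (snd p) - c' (fst p) (snd p)))\<^sup>2) \<le>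
         ennreal (2 * L\<^sup>2) * ennreal ((norm (X (fst p) (snd p) - Y (fst p) (snd p)))\<^sup>2)
         + 2 * ennreal ((r (fst p) (snd p))\<^sup>2)"
        by (simp add: A_def C_def D_def \<rho>_def ennreal_mult ennreal_plus)
    qed
    also have "\<dots> = ennreal (2 * L\<^sup>2) * ?E + 2 * ?Rt"
    proof -
      have [measurable]: "(\<lambda>p. ennreal ((norm (X (fst p) (snd p) - Y (fst p) (snd p)))\<^sup>2)) \<in> borel_measurable ?N"
         "(\<lambda>p. ennreal ((r (fst p) (snd p))\<^sup>2)) \<in> borel_measurable ?N"
        unfolding borel_measurable_time_prob by measurable
      show ?thesis by (simp add: nn_integral_add nn_integral_cmult)
    qed
    also have "?E = (\<integral>\<^sup>+s\<in>{0..t}. e s \<partial>lborel)"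
    proof -
      have "(\<lambda>p. ennreal ((norm (X (fst p) (snd p) - Y (fst p) (snd p)))\<^sup>2))
          \<in> borel_measurable (time_interval t \<Otimes>\<^sub>M M)" by measurable
      from nn_integral_time_prob(2)[OF this] show ?thesis by (simp add: e_def)
    qed
    finally have *: "e t \<le> ennreal (3 * (T + 9)) * (ennreal (2 * L\<^sup>2) * (\<integral>\<^sup>+s\<in>{0..t}. e s \<partial>lborel) + 2 * ?Rt)"
      by (simp add: mult_left_mono)
    have "?Rt \<le> ?R"
      by (rule nn_integral_time_prob_mono[OF _ tT]) (use r in measurable)
    then have "e t \<le> ennreal (3 * (T + 9)) * (ennreal (2 * (L\<^sup>2 + 1)) * (\<integral>\<^sup>+s\<in>{0..t}. e s \<partial>lborel) + 2 * ?R)"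
      using * by (elim order_trans) (intro mult_left_mono add_mono mult_right_mono ennreal_leI, auto)
    also have "\<dots> = ennreal (6 * (T + 9)) * ?R + ennreal (6 * (T + 9) * (L\<^sup>2 + 1)) * (\<integral>\<^sup>+s\<in>{0..t}. e s \<partial>lborel)"
    proof -
      have "ennreal (3 * (T + 9)) * ennreal (2 * (L\<^sup>2 + 1)) = ennreal (6 * (T + 9) * (L\<^sup>2 + 1))"
        using T by (subst ennreal_mult[symmetric]) (auto simp: algebra_simps)
      moreover have "ennreal (3 * (T + 9)) * 2 = ennreal (6 * (T + 9))"
        using T ennreal_mult[of "3 * (T + 9)" 2] by (simp add: algebra_simps)
      ultimately show ?thesis by (simp add: distrib_left mult.assoc[symmetric] add.commute)
    qed
    finally show "e t \<le> ennreal (6 * (T + 9)) * ?R + ennreal (6 * (T + 9) * (L\<^sup>2 + 1)) * (\<integral>\<^sup>+s\<in>{0..t}. e s \<partial>lborel)" .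
  qed fact
  then show ?thesis by (simp add: e_def)
qed

end

section \<open>Functions of quadratic growth\<close>

text \<open>By Young's inequality with a small weight on the fixed factor \<open>g\<close>.\<close>

lemma nn_integral_mult_tendsto_zero:
  fixes g :: "'p \<Rightarrow> real" and d :: "nat \<Rightarrow> 'p \<Rightarrow> real"
  assumes [measurable]: "g \<in> borel_measurable N" "\<And>n. d n \<in> borel_measurable N"
    and g: "(\<integral>\<^sup>+p. ennreal ((g p)\<^sup>2) \<partial>N) < \<infinity>"
    and d: "(\<lambda>n. \<integral>\<^sup>+p. ennreal ((d n p)\<^sup>2) \<partial>N) \<longlonglongrightarrow> 0"
  shows "(\<lambda>n. \<integral>\<^sup>+p. ennreal (\<bar>g p\<bar> * \<bar>d n p\<bar>) \<partial>N) \<longlonglongrightarrow> 0"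
proof (rule tendsto_zero_ennreal)
  fix e :: real assume "0 < e"
  obtain G where G: "(\<integral>\<^sup>+p. ennreal ((g p)\<^sup>2) \<partial>N) = ennreal G" "G \<ge> 0"
    using g by (cases "\<integral>\<^sup>+p. ennreal ((g p)\<^sup>2) \<partial>N") auto
  define \<epsilon> where "\<epsilon> = e / (2 * (G + 1))"
  have \<epsilon>: "\<epsilon> > 0" "\<epsilon> * G < e / 2"
    using \<open>0 < e\<close> G by (auto simp: \<epsilon>_def field_simps)
  have "eventually (\<lambda>n. (\<integral>\<^sup>+p. ennreal ((d n p)\<^sup>2) \<partial>N) < ennreal (\<epsilon> * (e / 2))) sequentially"
    using order_tendstoD(2)[OF d, of "ennreal (\<epsilon> * (e / 2))"] \<epsilon> \<open>0 < e\<close> by simp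
  then show "eventually (\<lambda>n. (\<integral>\<^sup>+p. ennreal (\<bar>g p\<bar> * \<bar>d n p\<bar>) \<partial>N) < ennreal e) sequentially"
  proof eventually_elim
    fix n assume n: "(\<integral>\<^sup>+p. ennreal ((d n p)\<^sup>2) \<partial>N) < ennreal (\<epsilon> * (e / 2))"
    have "(\<integral>\<^sup>+p. ennreal (\<bar>g p\<bar> * \<bar>d n p\<bar>) \<partial>N) \<le>
        (\<integral>\<^sup>+p. ennreal \<epsilon> * ennreal ((g p)\<^sup>2) + ennreal (1 / \<epsilon>) * ennreal ((d n p)\<^sup>2) \<partial>N)"
    proof (rule nn_integral_mono)
      fix p
      have "\<epsilon> * (\<bar>g p\<bar> * \<bar>d n p\<bar>) \<le> (\<epsilon> * \<bar>g p\<bar>)\<^sup>2 + \<bar>d n p\<bar>\<^sup>2"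
      proof -
        have "0 \<le> \<epsilon> * (\<bar>g p\<bar> * \<bar>d n p\<bar>)" using \<epsilon> by simp
        then show ?thesis
          using zero_le_power2[of "\<epsilon> * \<bar>g p\<bar> - \<bar>d n p\<bar>"]
          unfolding power2_diff by (simp add: mult.assoc)
      qed
      then have "\<bar>g p\<bar> * \<bar>d n p\<bar> \<le> \<epsilon> * (g p)\<^sup>2 + 1 / \<epsilon> * (d n p)\<^sup>2"
        using \<epsilon> by (simp add: field_simps power2_eq_square)
      then have "ennreal (\<bar>g p\<bar> * \<bar>d n p\<bar>) \<le> ennreal (\<epsilon> * (g p)\<^sup>2 + 1 / \<epsilon> * (d n p)\<^sup>2)" by (rule ennreal_leI)
      then show "ennreal (\<bar>g p\<bar> * \<bar>d n p\<bar>) \<le> ennreal \<epsilon> * ennreal ((g p)\<^sup>2) + ennreal (1 / \<epsilon>) * ennreal ((d n p)\<^sup>2)"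
        using \<epsilon> by (simp only: ennreal_mult[symmetric] ennreal_plus[symmetric] zero_le_power2
           mult_nonneg_nonneg less_imp_le divide_nonneg_nonneg zero_le_one)
    qed
    also have "\<dots> = ennreal \<epsilon> * ennreal G + ennreal (1 / \<epsilon>) * (\<integral>\<^sup>+p. ennreal ((d n p)\<^sup>2) \<partial>N)"
      by (simp add: nn_integral_add nn_integral_cmult G)
    also have "\<dots> \<le> ennreal (\<epsilon> * G) + ennreal (1 / \<epsilon>) * ennreal (\<epsilon> * (e / 2))"
      using \<epsilon> G n by (intro add_mono mult_left_mono) (auto simp: ennreal_mult less_imp_le)
    also have "\<dots> = ennreal (\<epsilon> * G + e / 2)"
      using \<epsilon> G \<open>0 < e\<close> by (simp add: ennreal_mult[symmetric])
    also have "\<dots> < ennreal e" using \<epsilon> G \<open>0 < e\<close> by (intro ennreal_lessI) auto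
    finally show "(\<integral>\<^sup>+p. ennreal (\<bar>g p\<bar> * \<bar>d n p\<bar>) \<partial>N) < ennreal e" .
  qed
qed

lemma quadratic_growth_integrable:
  fixes X :: "'p \<Rightarrow> 'x::euclidean_space" and v g :: "'p \<Rightarrow> real"
  assumes "finite_measure N"
    and [measurable]: "X \<in> borel_measurable N" "v \<in> borel_measurable N" "g \<in> borel_measurable N"
    and X: "(\<integral>\<^sup>+p. ennreal ((norm (X p))\<^sup>2) \<partial>N) < \<infinity>" and v: "(\<integral>\<^sup>+p. ennreal ((v p)\<^sup>2) \<partial>N) < \<infinity>"
    and g: "\<And>p. p \<in> space N \<Longrightarrow> \<bar>g p\<bar> \<le> L * (1 + (norm (X p))\<^sup>2 + (v p)\<^sup>2)"
  shows "integrable N g" "integrable N (\<lambda>p. L * (1 + (norm (X p))\<^sup>2 + (v p)\<^sup>2))"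
proof -
  interpret finite_measure N by fact
  have "integrable N (\<lambda>p. (norm (X p))\<^sup>2)" "integrable N (\<lambda>p. (v p)\<^sup>2)"
    using X v by (auto simp: integrable_iff_bounded)
  then show *: "integrable N (\<lambda>p. L * (1 + (norm (X p))\<^sup>2 + (v p)\<^sup>2))" by simp
  show "integrable N g"
    by (rule Bochner_Integration.integrable_bound[OF *]) (use g in \<open>auto intro!: AE_I2 order_trans[OF g]\<close>)
qed

text \<open>The difference splits into the effect of moving the argument from \<open>X0\<close> to \<open>X n\<close>, which is of
  the form (square integrable) times (small in $L^2$) by the local Lipschitz bound, and the effect of
  moving the integrand along the fixed \<open>X0\<close>, which is dominated. It serves for the running cost on
  the product of time and probability space and for the terminal cost on the probability space.\<close>

lemma quadratic_growth_integral_tendsto: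
  fixes X :: "nat \<Rightarrow> 'p \<Rightarrow> 'x::euclidean_space" and v :: "'p \<Rightarrow> real" and \<Phi> :: "nat \<Rightarrow> 'p \<Rightarrow> 'x \<Rightarrow> real"
  assumes N: "finite_measure N"
    and [measurable]: "\<And>n. X n \<in> borel_measurable N" "X0 \<in> borel_measurable N" "v \<in> borel_measurable N"
      "\<And>n. (\<lambda>p. \<Phi> n p (X n p)) \<in> borel_measurable N" "\<And>n. (\<lambda>p. \<Phi> n p (X0 p)) \<in> borel_measurable N"
      "(\<lambda>p. \<Phi>0 p (X0 p)) \<in> borel_measurable N"
    and L: "L \<ge> 0"
    and lip: "\<And>n p x x'. p \<in> space N \<Longrightarrow>
       \<bar>\<Phi> n p x - \<Phi> n p x'\<bar> \<le> L * (1 + norm x + norm x' + \<bar>v p\<bar>) * norm (x - x')"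
    and growth: "\<And>n p x. p \<in> space N \<Longrightarrow> \<bar>\<Phi> n p x\<bar> \<le> L * (1 + (norm x)\<^sup>2 + (v p)\<^sup>2)"
      "\<And>p x. p \<in> space N \<Longrightarrow> \<bar>\<Phi>0 p x\<bar> \<le> L * (1 + (norm x)\<^sup>2 + (v p)\<^sup>2)"
    and lim: "\<And>p. p \<in> space N \<Longrightarrow> (\<lambda>n. \<Phi> n p (X0 p)) \<longlonglongrightarrow> \<Phi>0 p (X0 p)"
    and fin: "\<And>n. (\<integral>\<^sup>+p. ennreal ((norm (X n p))\<^sup>2) \<partial>N) < \<infinity>"
      "(\<integral>\<^sup>+p. ennreal ((norm (X0 p))\<^sup>2) \<partial>N) < \<infinity>" "(\<integral>\<^sup>+p. ennreal ((v p)\<^sup>2) \<partial>N) < \<infinity>"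
    and conv: "(\<lambda>n. \<integral>\<^sup>+p. ennreal ((norm (X n p - X0 p))\<^sup>2) \<partial>N) \<longlonglongrightarrow> 0"
  shows "(\<lambda>n. \<integral>p. \<Phi> n p (X n p) \<partial>N) \<longlonglongrightarrow> (\<integral>p. \<Phi>0 p (X0 p) \<partial>N)"
proof (rule tendsto_L1_int)
  interpret finite_measure N by fact
  show "integrable N (\<lambda>p. \<Phi> n p (X n p))" for n
    by (rule quadratic_growth_integrable[OF N, where X="X n" and v=v and L=L]) (use fin growth in auto)
  show "integrable N (\<lambda>p. \<Phi>0 p (X0 p))"
    by (rule quadratic_growth_integrable[OF N, where X="X0" and v=v and L=L]) (use fin growth in auto)
  \<comment> \<open>\<open>g\<close> does not depend on \<open>n\<close>: \<open>X n\<close> has been replaced by \<open>X0\<close> at the price of one more \<open>d n\<close>.\<close>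
  define g where "g p = 1 + 2 * norm (X0 p) + \<bar>v p\<bar>" for p
  define d where "d n p = norm (X n p - X0 p)" for n p
  have [measurable]: "g \<in> borel_measurable N" "\<And>n. d n \<in> borel_measurable N"
    unfolding g_def d_def by measurable
  have d0: "(\<lambda>n. \<integral>\<^sup>+p. ennreal ((d n p)\<^sup>2) \<partial>N) \<longlonglongrightarrow> 0"
    using conv by (simp add: d_def)
  have g_fin: "(\<integral>\<^sup>+p. ennreal ((g p)\<^sup>2) \<partial>N) < \<infinity>"
  proof -
    have "(\<integral>\<^sup>+p. ennreal ((norm (g p))\<^sup>2) \<partial>N) \<le> 3 * ((\<integral>\<^sup>+p. ennreal ((norm (1::real))\<^sup>2) \<partial>N)
       + (\<integral>\<^sup>+p. ennreal ((norm (2 * norm (X0 p)))\<^sup>2) \<partial>N) + (\<integral>\<^sup>+p. ennreal ((norm (v p))\<^sup>2) \<partial>N))"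
      by (rule nn_integral_norm_sum3; (measurable)?) (simp add: g_def)
    also have "(\<integral>\<^sup>+p. ennreal ((norm (2 * norm (X0 p)))\<^sup>2) \<partial>N) = 4 * (\<integral>\<^sup>+p. ennreal ((norm (X0 p))\<^sup>2) \<partial>N)"
      by (subst nn_integral_cmult[symmetric]) (auto simp: power_mult_distrib ennreal_mult)
    finally have "(\<integral>\<^sup>+p. ennreal ((g p)\<^sup>2) \<partial>N) \<le> 3 * (emeasure N (space N)
       + 4 * (\<integral>\<^sup>+p. ennreal ((norm (X0 p))\<^sup>2) \<partial>N) + (\<integral>\<^sup>+p. ennreal ((v p)\<^sup>2) \<partial>N))" by simp
    also have "\<dots> < \<infinity>"
      using fin by (simp add: ennreal_mult_less_top less_top[symmetric] emeasure_finite ennreal_mult_eq_top_iff)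
    finally show ?thesis .
  qed
  let ?a = "\<lambda>n. \<integral>\<^sup>+p. ennreal (\<bar>g p\<bar> * \<bar>d n p\<bar>) \<partial>N"
  let ?b = "\<lambda>n. \<integral>\<^sup>+p. ennreal ((d n p)\<^sup>2) \<partial>N"
  let ?c = "\<lambda>n. \<integral>\<^sup>+p. ennreal (norm (\<Phi> n p (X0 p) - \<Phi>0 p (X0 p))) \<partial>N"
  have a0: "?a \<longlonglongrightarrow> 0" by (rule nn_integral_mult_tendsto_zero[OF _ _ g_fin d0]) measurable
  have "?c \<longlonglongrightarrow> (\<integral>\<^sup>+p. 0 \<partial>N)"
  proof (rule nn_integral_dominated_convergence)
    let ?w = "\<lambda>p. 2 * (L * (1 + (norm (X0 p))\<^sup>2 + (v p)\<^sup>2))"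
    show "AE p in N. ennreal (norm (\<Phi> n p (X0 p) - \<Phi>0 p (X0 p))) \<le> ennreal (?w p)" for n
    proof (intro AE_I2 ennreal_leI)
      fix p assume "p \<in> space N"
      from growth(1)[OF this, of n "X0 p"] growth(2)[OF this, of "X0 p"]
      show "norm (\<Phi> n p (X0 p) - \<Phi>0 p (X0 p)) \<le> ?w p" by simp
    qed
    have "integrable N (\<lambda>p. L * (1 + (norm (X0 p))\<^sup>2 + (v p)\<^sup>2))"
      by (rule quadratic_growth_integrable(2)[OF N, where g="\<lambda>p. \<Phi>0 p (X0 p)"]) (use fin growth in auto)
    then have "integrable N ?w" by simp
    then have "(\<integral>\<^sup>+p. ennreal (norm (?w p)) \<partial>N) < \<infinity>" unfolding integrable_iff_bounded by blast
    moreover have "norm (?w p) = ?w p" for p using L by simp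
    ultimately show "(\<integral>\<^sup>+p. ennreal (?w p) \<partial>N) < \<infinity>" by simp
    show "AE p in N. (\<lambda>n. ennreal (norm (\<Phi> n p (X0 p) - \<Phi>0 p (X0 p)))) \<longlonglongrightarrow> 0"
    proof (rule AE_I2)
      fix p assume "p \<in> space N"
      have "(\<lambda>n. norm (\<Phi> n p (X0 p) - \<Phi>0 p (X0 p))) \<longlonglongrightarrow> 0"
        by (intro tendsto_norm_zero LIM_zero lim) fact
      then show "(\<lambda>n. ennreal (norm (\<Phi> n p (X0 p) - \<Phi>0 p (X0 p)))) \<longlonglongrightarrow> 0"
        by (subst ennreal_tendsto_0_iff) auto
    qed
  qed measurable
  then have c0: "?c \<longlonglongrightarrow> 0" by simp
  have bound: "(\<integral>\<^sup>+p. ennreal (norm (\<Phi> n p (X n p) - \<Phi>0 p (X0 p))) \<partial>N) \<le>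
      ennreal L * (?a n + ?b n) + ?c n" for n
  proof -
    have "(\<integral>\<^sup>+p. ennreal (norm (\<Phi> n p (X n p) - \<Phi>0 p (X0 p))) \<partial>N) \<le>
      (\<integral>\<^sup>+p. ennreal L * (ennreal (\<bar>g p\<bar> * \<bar>d n p\<bar>) + ennreal ((d n p)\<^sup>2))
         + ennreal (norm (\<Phi> n p (X0 p) - \<Phi>0 p (X0 p))) \<partial>N)"
    proof (rule nn_integral_mono)
      fix p assume p: "p \<in> space N"
      have ge: "g p \<ge> 0" "d n p \<ge> 0" by (auto simp: g_def d_def)
      have "1 + norm (X n p) + norm (X0 p) + \<bar>v p\<bar> \<le> g p + d n p"
        unfolding g_def d_def using norm_triangle_sub[of "X n p" "X0 p"] by simp
      then have "L * (1 + norm (X n p) + norm (X0 p) + \<bar>v p\<bar>) * d n p \<le> L * (g p + d n p) * d n p"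
        using L ge by (intro mult_right_mono mult_left_mono) auto
      then have "norm (\<Phi> n p (X n p) - \<Phi>0 p (X0 p)) \<le>
          L * (\<bar>g p\<bar> * \<bar>d n p\<bar> + (d n p)\<^sup>2) + norm (\<Phi> n p (X0 p) - \<Phi>0 p (X0 p))"
        using lip[OF p, of n "X n p" "X0 p"] ge unfolding d_def[symmetric]
        by (simp add: algebra_simps power2_eq_square)
      then have "ennreal (norm (\<Phi> n p (X n p) - \<Phi>0 p (X0 p))) \<le>
          ennreal (L * (\<bar>g p\<bar> * \<bar>d n p\<bar> + (d n p)\<^sup>2) + norm (\<Phi> n p (X0 p) - \<Phi>0 p (X0 p)))"
        by (rule ennreal_leI)
      also have "\<dots> = ennreal L * (ennreal (\<bar>g p\<bar> * \<bar>d n p\<bar>) + ennreal ((d n p)\<^sup>2))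
         + ennreal (norm (\<Phi> n p (X0 p) - \<Phi>0 p (X0 p)))"
        using L by (simp add: ennreal_mult)
      finally show "ennreal (norm (\<Phi> n p (X n p) - \<Phi>0 p (X0 p))) \<le>
         ennreal L * (ennreal (\<bar>g p\<bar> * \<bar>d n p\<bar>) + ennreal ((d n p)\<^sup>2))
         + ennreal (norm (\<Phi> n p (X0 p) - \<Phi>0 p (X0 p)))" .
    qed
    also have "\<dots> = ennreal L * (?a n + ?b n) + ?c n"
      by (simp add: nn_integral_add nn_integral_cmult)
    finally show ?thesis .
  qed
  have "(\<lambda>n. ennreal L * (?a n + ?b n) + ?c n) \<longlonglongrightarrow> ennreal L * (0 + 0) + 0"
    by (intro tendsto_add ennreal_tendsto_cmult a0 d0 c0) simp
  then have lim0: "(\<lambda>n. ennreal L * (?a n + ?b n) + ?c n) \<longlonglongrightarrow> 0" by simp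
  show "(\<lambda>n. \<integral>\<^sup>+p. ennreal (norm (\<Phi> n p (X n p) - \<Phi>0 p (X0 p))) \<partial>N) \<longlonglongrightarrow> 0"
  proof (rule tendsto_sandwich[OF _ _ tendsto_const lim0])
    show "\<forall>\<^sub>F n in sequentially. (\<integral>\<^sup>+p. ennreal (norm (\<Phi> n p (X n p) - \<Phi>0 p (X0 p))) \<partial>N) \<le>
        ennreal L * (?a n + ?b n) + ?c n"
      by (rule always_eventually) (rule allI, rule bound)
  qed simp
qed

text \<open>The mean value inequality on the segment from \<open>x\<close> to \<open>x'\<close>, all of whose points have norm at most
  \<open>norm x + norm x'\<close>.\<close>

lemma quadratic_growth_lipschitz:
  fixes \<phi> :: "'x::euclidean_space \<Rightarrow> real"
  assumes deriv: "\<And>y. (\<phi> has_derivative (\<lambda>d. G y \<bullet> d)) (at y)"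
    and G: "\<And>y. norm (G y) \<le> L * (1 + norm y + c)" and L: "L \<ge> 0" "c \<ge> 0"
  shows "\<bar>\<phi> x - \<phi> x'\<bar> \<le> L * (1 + norm x + norm x' + c) * norm (x - x')"
proof -
  have "norm (\<phi> x - \<phi> x') \<le> (L * (1 + norm x + norm x' + c)) * norm (x - x')"
  proof (rule differentiable_bound[of "closed_segment x x'" \<phi> "\<lambda>y d. G y \<bullet> d"])
    fix y assume y: "y \<in> closed_segment x x'"
    show "(\<phi> has_derivative (\<lambda>d. G y \<bullet> d)) (at y within closed_segment x x')"
      by (rule has_derivative_at_withinI[OF deriv])
    have "norm y \<le> norm x + norm x'"
    proof -
      obtain u where u: "0 \<le> u" "u \<le> 1" "y = (1 - u) *\<^sub>R x + u *\<^sub>R x'"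
        using y by (auto simp: closed_segment_def)
      have "norm y \<le> (1 - u) * norm x + u * norm x'"
        using u norm_triangle_ineq[of "(1 - u) *\<^sub>R x" "u *\<^sub>R x'"] by simp
      also have "\<dots> \<le> 1 * norm x + 1 * norm x'" using u by (intro add_mono mult_right_mono) auto
      finally show ?thesis by simp
    qed
    then have "norm (G y) \<le> L * (1 + norm x + norm x' + c)"
      using G[of y] L by (elim order_trans) (intro mult_left_mono, auto)
    moreover have "onorm (\<lambda>d. G y \<bullet> d) \<le> norm (G y)"
      using Cauchy_Schwarz_ineq2[of "G y"] by (intro onorm_bound) auto
    ultimately show "onorm (\<lambda>d. G y \<bullet> d) \<le> L * (1 + norm x + norm x' + c)" by simp
  qed auto
  then show ?thesis by simp
qed

lemma linear_functional_eq_inner: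
  fixes l :: "real^'n \<Rightarrow> real"
  assumes "linear l" shows "l d = (\<chi> i. l (axis i 1)) \<bullet> d"
proof -
  have "l d = l (\<Sum>i\<in>UNIV. d $ i *s axis i 1)" by (simp add: basis_expansion)
  also have "\<dots> = (\<Sum>i\<in>UNIV. d $ i * l (axis i 1))"
    using assms by (simp add: linear_sum linear_cmul scalar_mult_eq_scaleR)
  finally show ?thesis by (simp add: inner_vec_def mult.commute)
qed

text \<open>The derivative in both variables is taken within \<open>UNIV \<times> U\<close> only, but the state variable is
  unrestricted, so the partial derivative in it is a full one.\<close>

lemma C2_on_deriv_x:
  fixes \<phi> :: "((real^'n) \<times> (real^'m), real) c2_fun"
  assumes "C2_on (UNIV \<times> U) \<phi>" "u \<in> U"
  shows "((\<lambda>y. val \<phi> (y, u)) has_derivative (\<lambda>d. grad_x \<phi> (y, u) \<bullet> d)) (at y)"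
proof -
  have deriv: "((\<lambda>y. val \<phi> (y, u)) has_derivative (\<lambda>d. blinfun_apply (deriv1 \<phi> (y, u)) (d, 0))) (at y within UNIV)"
  proof (rule has_derivative_in_compose2[where t="UNIV \<times> U" and g="val \<phi>" and g'="\<lambda>z. blinfun_apply (deriv1 \<phi> z)"])
    show "((\<lambda>y. (y, u)) has_derivative (\<lambda>d. (d, 0))) (at y within UNIV)"
      by (auto intro!: derivative_eq_intros)
  qed (use assms in \<open>auto simp: C2_on_def\<close>)
  have lin: "linear (\<lambda>d. blinfun_apply (deriv1 \<phi> (y, u)) (d, 0))"
  proof (rule linearI)
    show "blinfun_apply (deriv1 \<phi> (y, u)) (d + e, 0) =
        blinfun_apply (deriv1 \<phi> (y, u)) (d, 0) + blinfun_apply (deriv1 \<phi> (y, u)) (e, 0)" for d e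
      using blinfun.add_right[of "deriv1 \<phi> (y, u)" "(d, 0)" "(e, 0)"] by simp
    show "blinfun_apply (deriv1 \<phi> (y, u)) (r *\<^sub>R d, 0) = r *\<^sub>R blinfun_apply (deriv1 \<phi> (y, u)) (d, 0)" for r d
      using blinfun.scaleR_right[of "deriv1 \<phi> (y, u)" r "(d, 0)"] by simp
  qed
  have "blinfun_apply (deriv1 \<phi> (y, u)) (d, 0) = grad_x \<phi> (y, u) \<bullet> d" for d
    unfolding grad_x_def by (rule linear_functional_eq_inner[OF lin])
  with deriv show ?thesis by simp
qed

lemma C2_on_deriv:
  fixes \<phi> :: "(real^'n, real) c2_fun"
  assumes "C2_on UNIV \<phi>"
  shows "(val \<phi> has_derivative (\<lambda>d. grad \<phi> y \<bullet> d)) (at y)"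
proof -
  have "(val \<phi> has_derivative blinfun_apply (deriv1 \<phi> y)) (at y)"
    using assms by (simp add: C2_on_def)
  moreover have "blinfun_apply (deriv1 \<phi> y) = (\<lambda>d. grad \<phi> y \<bullet> d)"
    unfolding grad_def
    by (rule ext) (rule linear_functional_eq_inner[OF bounded_linear.linear[OF blinfun.bounded_linear_right]])
  ultimately show ?thesis by simp
qed

text \<open>A sequence may hit its limit, so besides the limit of the modulus from the right its value at \<open>0\<close>
  matters.\<close>

lemma modulus_of_continuity_tendsto:
  fixes \<gamma> :: "nat \<Rightarrow> 'g::metric_space"
  assumes w: "modulus_of_continuity w" and \<gamma>: "\<gamma> \<longlonglongrightarrow> \<gamma>0"
  shows "(\<lambda>n. w (dist (\<gamma> n) \<gamma>0)) \<longlonglongrightarrow> 0"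
proof (rule tendstoI)
  fix e :: real assume "e > 0"
  have "eventually (\<lambda>r. dist (w r) 0 < e) (at_right 0)"
    using w \<open>e > 0\<close> unfolding modulus_of_continuity_def by (blast dest: tendstoD)
  then obtain \<delta> where \<delta>: "\<delta> > 0" "\<And>r. 0 < r \<Longrightarrow> r < \<delta> \<Longrightarrow> dist (w r) 0 < e"
    unfolding eventually_at_right[OF zero_less_one] by auto
  have "eventually (\<lambda>n. dist (\<gamma> n) \<gamma>0 < \<delta>) sequentially" using \<gamma> \<delta>(1) by (rule tendstoD)
  then show "eventually (\<lambda>n. dist (w (dist (\<gamma> n) \<gamma>0)) 0 < e) sequentially"
  proof eventually_elim
    fix n assume "dist (\<gamma> n) \<gamma>0 < \<delta>"
    then show "dist (w (dist (\<gamma> n) \<gamma>0)) 0 < e"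
      using \<delta>(2)[of "dist (\<gamma> n) \<gamma>0"] w \<open>e > 0\<close>
      by (cases "dist (\<gamma> n) \<gamma>0 = 0") (auto simp: modulus_of_continuity_def)
  qed
qed

lemma c2_close_tendsto:
  assumes "modulus_of_continuity w" "\<gamma> \<longlonglongrightarrow> \<gamma>0"
    and "\<And>n. c2_close (\<phi> (\<gamma> n)) (\<phi> \<gamma>0) z (w (dist (\<gamma> n) \<gamma>0))"
  shows "(\<lambda>n. val (\<phi> (\<gamma> n)) z) \<longlonglongrightarrow> val (\<phi> \<gamma>0) z"
proof -
  have "(\<lambda>n. val (\<phi> (\<gamma> n)) z - val (\<phi> \<gamma>0) z) \<longlonglongrightarrow> 0"
    by (rule Lim_null_comparison[OF _ modulus_of_continuity_tendsto[OF assms(1,2)]])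
      (use assms(3) in \<open>auto simp: c2_close_def\<close>)
  then show ?thesis by (simp add: LIM_zero_iff)
qed

section \<open>Continuous dependence of the state on the model\<close>

locale robust_state = brownian_space M T W
  for M :: "'w measure" and T :: real and W :: "real \<Rightarrow> 'w \<Rightarrow> real" +
  fixes U :: "(real^'m) set"
    and b \<sigma> :: "'g::metric_space \<Rightarrow> real \<Rightarrow> ((real^'n) \<times> (real^'m), real^'n) c2_fun"
    and f :: "'g \<Rightarrow> real \<Rightarrow> ((real^'n) \<times> (real^'m), real) c2_fun"
    and h :: "'g \<Rightarrow> (real^'n, real) c2_fun"
    and x0 :: "real^'n"
    and u :: "real \<Rightarrow> 'w \<Rightarrow> real^'m"
    and x :: "(real \<Rightarrow> 'w \<Rightarrow> real^'m) \<Rightarrow> 'g \<Rightarrow> real \<Rightarrow> 'w \<Rightarrow> real^'n"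
  assumes T_pos: "T > 0"
    and regular: "coefficients_regular T U b \<sigma> f h"
    and equicontinuous: "coefficients_equicontinuous T U b \<sigma> f h"
    and state: "solves_state M F W T x0 (b \<gamma>) (\<sigma> \<gamma>) u (x u \<gamma>)"
    and u_in_U: "\<And>t \<omega>. t \<in> {0..T} \<Longrightarrow> \<omega> \<in> space M \<Longrightarrow> u t \<omega> \<in> U"
    and u_measurable: "(\<lambda>p. u (fst p) (snd p)) \<in> borel_measurable (time_interval T \<Otimes>\<^sub>M M)"
    and u_square: "(\<integral>\<^sup>+p. ennreal ((norm (u (fst p) (snd p)))\<^sup>2) \<partial>time_prob M T) < \<infinity>"
begin

abbreviation X :: "'g \<Rightarrow> real \<Rightarrow> 'w \<Rightarrow> real^'n" where
  "X \<equiv> x u"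

lemma X_adapted: "adapted_measurable M F T (X \<gamma>)"
  using state[of \<gamma>] by (simp add: solves_state_def continuous_adapted_def)

lemma X_init: "AE \<omega> in M. X \<gamma> 0 \<omega> = x0"
  using state[of \<gamma>] by (simp add: solves_state_def)

lemma X_dynamics:
  "ito_dynamics M F W T (X \<gamma>) (\<lambda>t \<omega>. val (b \<gamma> t) (X \<gamma> t \<omega>, u t \<omega>)) (\<lambda>t \<omega>. val (\<sigma> \<gamma> t) (X \<gamma> t \<omega>, u t \<omega>))"
  using state[of \<gamma>] by (simp add: solves_state_def)

lemma X_measurable: "(\<lambda>p. X \<gamma> (fst p) (snd p)) \<in> borel_measurable (time_interval T \<Otimes>\<^sub>M M)"
  by (rule adapted_measurable_joint[OF X_adapted])

lemma X_measurable_at: "t \<in> {0..T} \<Longrightarrow> X \<gamma> t \<in> borel_measurable M"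
  by (rule adapted_measurable_at[OF X_adapted])

lemma coefficient_measurable:
  fixes \<phi> :: "real \<Rightarrow> ((real^'n) \<times> (real^'m), 'a::euclidean_space) c2_fun"
  assumes "(\<lambda>(t, z). val (\<phi> t) z) \<in> borel_measurable (restrict_space borel ({0..T} \<times> UNIV \<times> U))"
  shows "(\<lambda>p. val (\<phi> (fst p)) (X \<gamma> (fst p) (snd p), u (fst p) (snd p))) \<in> borel_measurable (time_interval T \<Otimes>\<^sub>M M)"
proof -
  let ?N = "time_interval T \<Otimes>\<^sub>M M"
  let ?g = "\<lambda>p. (fst p, (X \<gamma> (fst p) (snd p), u (fst p) (snd p)))"
  have "fst \<in> borel_measurable ?N"
    by (rule measurable_compose[OF measurable_fst]) (simp add: measurable_restrict_space1)
  then have "?g \<in> borel_measurable ?N"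
    by (intro borel_measurable_Pair X_measurable u_measurable)
  moreover have "?g \<in> space ?N \<rightarrow> {0..T} \<times> UNIV \<times> U"
    using u_in_U by (auto simp: space_pair_measure space_restrict_space)
  ultimately have "?g \<in> measurable ?N (restrict_space borel ({0..T} \<times> UNIV \<times> U))"
    by (rule measurable_restrict_space2[rotated])
  from measurable_compose[OF this assms] show ?thesis by simp
qed

lemma coefficients_measurable:
  "(\<lambda>p. val (b \<gamma> (fst p)) (X \<gamma>' (fst p) (snd p), u (fst p) (snd p))) \<in> borel_measurable (time_interval T \<Otimes>\<^sub>M M)"
  "(\<lambda>p. val (\<sigma> \<gamma> (fst p)) (X \<gamma>' (fst p) (snd p), u (fst p) (snd p))) \<in> borel_measurable (time_interval T \<Otimes>\<^sub>M M)"
  "(\<lambda>p. val (f \<gamma> (fst p)) (X \<gamma>' (fst p) (snd p), u (fst p) (snd p))) \<in> borel_measurable (time_interval T \<Otimes>\<^sub>M M)"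
  "val (h \<gamma>) \<in> borel_measurable borel"
  using regular unfolding coefficients_regular_def by (auto intro!: coefficient_measurable)

lemma coefficients_bounded:
  "\<exists>K. \<forall>\<gamma>. \<forall>t\<in>{0..T}. \<forall>y. \<forall>v\<in>U. norm (val (b \<gamma> t) (y, v)) \<le> K \<and> norm (val (\<sigma> \<gamma> t) (y, v)) \<le> K"
proof -
  obtain K where "\<forall>\<gamma>. \<forall>t\<in>{0..T}. \<forall>y. \<forall>v\<in>U. \<forall>\<phi>\<in>{b \<gamma> t, \<sigma> \<gamma> t}.
          norm (val \<phi> (y, v)) \<le> K \<and> norm (deriv1 \<phi> (y, v)) \<le> K \<and> norm (deriv2 \<phi> (y, v)) \<le> K"
    using regular unfolding coefficients_regular_def by (elim conjE exE) blast
  then show ?thesis by (intro exI[of _ K]) simp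
qed

lemma coefficients_lipschitz:
  "\<exists>L. \<forall>\<gamma>. \<forall>t\<in>{0..T}. \<forall>y y'. \<forall>v\<in>U.
     norm (val (b \<gamma> t) (y, v) - val (b \<gamma> t) (y', v)) + norm (val (\<sigma> \<gamma> t) (y, v) - val (\<sigma> \<gamma> t) (y', v))
       \<le> L * norm (y - y')"
proof -
  obtain L where L: "\<forall>\<gamma>. \<forall>t\<in>{0..T}. \<forall>y y'. \<forall>v\<in>U. \<forall>v'\<in>U.
          norm (val (b \<gamma> t) (y, v) - val (b \<gamma> t) (y', v'))
            + norm (val (\<sigma> \<gamma> t) (y, v) - val (\<sigma> \<gamma> t) (y', v')) \<le> L * (norm (y - y') + norm (v - v'))"
    using regular unfolding coefficients_regular_def by (elim conjE exE) blast
  show ?thesis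
  proof (intro exI[of _ L] allI ballI)
    fix \<gamma> t y y' v assume "t \<in> {0..T}" "v \<in> U"
    with L have "norm (val (b \<gamma> t) (y, v) - val (b \<gamma> t) (y', v))
            + norm (val (\<sigma> \<gamma> t) (y, v) - val (\<sigma> \<gamma> t) (y', v)) \<le> L * (norm (y - y') + norm (v - v))" by blast
    then show "norm (val (b \<gamma> t) (y, v) - val (b \<gamma> t) (y', v))
            + norm (val (\<sigma> \<gamma> t) (y, v) - val (\<sigma> \<gamma> t) (y', v)) \<le> L * norm (y - y')" by simp
  qed
qed

text \<open>The growth bounds on the costs are assumptions; the local Lipschitz bounds follow from the linear
  growth of the gradients in the state variable.\<close>

lemma costs_growth:
  "\<exists>L\<ge>0. \<forall>\<gamma>. \<forall>t\<in>{0..T}. \<forall>y y'. \<forall>v\<in>U.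
     \<bar>val (f \<gamma> t) (y, v)\<bar> \<le> L * (1 + (norm y)\<^sup>2 + (norm v)\<^sup>2) \<and>
     \<bar>val (h \<gamma>) y\<bar> \<le> L * (1 + (norm y)\<^sup>2) \<and>
     \<bar>val (f \<gamma> t) (y, v) - val (f \<gamma> t) (y', v)\<bar> \<le> L * (1 + norm y + norm y' + norm v) * norm (y - y') \<and>
     \<bar>val (h \<gamma>) y - val (h \<gamma>) y'\<bar> \<le> L * (1 + norm y + norm y') * norm (y - y')"
proof -
  obtain L where "L > 0" and L: "\<forall>\<gamma>. \<forall>t\<in>{0..T}. \<forall>y y'. \<forall>v\<in>U. \<forall>v'\<in>U.
          \<bar>val (f \<gamma> t) (y, v)\<bar> \<le> L * (1 + (norm y)\<^sup>2 + (norm v)\<^sup>2) \<and>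
          \<bar>val (h \<gamma>) y\<bar> \<le> L * (1 + (norm y)\<^sup>2) \<and>
          norm (grad_x (f \<gamma> t) (y, v)) + norm (grad_u (f \<gamma> t) (y, v)) \<le> L * (1 + norm y + norm v) \<and>
          norm (hess_xx (f \<gamma> t) (y, v)) + norm (hess_xu (f \<gamma> t) (y, v)) + norm (hess_uu (f \<gamma> t) (y, v)) \<le> L \<and>
          norm (deriv2 (f \<gamma> t) (y, v) - deriv2 (f \<gamma> t) (y', v')) \<le> L * (norm (y - y') + norm (v - v')) \<and>
          norm (grad (h \<gamma>) y) \<le> L * (1 + norm y) \<and>
          norm (hess (h \<gamma>) y) \<le> L"
    using regular unfolding coefficients_regular_def by (elim conjE exE) blast
  have "\<forall>\<gamma>. \<forall>t\<in>{0..T}. C2_on (UNIV \<times> U) (b \<gamma> t) \<and> C2_on (UNIV \<times> U) (\<sigma> \<gamma> t) \<and>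
      C2_on (UNIV \<times> U) (f \<gamma> t) \<and> C2_on UNIV (h \<gamma>)"
    using regular unfolding coefficients_regular_def by (elim conjE)
  then have C2: "\<forall>\<gamma>. \<forall>t\<in>{0..T}. C2_on (UNIV \<times> U) (f \<gamma> t) \<and> C2_on UNIV (h \<gamma>)" by blast
  show ?thesis
  proof (intro exI[of _ L] conjI allI ballI)
    show "L \<ge> 0" using \<open>L > 0\<close> by simp
    fix \<gamma> t and y y' :: "real^'n" and v assume t: "t \<in> {0..T}" and v: "v \<in> U"
    have f: "\<bar>val (f \<gamma> t) (y, v)\<bar> \<le> L * (1 + (norm y)\<^sup>2 + (norm v)\<^sup>2)"
      and h: "\<bar>val (h \<gamma>) y\<bar> \<le> L * (1 + (norm y)\<^sup>2)"
      and fx: "norm (grad_x (f \<gamma> t) (y, v)) + norm (grad_u (f \<gamma> t) (y, v)) \<le> L * (1 + norm y + norm v)"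
      and hx: "norm (grad (h \<gamma>) y) \<le> L * (1 + norm y)" for y
      using L[rule_format, OF t v v] by blast+
    show "\<bar>val (f \<gamma> t) (y, v)\<bar> \<le> L * (1 + (norm y)\<^sup>2 + (norm v)\<^sup>2)" by (rule f)
    show "\<bar>val (h \<gamma>) y\<bar> \<le> L * (1 + (norm y)\<^sup>2)" by (rule h)
    show "\<bar>val (f \<gamma> t) (y, v) - val (f \<gamma> t) (y', v)\<bar> \<le> L * (1 + norm y + norm y' + norm v) * norm (y - y')"
    proof (rule quadratic_growth_lipschitz[where \<phi>="\<lambda>y. val (f \<gamma> t) (y, v)" and G="\<lambda>y. grad_x (f \<gamma> t) (y, v)"])
      show "((\<lambda>y. val (f \<gamma> t) (y, v)) has_derivative (\<lambda>d. grad_x (f \<gamma> t) (y, v) \<bullet> d)) (at y)" for y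
        using C2 t by (intro C2_on_deriv_x[OF _ v]) blast
      show "norm (grad_x (f \<gamma> t) (y, v)) \<le> L * (1 + norm y + norm v)" for y
        using fx[of y] norm_ge_zero[of "grad_u (f \<gamma> t) (y, v)"] by linarith
    qed (use \<open>L > 0\<close> in auto)
    have "\<bar>val (h \<gamma>) y - val (h \<gamma>) y'\<bar> \<le> L * (1 + norm y + norm y' + 0) * norm (y - y')"
    proof (rule quadratic_growth_lipschitz[where \<phi>="val (h \<gamma>)" and G="grad (h \<gamma>)"])
      show "(val (h \<gamma>) has_derivative (\<lambda>d. grad (h \<gamma>) y \<bullet> d)) (at y)" for y
        using C2 t by (intro C2_on_deriv) blast
    qed (use \<open>L > 0\<close> hx in auto)
    then show "\<bar>val (h \<gamma>) y - val (h \<gamma>) y'\<bar> \<le> L * (1 + norm y + norm y') * norm (y - y')" by simp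
  qed
qed

text \<open>The modulus of continuity depends on a positive bound for the state; \<open>norm y + 1\<close> is one.\<close>

lemma coefficients_tendsto:
  assumes \<gamma>: "\<gamma> \<longlonglongrightarrow> \<gamma>0" and t: "t \<in> {0..T}" and v: "v \<in> U"
  shows "(\<lambda>n. val (b (\<gamma> n) t) (y, v)) \<longlonglongrightarrow> val (b \<gamma>0 t) (y, v)"
    "(\<lambda>n. val (\<sigma> (\<gamma> n) t) (y, v)) \<longlonglongrightarrow> val (\<sigma> \<gamma>0 t) (y, v)"
    "(\<lambda>n. val (f (\<gamma> n) t) (y, v)) \<longlonglongrightarrow> val (f \<gamma>0 t) (y, v)"
    "(\<lambda>n. val (h (\<gamma> n)) y) \<longlonglongrightarrow> val (h \<gamma>0) y"
proof -
  have "norm y + 1 > 0" using norm_ge_zero[of y] by linarith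
  then obtain w where w: "modulus_of_continuity w" and
    *: "\<forall>t\<in>{0..T}. \<forall>y'. norm y' \<le> norm y + 1 \<longrightarrow> (\<forall>v\<in>U. \<forall>\<gamma> \<gamma>'.
           c2_close (b \<gamma> t) (b \<gamma>' t) (y', v) (w (dist \<gamma> \<gamma>')) \<and>
           c2_close (\<sigma> \<gamma> t) (\<sigma> \<gamma>' t) (y', v) (w (dist \<gamma> \<gamma>')) \<and>
           c2_close (f \<gamma> t) (f \<gamma>' t) (y', v) (w (dist \<gamma> \<gamma>')) \<and>
           c2_close (h \<gamma>) (h \<gamma>') y' (w (dist \<gamma> \<gamma>')))"
    using equicontinuous unfolding coefficients_equicontinuous_def by blast
  have close: "c2_close (b \<gamma> t) (b \<gamma>' t) (y, v) (w (dist \<gamma> \<gamma>'))"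
    "c2_close (\<sigma> \<gamma> t) (\<sigma> \<gamma>' t) (y, v) (w (dist \<gamma> \<gamma>'))"
    "c2_close (f \<gamma> t) (f \<gamma>' t) (y, v) (w (dist \<gamma> \<gamma>'))"
    "c2_close (h \<gamma>) (h \<gamma>') y (w (dist \<gamma> \<gamma>'))" for \<gamma> \<gamma>'
    using *[rule_format, OF t _ v, of y \<gamma> \<gamma>'] by simp_all
  show "(\<lambda>n. val (b (\<gamma> n) t) (y, v)) \<longlonglongrightarrow> val (b \<gamma>0 t) (y, v)"
    by (rule c2_close_tendsto[OF w \<gamma>, of "\<lambda>\<gamma>. b \<gamma> t"]) (rule close)
  show "(\<lambda>n. val (\<sigma> (\<gamma> n) t) (y, v)) \<longlonglongrightarrow> val (\<sigma> \<gamma>0 t) (y, v)"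
    by (rule c2_close_tendsto[OF w \<gamma>, of "\<lambda>\<gamma>. \<sigma> \<gamma> t"]) (rule close)
  show "(\<lambda>n. val (f (\<gamma> n) t) (y, v)) \<longlonglongrightarrow> val (f \<gamma>0 t) (y, v)"
    by (rule c2_close_tendsto[OF w \<gamma>, of "\<lambda>\<gamma>. f \<gamma> t"]) (rule close)
  show "(\<lambda>n. val (h (\<gamma> n)) y) \<longlonglongrightarrow> val (h \<gamma>0) y"
    by (rule c2_close_tendsto[OF w \<gamma>, of h]) (rule close)
qed

text \<open>The bound is uniform in the model because the drift and diffusion coefficients are.\<close>

lemma state_moment_bound:
  "\<exists>C. \<forall>\<gamma>. \<forall>t\<in>{0..T}. (\<integral>\<^sup>+\<omega>. ennreal ((norm (X \<gamma> t \<omega>))\<^sup>2) \<partial>M) \<le> ennreal C"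
proof -
  obtain K where K: "\<forall>\<gamma>. \<forall>t\<in>{0..T}. \<forall>y. \<forall>v\<in>U. norm (val (b \<gamma> t) (y, v)) \<le> K \<and> norm (val (\<sigma> \<gamma> t) (y, v)) \<le> K"
    using coefficients_bounded by blast
  let ?B = "3 * (T * (K\<^sup>2 * T) + 9 * (K\<^sup>2 * T))"
  have "(\<integral>\<^sup>+\<omega>. ennreal ((norm (X \<gamma> t \<omega>))\<^sup>2) \<partial>M) \<le> ennreal (3 * (?B + (norm x0)\<^sup>2))" if t: "t \<in> {0..T}" for \<gamma> t
  proof -
    note [measurable] = X_measurable_at[OF t]
    have "(\<integral>\<^sup>+\<omega>. ennreal ((norm (X \<gamma> t \<omega>))\<^sup>2) \<partial>M) \<le> 3 * ((\<integral>\<^sup>+\<omega>. ennreal ((norm (X \<gamma> t \<omega> - x0))\<^sup>2) \<partial>M)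
       + (\<integral>\<^sup>+\<omega>. ennreal ((norm x0)\<^sup>2) \<partial>M) + (\<integral>\<^sup>+\<omega>. ennreal ((norm (0 :: real^'n))\<^sup>2) \<partial>M))"
      by (rule nn_integral_norm_sum3; (measurable)?) norm
    also have "\<dots> \<le> 3 * (ennreal ?B + ennreal ((norm x0)\<^sup>2) + 0)"
    proof (intro mult_left_mono add_mono)
      show "(\<integral>\<^sup>+\<omega>. ennreal ((norm (X \<gamma> t \<omega> - x0))\<^sup>2) \<partial>M) \<le> ennreal ?B"
        by (rule ito_dynamics_moment_bound[OF X_dynamics X_adapted X_init coefficients_measurable(1) _ t])
          (use K u_in_U in blast)
    qed (simp_all add: emeasure_space_1)
    also have "\<dots> = ennreal (3 * (?B + (norm x0)\<^sup>2))"
      using T_pos ennreal_mult[of 3 "?B + (norm x0)\<^sup>2"] ennreal_plus[of ?B "(norm x0)\<^sup>2"]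
      by (simp del: ennreal_plus)
    finally show ?thesis .
  qed
  then show ?thesis by blast
qed

text \<open>The discrepancy of the coefficients along the limiting state is bounded by \<open>4 * K\<close> and tends to
  zero pointwise, hence in $L^2$ by dominated convergence, and stability applies.\<close>

lemma state_continuous:
  assumes \<gamma>: "\<gamma> \<longlonglongrightarrow> \<gamma>0"
  shows "\<exists>\<eta>. \<eta> \<longlonglongrightarrow> 0 \<and>
    (\<forall>n. \<forall>t\<in>{0..T}. (\<integral>\<^sup>+\<omega>. ennreal ((norm (X (\<gamma> n) t \<omega> - X \<gamma>0 t \<omega>))\<^sup>2) \<partial>M) \<le> \<eta> n)"
proof -
  obtain K where K: "\<forall>\<gamma>. \<forall>t\<in>{0..T}. \<forall>y. \<forall>v\<in>U. norm (val (b \<gamma> t) (y, v)) \<le> K \<and> norm (val (\<sigma> \<gamma> t) (y, v)) \<le> K"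
    using coefficients_bounded by blast
  obtain L where L: "\<forall>\<gamma>. \<forall>t\<in>{0..T}. \<forall>y y'. \<forall>v\<in>U.
     norm (val (b \<gamma> t) (y, v) - val (b \<gamma> t) (y', v)) + norm (val (\<sigma> \<gamma> t) (y, v) - val (\<sigma> \<gamma> t) (y', v))
       \<le> L * norm (y - y')"
    using coefficients_lipschitz by blast
  define r where "r n t \<omega> = norm (val (b (\<gamma> n) t) (X \<gamma>0 t \<omega>, u t \<omega>) - val (b \<gamma>0 t) (X \<gamma>0 t \<omega>, u t \<omega>))
      + norm (val (\<sigma> (\<gamma> n) t) (X \<gamma>0 t \<omega>, u t \<omega>) - val (\<sigma> \<gamma>0 t) (X \<gamma>0 t \<omega>, u t \<omega>))" for n t \<omega>
  note [measurable] = coefficients_measurable(1-2)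
  have r_meas: "(\<lambda>p. r n (fst p) (snd p)) \<in> borel_measurable (time_interval T \<Otimes>\<^sub>M M)" for n
    unfolding r_def by measurable
  then have [measurable]: "(\<lambda>p. r n (fst p) (snd p)) \<in> borel_measurable (time_prob M T)" for n
    by (simp add: borel_measurable_time_prob)
  define R where "R n = (\<integral>\<^sup>+p. ennreal ((r n (fst p) (snd p))\<^sup>2) \<partial>time_prob M T)" for n
  have "R \<longlonglongrightarrow> (\<integral>\<^sup>+p. 0 \<partial>time_prob M T)"
    unfolding R_def
  proof (rule nn_integral_dominated_convergence)
    show "AE p in time_prob M T. ennreal ((r n (fst p) (snd p))\<^sup>2) \<le> ennreal ((4 * K)\<^sup>2)" for n
    proof (intro AE_I2 ennreal_leI power_mono)
      fix p assume "p \<in> space (time_prob M T)"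
      then have p: "fst p \<in> {0..T}" "u (fst p) (snd p) \<in> U"
        using u_in_U by (auto simp: space_pair_measure space_restrict_space)
      have *: "norm (val (b \<gamma> (fst p)) (y, u (fst p) (snd p))) \<le> K \<and> norm (val (\<sigma> \<gamma> (fst p)) (y, u (fst p) (snd p))) \<le> K" for \<gamma> y
        using K p by blast
      have "norm (p - q) + norm (p' - q') \<le> 4 * K"
        if "norm p \<le> K" "norm q \<le> K" "norm p' \<le> K" "norm q' \<le> K" for p q p' q' :: "real^'n"
        using that norm_triangle_ineq4[of p q] norm_triangle_ineq4[of p' q'] by linarith
      then show "r n (fst p) (snd p) \<le> 4 * K" unfolding r_def using * by blast
      show "0 \<le> r n (fst p) (snd p)" by (simp add: r_def)
    qed
    show "(\<integral>\<^sup>+p. ennreal ((4 * K)\<^sup>2) \<partial>time_prob M T) < \<infinity>"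
      using T_pos by (simp add: emeasure_time_prob ennreal_mult_less_top)
    show "AE p in time_prob M T. (\<lambda>n. ennreal ((r n (fst p) (snd p))\<^sup>2)) \<longlonglongrightarrow> 0"
    proof (rule AE_I2)
      fix p assume "p \<in> space (time_prob M T)"
      then have p: "fst p \<in> {0..T}" "u (fst p) (snd p) \<in> U"
        using u_in_U by (auto simp: space_pair_measure space_restrict_space)
      have "(\<lambda>n. r n (fst p) (snd p)) \<longlonglongrightarrow> 0 + 0"
        unfolding r_def
        by (intro tendsto_add tendsto_norm_zero LIM_zero coefficients_tendsto[OF \<gamma> p])
      then have "(\<lambda>n. (r n (fst p) (snd p))\<^sup>2) \<longlonglongrightarrow> (0 + 0)\<^sup>2" by (intro tendsto_power)
      then show "(\<lambda>n. ennreal ((r n (fst p) (snd p))\<^sup>2)) \<longlonglongrightarrow> 0"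
        by (subst ennreal_tendsto_0_iff) auto
    qed
  qed measurable
  then have R0: "R \<longlonglongrightarrow> 0" by simp
  define \<eta> where "\<eta> n = 2 * (ennreal (6 * (T + 9)) * R n) * ennreal (exp (2 * (6 * (T + 9) * (L\<^sup>2 + 1)) * T))" for n
  have "\<eta> = (\<lambda>n. (2 * ennreal (6 * (T + 9)) * ennreal (exp (2 * (6 * (T + 9) * (L\<^sup>2 + 1)) * T))) * R n)"
    by (simp add: \<eta>_def[abs_def] mult_ac del: ennreal_plus)
  moreover have "(\<lambda>n. (2 * ennreal (6 * (T + 9)) * ennreal (exp (2 * (6 * (T + 9) * (L\<^sup>2 + 1)) * T))) * R n)
      \<longlonglongrightarrow> (2 * ennreal (6 * (T + 9)) * ennreal (exp (2 * (6 * (T + 9) * (L\<^sup>2 + 1)) * T))) * 0"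
    by (intro ennreal_tendsto_cmult R0) (simp add: ennreal_mult_less_top)
  ultimately have "\<eta> \<longlonglongrightarrow> 0" by simp
  moreover have "(\<integral>\<^sup>+\<omega>. ennreal ((norm (X (\<gamma> n) t \<omega> - X \<gamma>0 t \<omega>))\<^sup>2) \<partial>M) \<le> \<eta> n" if t: "t \<in> {0..T}" for n t
    unfolding \<eta>_def R_def
  proof (rule ito_dynamics_stability[OF X_dynamics X_adapted X_dynamics X_adapted X_init X_init
        coefficients_measurable(1,1) coefficients_measurable(2,2) r_meas _ _ _ t])
    fix s \<omega> assume s: "s \<in> {0..T}" and w: "\<omega> \<in> space M"
    have us: "u s \<omega> \<in> U" using u_in_U s w by blast
    show "norm (val (b (\<gamma> n) s) (X (\<gamma> n) s \<omega>, u s \<omega>)) \<le> K \<and> norm (val (\<sigma> (\<gamma> n) s) (X (\<gamma> n) s \<omega>, u s \<omega>)) \<le> K"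
      "norm (val (b \<gamma>0 s) (X \<gamma>0 s \<omega>, u s \<omega>)) \<le> K \<and> norm (val (\<sigma> \<gamma>0 s) (X \<gamma>0 s \<omega>, u s \<omega>)) \<le> K"
      using K s us by blast+
    have "norm (val (b (\<gamma> n) s) (X (\<gamma> n) s \<omega>, u s \<omega>) - val (b (\<gamma> n) s) (X \<gamma>0 s \<omega>, u s \<omega>))
        + norm (val (\<sigma> (\<gamma> n) s) (X (\<gamma> n) s \<omega>, u s \<omega>) - val (\<sigma> (\<gamma> n) s) (X \<gamma>0 s \<omega>, u s \<omega>))
       \<le> L * norm (X (\<gamma> n) s \<omega> - X \<gamma>0 s \<omega>)" using L s us by blast
    moreover have "norm (p - q) + norm (p' - q') \<le> (norm (p - o1) + norm (p' - o2)) + (norm (o1 - q) + norm (o2 - q'))"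
      for p q o1 p' q' o2 :: "real^'n"
      using norm_triangle_ineq[of "p - o1" "o1 - q"] norm_triangle_ineq[of "p' - o2" "o2 - q'"] by simp
    ultimately show "norm (val (b (\<gamma> n) s) (X (\<gamma> n) s \<omega>, u s \<omega>) - val (b \<gamma>0 s) (X \<gamma>0 s \<omega>, u s \<omega>))
        + norm (val (\<sigma> (\<gamma> n) s) (X (\<gamma> n) s \<omega>, u s \<omega>) - val (\<sigma> \<gamma>0 s) (X \<gamma>0 s \<omega>, u s \<omega>))
       \<le> L * norm (X (\<gamma> n) s \<omega> - X \<gamma>0 s \<omega>) + r n s \<omega>"
      unfolding r_def by (meson add_right_mono order_trans)
  qed
  ultimately show ?thesis by blast
qed

end

section \<open>Continuity of the expected cost and worst-case measures\<close>

lemma (in prob_space) nn_integral_time_prob_le: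
  assumes f: "f \<in> borel_measurable (time_interval t \<Otimes>\<^sub>M M)" and t: "0 \<le> t"
    and c: "\<And>s. s \<in> {0..t} \<Longrightarrow> (\<integral>\<^sup>+\<omega>. f (s, \<omega>) \<partial>M) \<le> c"
  shows "(\<integral>\<^sup>+p. f p \<partial>time_prob M t) \<le> c * ennreal t"
proof -
  have "(\<integral>\<^sup>+p. f p \<partial>time_prob M t) = (\<integral>\<^sup>+s\<in>{0..t}. (\<integral>\<^sup>+\<omega>. f (s, \<omega>) \<partial>M) \<partial>lborel)"
    by (rule nn_integral_time_prob(2)[OF f, symmetric])
  also have "\<dots> \<le> (\<integral>\<^sup>+s. c * indicator {0..t} s \<partial>lborel)"
    using c by (intro nn_integral_mono) (auto simp: indicator_def)
  also have "\<dots> = c * ennreal t" using t by (simp add: nn_integral_cmult_indicator)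
  finally show ?thesis .
qed

lemma (in prob_space) integral_time_prob:
  fixes g :: "real \<times> 'a \<Rightarrow> real"
  assumes g: "integrable (time_prob M t) g"
  shows "(\<integral>\<omega>. (LINT s:{0..t}|lborel. g (s, \<omega>)) \<partial>M) = (\<integral>p. g p \<partial>time_prob M t)"
    and "integrable M (\<lambda>\<omega>. LINT s:{0..t}|lborel. g (s, \<omega>))"
    and "AE \<omega> in M. set_integrable lborel {0..t} (\<lambda>s. g (s, \<omega>))"
proof -
  interpret P: pair_sigma_finite "restrict_space lborel {0..t}" M by (rule pair_sigma_finite_time_prob)
  have g': "integrable (time_prob M t) (case_prod (\<lambda>s \<omega>. g (s, \<omega>)))" using g by simp
  have *: "(\<integral>s. g (s, \<omega>) \<partial>restrict_space lborel {0..t}) = (LINT s:{0..t}|lborel. g (s, \<omega>))" for \<omega>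
    by (simp add: integral_restrict_space set_lebesgue_integral_def)
  show "(\<integral>\<omega>. (LINT s:{0..t}|lborel. g (s, \<omega>)) \<partial>M) = (\<integral>p. g p \<partial>time_prob M t)"
    using P.integral_snd[OF g'] by (simp add: *)
  show "integrable M (\<lambda>\<omega>. LINT s:{0..t}|lborel. g (s, \<omega>))"
    using P.integrable_snd[OF g'] by (simp add: *)
  show "AE \<omega> in M. set_integrable lborel {0..t} (\<lambda>s. g (s, \<omega>))"
    using P.AE_integrable_snd[OF g']
    by (simp add: integrable_restrict_space set_integrable_def)
qed

text \<open>For equal exponents the nested integrability conditions reduce to one on the product of time and
  probability space.\<close>

lemma (in prob_space) LF_space_diagonal_iff:
  assumes p: "p \<noteq> 0"
  shows "u \<in> LF_space M F t p p \<longleftrightarrow> adapted_measurable M F t u \<and>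
    (\<integral>\<^sup>+q. ennreal (norm (u (fst q) (snd q)) powr p) \<partial>time_prob M t) < \<infinity>" (is "?L \<longleftrightarrow> ?R")
proof -
  let ?g = "\<lambda>q. norm (u (fst q) (snd q)) powr p"
  have meas: "?g \<in> borel_measurable (time_interval t \<Otimes>\<^sub>M M)" if "adapted_measurable M F t u"
  proof -
    have [measurable]: "(\<lambda>q. u (fst q) (snd q)) \<in> borel_measurable (time_interval t \<Otimes>\<^sub>M M)"
      using that by (simp add: adapted_measurable_def case_prod_beta')
    show ?thesis by measurable
  qed
  show ?thesis
  proof
    assume L: ?L
    then have ad: "adapted_measurable M F t u" by (simp add: LF_space_def)
    have "(\<integral>\<^sup>+q. ennreal (?g q) \<partial>time_prob M t) =
        (\<integral>\<^sup>+\<omega>. (\<integral>\<^sup>+s\<in>{0..t}. ennreal (norm (u s \<omega>) powr p) \<partial>lborel) \<partial>M)"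
      using nn_integral_time_prob(1)[of "\<lambda>q. ennreal (?g q)" t] meas[OF ad] by simp
    also have "\<dots> = (\<integral>\<^sup>+\<omega>. ennreal ((LINT s:{0..t}|lborel. norm (u s \<omega>) powr p) powr (p / p)) \<partial>M)"
    proof (rule nn_integral_cong_AE)
      have "AE \<omega> in M. set_integrable lborel {0..t} (\<lambda>s. norm (u s \<omega>) powr p)"
        using L by (simp add: LF_space_def)
      then show "AE \<omega> in M. (\<integral>\<^sup>+s\<in>{0..t}. ennreal (norm (u s \<omega>) powr p) \<partial>lborel) =
          ennreal ((LINT s:{0..t}|lborel. norm (u s \<omega>) powr p) powr (p / p))"
      proof eventually_elim
        fix \<omega> assume i: "set_integrable lborel {0..t} (\<lambda>s. norm (u s \<omega>) powr p)"
        have "(\<integral>\<^sup>+s\<in>{0..t}. ennreal (norm (u s \<omega>) powr p) \<partial>lborel) =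
            (\<integral>\<^sup>+s. ennreal (indicator {0..t} s *\<^sub>R (norm (u s \<omega>) powr p)) \<partial>lborel)"
          by (intro nn_integral_cong) (simp add: indicator_def)
        also have "\<dots> = ennreal (LINT s:{0..t}|lborel. norm (u s \<omega>) powr p)"
          unfolding set_lebesgue_integral_def
          by (rule nn_integral_eq_integral) (use i in \<open>auto simp: set_integrable_def\<close>)
        moreover have "(LINT s:{0..t}|lborel. norm (u s \<omega>) powr p) \<ge> 0"
          unfolding set_lebesgue_integral_def by (rule integral_nonneg_AE) auto
        ultimately show "(\<integral>\<^sup>+s\<in>{0..t}. ennreal (norm (u s \<omega>) powr p) \<partial>lborel) =
          ennreal ((LINT s:{0..t}|lborel. norm (u s \<omega>) powr p) powr (p / p))"
          using p by simp
      qed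
    qed
    also have "\<dots> < \<infinity>"
    proof -
      have "integrable M (\<lambda>\<omega>. (LINT s:{0..t}|lborel. norm (u s \<omega>) powr p) powr (p / p))"
        using L unfolding LF_space_def by blast
      then have "(\<integral>\<^sup>+\<omega>. ennreal (norm ((LINT s:{0..t}|lborel. norm (u s \<omega>) powr p) powr (p / p))) \<partial>M) < \<infinity>"
        unfolding integrable_iff_bounded by blast
      then show ?thesis by (simp only: real_norm_def abs_of_nonneg[OF powr_ge_zero])
    qed
    finally show ?R using ad by simp
  next
    assume R: ?R
    then have "integrable (time_prob M t) ?g"
      using meas by (simp add: integrable_iff_bounded borel_measurable_time_prob)
    from integral_time_prob(2,3)[OF this] R
    have "integrable M (\<lambda>\<omega>. (LINT s:{0..t}|lborel. norm (u s \<omega>) powr p))"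
      "AE \<omega> in M. set_integrable lborel {0..t} (\<lambda>s. norm (u s \<omega>) powr p)" "adapted_measurable M F t u" by auto
    moreover have "(LINT s:{0..t}|lborel. norm (u s \<omega>) powr p) \<ge> 0" for \<omega>
      unfolding set_lebesgue_integral_def by (rule integral_nonneg_AE) auto
    ultimately show ?L using p by (simp add: LF_space_def)
  qed
qed

text \<open>The time interval has finite length, and $y^p \le 1 + y^q$ for $y \ge 0$.\<close>

lemma (in prob_space) LF_space_antimono:
  assumes pq: "0 < p" "p \<le> q" and t: "0 \<le> t" and u: "u \<in> LF_space M F t q q"
  shows "u \<in> LF_space M F t p p"
proof -
  have ad: "adapted_measurable M F t u" using u by (simp add: LF_space_def)
  have [measurable]: "(\<lambda>r. u (fst r) (snd r)) \<in> borel_measurable (time_prob M t)"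
    using ad by (simp add: adapted_measurable_def case_prod_beta' borel_measurable_time_prob)
  have le: "y powr p \<le> 1 + y powr q" if "y \<ge> 0" for y :: real
  proof (cases "y \<le> 1")
    case True
    then have "y powr p \<le> 1" using that pq by (intro powr_le1) auto
    then show ?thesis using powr_ge_zero[of y q] by linarith
  next
    case False
    then have "y powr p \<le> y powr q" using pq by (intro powr_mono) auto
    then show ?thesis by simp
  qed
  have "(\<integral>\<^sup>+r. ennreal (norm (u (fst r) (snd r)) powr p) \<partial>time_prob M t)
      \<le> (\<integral>\<^sup>+r. 1 + ennreal (norm (u (fst r) (snd r)) powr q) \<partial>time_prob M t)"
    using le[OF norm_ge_zero]
    by (intro nn_integral_mono) (simp add: ennreal_leI ennreal_plus[symmetric] flip: ennreal_1 del: ennreal_plus)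
  also have "\<dots> = emeasure (time_prob M t) (space (time_prob M t))
      + (\<integral>\<^sup>+r. ennreal (norm (u (fst r) (snd r)) powr q) \<partial>time_prob M t)"
    by (simp add: nn_integral_add)
  also have "\<dots> < \<infinity>"
    using u pq t by (simp add: LF_space_diagonal_iff emeasure_time_prob)
  finally show ?thesis using ad pq by (simp add: LF_space_diagonal_iff)
qed

lemma quadratic_growth_integral_bound:
  fixes Y :: "'p \<Rightarrow> 'x::euclidean_space" and v g :: "'p \<Rightarrow> real"
  assumes N: "finite_measure N"
    and meas: "Y \<in> borel_measurable N" "v \<in> borel_measurable N" "g \<in> borel_measurable N"
    and L: "L \<ge> 0" and Y: "(\<integral>\<^sup>+p. ennreal ((norm (Y p))\<^sup>2) \<partial>N) \<le> ennreal C"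
    and v: "(\<integral>\<^sup>+p. ennreal ((v p)\<^sup>2) \<partial>N) < \<infinity>"
    and g: "\<And>p. p \<in> space N \<Longrightarrow> \<bar>g p\<bar> \<le> L * (1 + (norm (Y p))\<^sup>2 + (v p)\<^sup>2)"
  shows "integrable N g \<and> \<bar>\<integral>p. g p \<partial>N\<bar> \<le> L * (measure N (space N) + max 0 C + (\<integral>p. (v p)\<^sup>2 \<partial>N))"
proof -
  interpret N: finite_measure N by fact
  note [measurable] = meas
  have Y_fin: "(\<integral>\<^sup>+p. ennreal ((norm (Y p))\<^sup>2) \<partial>N) < \<infinity>" using Y by (rule le_less_trans) simp
  note int = quadratic_growth_integrable[OF N meas Y_fin v g]
  have iY: "integrable N (\<lambda>p. (norm (Y p))\<^sup>2)" and iv: "integrable N (\<lambda>p. (v p)\<^sup>2)"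
    using Y_fin v by (auto simp: integrable_iff_bounded)
  have "ennreal (\<integral>p. (norm (Y p))\<^sup>2 \<partial>N) \<le> ennreal C"
    using Y nn_integral_eq_integral[OF iY] by simp
  also have "\<dots> \<le> ennreal (max 0 C)" by (rule ennreal_leI) simp
  finally have Y_le: "(\<integral>p. (norm (Y p))\<^sup>2 \<partial>N) \<le> max 0 C" by (subst (asm) ennreal_le_iff) auto
  have "\<bar>\<integral>p. g p \<partial>N\<bar> \<le> (\<integral>p. \<bar>g p\<bar> \<partial>N)" by (rule integral_abs_bound)
  also have "\<dots> \<le> (\<integral>p. L * (1 + (norm (Y p))\<^sup>2 + (v p)\<^sup>2) \<partial>N)"
    using int g by (intro integral_mono) auto
  also have "\<dots> = L * (measure N (space N) + (\<integral>p. (norm (Y p))\<^sup>2 \<partial>N) + (\<integral>p. (v p)\<^sup>2 \<partial>N))"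
    using iY iv by simp
  also have "\<dots> \<le> L * (measure N (space N) + max 0 C + (\<integral>p. (v p)\<^sup>2 \<partial>N))"
    using Y_le L by (intro mult_left_mono) auto
  finally show ?thesis using int(1) by blast
qed

context robust_state
begin

lemma finite_measure_time_prob: "finite_measure (time_prob M T)"
  using T_pos by (intro finite_measureI) (simp add: emeasure_time_prob)

lemma state_square_integrable:
  "\<exists>C. \<forall>\<gamma>. (\<integral>\<^sup>+p. ennreal ((norm (X \<gamma> (fst p) (snd p)))\<^sup>2) \<partial>time_prob M T) \<le> ennreal C
     \<and> (\<integral>\<^sup>+\<omega>. ennreal ((norm (X \<gamma> T \<omega>))\<^sup>2) \<partial>M) \<le> ennreal C"
proof -
  obtain C where C: "\<forall>\<gamma>. \<forall>t\<in>{0..T}. (\<integral>\<^sup>+\<omega>. ennreal ((norm (X \<gamma> t \<omega>))\<^sup>2) \<partial>M) \<le> ennreal C"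
    using state_moment_bound by blast
  note [measurable] = X_measurable
  have "(\<integral>\<^sup>+p. ennreal ((norm (X \<gamma> (fst p) (snd p)))\<^sup>2) \<partial>time_prob M T) \<le> ennreal C * ennreal T" for \<gamma>
    by (rule nn_integral_time_prob_le, measurable) (use T_pos C in simp_all)
  moreover have "ennreal C * ennreal T \<le> ennreal (\<bar>C\<bar> * T + \<bar>C\<bar>)"
    using T_pos by (subst ennreal_mult''[symmetric]) (auto intro!: ennreal_leI mult_right_mono add_increasing2)
  moreover have "(\<integral>\<^sup>+\<omega>. ennreal ((norm (X \<gamma> T \<omega>))\<^sup>2) \<partial>M) \<le> ennreal C" for \<gamma>
    using C T_pos by auto
  moreover have "ennreal C \<le> ennreal (\<bar>C\<bar> * T + \<bar>C\<bar>)"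
    using T_pos by (intro ennreal_leI) (auto intro: add_increasing)
  ultimately show ?thesis by (intro exI[of _ "\<bar>C\<bar> * T + \<bar>C\<bar>"]) (blast intro: order_trans)
qed

lemma state_square_finite:
  "(\<integral>\<^sup>+p. ennreal ((norm (X \<gamma> (fst p) (snd p)))\<^sup>2) \<partial>time_prob M T) < \<infinity>"
  "(\<integral>\<^sup>+\<omega>. ennreal ((norm (X \<gamma> T \<omega>))\<^sup>2) \<partial>M) < \<infinity>"
proof -
  obtain C where C: "(\<integral>\<^sup>+p. ennreal ((norm (X \<gamma> (fst p) (snd p)))\<^sup>2) \<partial>time_prob M T) \<le> ennreal C"
     "(\<integral>\<^sup>+\<omega>. ennreal ((norm (X \<gamma> T \<omega>))\<^sup>2) \<partial>M) \<le> ennreal C"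
    using state_square_integrable by blast
  show "(\<integral>\<^sup>+p. ennreal ((norm (X \<gamma> (fst p) (snd p)))\<^sup>2) \<partial>time_prob M T) < \<infinity>"
    by (rule le_less_trans[OF C(1)]) simp
  show "(\<integral>\<^sup>+\<omega>. ennreal ((norm (X \<gamma> T \<omega>))\<^sup>2) \<partial>M) < \<infinity>"
    by (rule le_less_trans[OF C(2)]) simp
qed

abbreviation running_cost :: "'g \<Rightarrow> real \<times> 'w \<Rightarrow> real" where
  "running_cost \<gamma> p \<equiv> val (f \<gamma> (fst p)) (X \<gamma> (fst p) (snd p), u (fst p) (snd p))"

lemma costs_measurable:
  "(\<lambda>p. val (f \<gamma> (fst p)) (X \<gamma>' (fst p) (snd p), u (fst p) (snd p))) \<in> borel_measurable (time_prob M T)"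
  "(\<lambda>\<omega>. val (h \<gamma>) (X \<gamma>' T \<omega>)) \<in> borel_measurable M"
  "(\<lambda>p. X \<gamma> (fst p) (snd p)) \<in> borel_measurable (time_prob M T)"
  "X \<gamma> T \<in> borel_measurable M"
  "(\<lambda>p. norm (u (fst p) (snd p))) \<in> borel_measurable (time_prob M T)"
  using coefficients_measurable(3,4) X_measurable X_measurable_at[of T] T_pos u_measurable
  by (auto simp: borel_measurable_time_prob intro: measurable_compose)

lemma u_in_U_prod: "p \<in> space (time_prob M T) \<Longrightarrow> fst p \<in> {0..T} \<and> u (fst p) (snd p) \<in> U"
  using u_in_U by (auto simp: space_pair_measure space_restrict_space)

lemma costs_integrable:
  "\<exists>L. \<forall>\<gamma>. integrable (time_prob M T) (running_cost \<gamma>) \<and> integrable M (\<lambda>\<omega>. val (h \<gamma>) (X \<gamma> T \<omega>)) \<and>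
     \<bar>\<integral>p. running_cost \<gamma> p \<partial>time_prob M T\<bar> \<le> L \<and> \<bar>\<integral>\<omega>. val (h \<gamma>) (X \<gamma> T \<omega>) \<partial>M\<bar> \<le> L"
proof -
  obtain L where L0: "L \<ge> 0" and L: "\<forall>\<gamma>. \<forall>t\<in>{0..T}. \<forall>y y'. \<forall>v\<in>U.
     \<bar>val (f \<gamma> t) (y, v)\<bar> \<le> L * (1 + (norm y)\<^sup>2 + (norm v)\<^sup>2) \<and>
     \<bar>val (h \<gamma>) y\<bar> \<le> L * (1 + (norm y)\<^sup>2) \<and>
     \<bar>val (f \<gamma> t) (y, v) - val (f \<gamma> t) (y', v)\<bar> \<le> L * (1 + norm y + norm y' + norm v) * norm (y - y') \<and>
     \<bar>val (h \<gamma>) y - val (h \<gamma>) y'\<bar> \<le> L * (1 + norm y + norm y') * norm (y - y')"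
    using costs_growth by blast
  obtain C where C: "\<forall>\<gamma>. (\<integral>\<^sup>+p. ennreal ((norm (X \<gamma> (fst p) (snd p)))\<^sup>2) \<partial>time_prob M T) \<le> ennreal C
     \<and> (\<integral>\<^sup>+\<omega>. ennreal ((norm (X \<gamma> T \<omega>))\<^sup>2) \<partial>M) \<le> ennreal C"
    using state_square_integrable by blast
  let ?L1 = "L * (measure (time_prob M T) (space (time_prob M T)) + max 0 C + (\<integral>p. (norm (u (fst p) (snd p)))\<^sup>2 \<partial>time_prob M T))"
  let ?L2 = "L * (measure M (space M) + max 0 C + (\<integral>\<omega>. 0\<^sup>2 \<partial>M))"
  have 1: "integrable (time_prob M T) (running_cost \<gamma>) \<and> \<bar>\<integral>p. running_cost \<gamma> p \<partial>time_prob M T\<bar> \<le> ?L1" for \<gamma>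
  proof (rule quadratic_growth_integral_bound[OF finite_measure_time_prob costs_measurable(3)[of \<gamma>] costs_measurable(5) costs_measurable(1) L0])
    show "(\<integral>\<^sup>+p. ennreal ((norm (X \<gamma> (fst p) (snd p)))\<^sup>2) \<partial>time_prob M T) \<le> ennreal C" using C by blast
    show "\<bar>running_cost \<gamma> p\<bar> \<le> L * (1 + (norm (X \<gamma> (fst p) (snd p)))\<^sup>2 + (norm (u (fst p) (snd p)))\<^sup>2)"
      if "p \<in> space (time_prob M T)" for p
      using L u_in_U_prod[OF that] by blast
  qed (rule u_square)
  have 2: "integrable M (\<lambda>\<omega>. val (h \<gamma>) (X \<gamma> T \<omega>)) \<and> \<bar>\<integral>\<omega>. val (h \<gamma>) (X \<gamma> T \<omega>) \<partial>M\<bar> \<le> ?L2" for \<gamma>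
  proof (rule quadratic_growth_integral_bound[OF finite_measure_axioms costs_measurable(4)[of \<gamma>] _ costs_measurable(2) L0])
    show "(\<integral>\<^sup>+\<omega>. ennreal ((norm (X \<gamma> T \<omega>))\<^sup>2) \<partial>M) \<le> ennreal C" using C by blast
    show "\<bar>val (h \<gamma>) (X \<gamma> T \<omega>)\<bar> \<le> L * (1 + (norm (X \<gamma> T \<omega>))\<^sup>2 + 0\<^sup>2)" if "\<omega> \<in> space M" for \<omega>
      using L T_pos u_in_U[OF _ that, of T] by force
  qed auto
  show ?thesis
    using 1 2 by (intro exI[of _ "max ?L1 ?L2"]) (auto simp: le_max_iff_disj)
qed

lemma expected_cost_split:
  "expected_cost M T f h x u \<gamma> = (\<integral>p. running_cost \<gamma> p \<partial>time_prob M T) + (\<integral>\<omega>. val (h \<gamma>) (X \<gamma> T \<omega>) \<partial>M)"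
proof -
  have i: "integrable (time_prob M T) (running_cost \<gamma>)" "integrable M (\<lambda>\<omega>. val (h \<gamma>) (X \<gamma> T \<omega>))"
    using costs_integrable by blast+
  show ?thesis
    unfolding expected_cost_def
    using integral_time_prob(1,2)[OF i(1)] i(2) by simp
qed

lemma expected_cost_bounded: "bounded (range (expected_cost M T f h x u))"
proof -
  obtain L where "\<forall>\<gamma>. \<bar>\<integral>p. running_cost \<gamma> p \<partial>time_prob M T\<bar> \<le> L \<and> \<bar>\<integral>\<omega>. val (h \<gamma>) (X \<gamma> T \<omega>) \<partial>M\<bar> \<le> L"
    using costs_integrable by blast
  then have "norm (expected_cost M T f h x u \<gamma>) \<le> L + L" for \<gamma>
    unfolding expected_cost_split real_norm_def by (meson abs_triangle_ineq add_mono order_trans)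
  then show ?thesis unfolding bounded_iff by blast
qed

text \<open>The running cost is handled on the product of time and probability space, where the mean square
  distance of the states is at most \<open>T\<close> times its supremum over time; the terminal cost uses the
  distance at time \<open>T\<close> alone.\<close>

lemma expected_cost_continuous: "continuous_on UNIV (expected_cost M T f h x u)"
  unfolding continuous_on_sequentially
proof (intro ballI allI impI, elim conjE)
  fix \<gamma>0 :: 'g and \<gamma> :: "nat \<Rightarrow> 'g" assume \<gamma>: "\<gamma> \<longlonglongrightarrow> \<gamma>0"
  obtain L where L0: "L \<ge> 0" and L: "\<forall>\<gamma>. \<forall>t\<in>{0..T}. \<forall>y y'. \<forall>v\<in>U.
     \<bar>val (f \<gamma> t) (y, v)\<bar> \<le> L * (1 + (norm y)\<^sup>2 + (norm v)\<^sup>2) \<and>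
     \<bar>val (h \<gamma>) y\<bar> \<le> L * (1 + (norm y)\<^sup>2) \<and>
     \<bar>val (f \<gamma> t) (y, v) - val (f \<gamma> t) (y', v)\<bar> \<le> L * (1 + norm y + norm y' + norm v) * norm (y - y') \<and>
     \<bar>val (h \<gamma>) y - val (h \<gamma>) y'\<bar> \<le> L * (1 + norm y + norm y') * norm (y - y')"
    using costs_growth by blast
  obtain \<eta> where \<eta>0: "\<eta> \<longlonglongrightarrow> 0" and
    \<eta>: "\<And>n t. t \<in> {0..T} \<Longrightarrow> (\<integral>\<^sup>+\<omega>. ennreal ((norm (X (\<gamma> n) t \<omega> - X \<gamma>0 t \<omega>))\<^sup>2) \<partial>M) \<le> \<eta> n"
    using state_continuous[OF \<gamma>] by blast
  have conv_T: "(\<lambda>n. \<integral>\<^sup>+\<omega>. ennreal ((norm (X (\<gamma> n) T \<omega> - X \<gamma>0 T \<omega>))\<^sup>2) \<partial>M) \<longlonglongrightarrow> 0"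
    by (rule tendsto_sandwich[OF _ _ tendsto_const \<eta>0]) (use \<eta>[of T] T_pos in auto)
  have "(\<lambda>n. \<eta> n * ennreal T) \<longlonglongrightarrow> 0 * ennreal T"
    using ennreal_tendsto_cmult[OF _ \<eta>0, of "ennreal T"] by (simp add: mult.commute)
  then have \<eta>T: "(\<lambda>n. \<eta> n * ennreal T) \<longlonglongrightarrow> 0" by simp
  note [measurable] = X_measurable
  have "(\<integral>\<^sup>+p. ennreal ((norm (X (\<gamma> n) (fst p) (snd p) - X \<gamma>0 (fst p) (snd p)))\<^sup>2) \<partial>time_prob M T) \<le> \<eta> n * ennreal T" for n
    by (rule nn_integral_time_prob_le, measurable) (use T_pos \<eta> in simp_all)
  then have conv: "(\<lambda>n. \<integral>\<^sup>+p. ennreal ((norm (X (\<gamma> n) (fst p) (snd p) - X \<gamma>0 (fst p) (snd p)))\<^sup>2) \<partial>time_prob M T) \<longlonglongrightarrow> 0"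
    by (intro tendsto_sandwich[OF _ _ tendsto_const \<eta>T]) simp_all
  have running: "(\<lambda>n. \<integral>p. running_cost (\<gamma> n) p \<partial>time_prob M T) \<longlonglongrightarrow> (\<integral>p. running_cost \<gamma>0 p \<partial>time_prob M T)"
  proof (rule quadratic_growth_integral_tendsto[where X="\<lambda>n p. X (\<gamma> n) (fst p) (snd p)" and ?X0.0="\<lambda>p. X \<gamma>0 (fst p) (snd p)"
        and v="\<lambda>p. norm (u (fst p) (snd p))" and \<Phi>="\<lambda>n p y. val (f (\<gamma> n) (fst p)) (y, u (fst p) (snd p))"
        and ?\<Phi>0.0="\<lambda>p y. val (f \<gamma>0 (fst p)) (y, u (fst p) (snd p))" and L=L])
    fix p assume "p \<in> space (time_prob M T)"
    note p = u_in_U_prod[OF this]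
    show "\<bar>val (f (\<gamma> n) (fst p)) (y, u (fst p) (snd p)) - val (f (\<gamma> n) (fst p)) (y', u (fst p) (snd p))\<bar> \<le>
        L * (1 + norm y + norm y' + \<bar>norm (u (fst p) (snd p))\<bar>) * norm (y - y')" for n y y'
      using L p by simp
    show "\<bar>val (f (\<gamma> n) (fst p)) (y, u (fst p) (snd p))\<bar> \<le> L * (1 + (norm y)\<^sup>2 + (norm (u (fst p) (snd p)))\<^sup>2)"
      "\<bar>val (f \<gamma>0 (fst p)) (y, u (fst p) (snd p))\<bar> \<le> L * (1 + (norm y)\<^sup>2 + (norm (u (fst p) (snd p)))\<^sup>2)" for n y
      using L p by simp_all
    show "(\<lambda>n. val (f (\<gamma> n) (fst p)) (X \<gamma>0 (fst p) (snd p), u (fst p) (snd p)))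
        \<longlonglongrightarrow> val (f \<gamma>0 (fst p)) (X \<gamma>0 (fst p) (snd p), u (fst p) (snd p))"
      using p by (intro coefficients_tendsto[OF \<gamma>]) auto
  qed (intro finite_measure_time_prob costs_measurable L0 state_square_finite u_square conv)+
  have terminal: "(\<lambda>n. \<integral>\<omega>. val (h (\<gamma> n)) (X (\<gamma> n) T \<omega>) \<partial>M) \<longlonglongrightarrow> (\<integral>\<omega>. val (h \<gamma>0) (X \<gamma>0 T \<omega>) \<partial>M)"
  proof (rule quadratic_growth_integral_tendsto[where X="\<lambda>n. X (\<gamma> n) T" and ?X0.0="X \<gamma>0 T"
        and v="\<lambda>_. 0" and \<Phi>="\<lambda>n _. val (h (\<gamma> n))" and ?\<Phi>0.0="\<lambda>_. val (h \<gamma>0)" and L=L])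
    fix \<omega> assume w: "\<omega> \<in> space M"
    have T: "T \<in> {0..T}" "u T \<omega> \<in> U" using T_pos u_in_U[OF _ w, of T] by auto
    have Lh: "\<bar>val (h \<gamma>') y\<bar> \<le> L * (1 + (norm y)\<^sup>2) \<and>
        \<bar>val (h \<gamma>') y - val (h \<gamma>') y'\<bar> \<le> L * (1 + norm y + norm y') * norm (y - y')" for \<gamma>' y y'
      using L T by blast
    show "\<bar>val (h (\<gamma> n)) y - val (h (\<gamma> n)) y'\<bar> \<le> L * (1 + norm y + norm y' + \<bar>0\<bar>) * norm (y - y')" for n y y'
      using Lh by simp
    show "\<bar>val (h (\<gamma> n)) y\<bar> \<le> L * (1 + (norm y)\<^sup>2 + 0\<^sup>2)"
      "\<bar>val (h \<gamma>0) y\<bar> \<le> L * (1 + (norm y)\<^sup>2 + 0\<^sup>2)" for n y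
      using Lh by simp_all
    show "(\<lambda>n. val (h (\<gamma> n)) (X \<gamma>0 T \<omega>)) \<longlonglongrightarrow> val (h \<gamma>0) (X \<gamma>0 T \<omega>)"
      by (rule coefficients_tendsto(4)[OF \<gamma> T])
  qed (auto intro: finite_measure_axioms costs_measurable L0 conv_T simp: state_square_finite[unfolded infinity_ennreal_def])
  show "(expected_cost M T f h x u \<circ> \<gamma>) \<longlonglongrightarrow> expected_cost M T f h x u \<gamma>0"
    unfolding comp_def expected_cost_split by (intro tendsto_add running terminal)
qed

end

text \<open>The weak topology is generated precisely by the sets that make such integrals continuous, so the
  integral maps the compact set to a compact set of reals.\<close>

lemma weakly_compact_integral_attains_sup:
  fixes \<phi> :: "'g::topological_space \<Rightarrow> real"
  assumes \<Lambda>: "compactin weak_topology \<Lambda>" "\<Lambda> \<noteq> {}"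
    and \<phi>: "continuous_on UNIV \<phi>" "bounded (range \<phi>)"
  shows "\<exists>\<mu>\<in>\<Lambda>. \<forall>\<nu>\<in>\<Lambda>. (\<integral>\<gamma>. \<phi> \<gamma> \<partial>\<nu>) \<le> (\<integral>\<gamma>. \<phi> \<gamma> \<partial>\<mu>)"
proof -
  let ?I = "\<lambda>\<mu>. \<integral>\<gamma>. \<phi> \<gamma> \<partial>\<mu>"
  have sub: "topspace (weak_topology :: 'g measure topology) \<subseteq> prob_measures"
    unfolding weak_topology_def topology_generated_by_topspace by auto
  have "continuous_map weak_topology euclideanreal ?I"
    unfolding continuous_map_def
  proof (intro conjI allI impI)
    fix V :: "real set" assume "openin euclideanreal V"
    then have "openin weak_topology {\<mu> \<in> prob_measures. ?I \<mu> \<in> V}"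
      unfolding weak_topology_def using \<phi> by (intro topology_generated_by_Basis) auto
    moreover from openin_subset[OF this] sub have "{\<mu> \<in> topspace weak_topology. ?I \<mu> \<in> V} = {\<mu> \<in> prob_measures. ?I \<mu> \<in> V}"
      by auto
    ultimately show "openin weak_topology {\<mu> \<in> topspace weak_topology. ?I \<mu> \<in> V}" by simp
  qed simp
  from image_compactin[OF \<Lambda>(1) this] have "compact (?I ` \<Lambda>)" by simp
  with \<Lambda>(2) obtain m where "m \<in> ?I ` \<Lambda>" "\<forall>v\<in>?I ` \<Lambda>. v \<le> m"
    using compact_attains_sup[of "?I ` \<Lambda>"] by blast
  then show ?thesis by blast
qed

lemma worst_case_measures_nonempty:
  assumes "compactin weak_topology \<Lambda>" "\<Lambda> \<noteq> {}"
    and "continuous_on UNIV (expected_cost M T f h x u)" "bounded (range (expected_cost M T f h x u))"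
  shows "worst_case_measures M T f h \<Lambda> x u \<noteq> {}"
proof -
  obtain \<mu> where \<mu>: "\<mu> \<in> \<Lambda>"
    "\<forall>\<nu>\<in>\<Lambda>. (\<integral>\<gamma>. expected_cost M T f h x u \<gamma> \<partial>\<nu>) \<le> (\<integral>\<gamma>. expected_cost M T f h x u \<gamma> \<partial>\<mu>)"
    using weakly_compact_integral_attains_sup[OF assms] by blast
  have "robust_cost M T f h \<Lambda> x u = ereal (\<integral>\<gamma>. expected_cost M T f h x u \<gamma> \<partial>\<mu>)"
    unfolding robust_cost_def using \<mu> by (intro antisym SUP_least SUP_upper) auto
  then show ?thesis using \<mu>(1) unfolding worst_case_measures_def by auto
qed

theorem corollary3p10:
  fixes M :: "'w measure" and F :: "real \<Rightarrow> 'w measure" and W :: "real \<Rightarrow> 'w \<Rightarrow> real"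
    and T \<beta> :: real
    and U :: "(real^'m) set"
    and \<Lambda> :: "'g::{metric_space, second_countable_topology} measure set"
    and x0 :: "real^'n"
    and b \<sigma> :: "'g \<Rightarrow> real \<Rightarrow> ((real^'n) \<times> (real^'m), real^'n) c2_fun"
    and f :: "'g \<Rightarrow> real \<Rightarrow> ((real^'n) \<times> (real^'m), real) c2_fun"
    and h :: "'g \<Rightarrow> (real^'n, real) c2_fun"
    and ubar :: "real \<Rightarrow> 'w \<Rightarrow> real^'m"
    and x :: "(real \<Rightarrow> 'w \<Rightarrow> real^'m) \<Rightarrow> 'g \<Rightarrow> real \<Rightarrow> 'w \<Rightarrow> real^'n"
    and y :: "'g \<Rightarrow> (real \<Rightarrow> 'w \<Rightarrow> real^'m) \<Rightarrow> real \<Rightarrow> 'w \<Rightarrow> real^'n"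
    and P1 Q1 :: "'g \<Rightarrow> real \<Rightarrow> 'w \<Rightarrow> real^'n"
    and P2 Q2 :: "'g \<Rightarrow> real \<Rightarrow> 'w \<Rightarrow> real^'n^'n"
  defines "z \<equiv> \<lambda>\<gamma> t \<omega>. (x ubar \<gamma> t \<omega>, ubar t \<omega>)"
    and "S \<equiv> \<lambda>\<gamma> t \<omega>. S_matrix (b \<gamma> t) (\<sigma> \<gamma> t) (f \<gamma> t) (x ubar \<gamma> t \<omega>, ubar t \<omega>)
                        (P1 \<gamma> t \<omega>) (Q1 \<gamma> t \<omega>) (P2 \<gamma> t \<omega>) (Q2 \<gamma> t \<omega>)"
  assumes prob: "prob_space M" "complete_measure M"
    and T: "T > 0"
    and W: "brownian_motion M T W"
    and F: "F = augmented_filtration M W"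
    and A1: "U \<noteq> {}" "convex U"
    and A2: "locally_compact_space (euclidean :: 'g topology)"
            "completely_metrizable_space (euclidean :: 'g topology)"
            "\<Lambda> \<noteq> {}" "compactin weak_topology \<Lambda>" "convex_measures \<Lambda>"
    and A3: "coefficients_regular T U b \<sigma> f h"
    and A4: "coefficients_equicontinuous T U b \<sigma> f h"
    and state: "\<And>\<gamma> u. u \<in> controls M F T U \<beta> \<Longrightarrow> solves_state M F W T x0 (b \<gamma>) (\<sigma> \<gamma>) u (x u \<gamma>)"
    and linearized: "\<And>\<gamma> v. v \<in> LF_space M F T 4 4 \<Longrightarrow>
                       solves_linearized M F W T (b \<gamma>) (\<sigma> \<gamma>) (z \<gamma>) v (y \<gamma> v)"
    and adjoint1: "\<And>\<gamma>. solves_first_adjoint M F W T (b \<gamma>) (\<sigma> \<gamma>) (f \<gamma>) (h \<gamma>) (z \<gamma>) (P1 \<gamma>) (Q1 \<gamma>)"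
    and adjoint2: "\<And>\<gamma>. solves_second_adjoint M F W T (b \<gamma>) (\<sigma> \<gamma>) (f \<gamma>) (h \<gamma>) (z \<gamma>)
                          (P1 \<gamma>) (Q1 \<gamma>) (P2 \<gamma>) (Q2 \<gamma>)"
    and joint: "jointly_measurable M T (x ubar)" "jointly_measurable M T P1" "jointly_measurable M T Q1"
               "jointly_measurable M T P2" "jointly_measurable M T Q2"
    and A5: "\<And>\<gamma> u1 u2. u1 \<in> LF_space M F T 4 4 \<Longrightarrow> u2 \<in> LF_space M F T 4 4 \<Longrightarrow>
               - (\<integral>\<omega>. (LINT t:{0..T}|lborel.
                    (S \<gamma> t \<omega> *v y \<gamma> (\<lambda>t \<omega>. u1 t \<omega> - u2 t \<omega>) t \<omega>) \<bullet> (u1 t \<omega> - u2 t \<omega>)) \<partial>M) \<ge> 0"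
    and \<beta>: "\<beta> \<ge> 4"
    and singular: "singular_optimal_control M F T U \<beta> b \<sigma> f h \<Lambda> x P1 Q1 P2 ubar"
  shows "\<exists>\<mu>\<in>worst_case_measures M T f h \<Lambda> x ubar.
           \<forall>u\<in>controls M F T U 4. \<forall>v. v = (\<lambda>t \<omega>. u t \<omega> - ubar t \<omega>) \<longrightarrow>
             (\<integral>\<gamma>. (\<integral>\<omega>. (LINT t:{0..T}|lborel. (S \<gamma> t \<omega> *v y \<gamma> v t \<omega>) \<bullet> v t \<omega>) \<partial>M) \<partial>\<mu>) \<le> 0"
proof -
  interpret brownian_space M T W
    using prob(1) W by (simp add: brownian_space_def brownian_space_axioms_def)
  have ubar: "ubar \<in> controls M F T U \<beta>"
    using singular by (simp add: singular_optimal_control_def optimal_control_def)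
  then have ubar_LF: "ubar \<in> LF_space M F T \<beta> \<beta>" and ubar_U: "\<And>t \<omega>. t \<in> {0..T} \<Longrightarrow> \<omega> \<in> space M \<Longrightarrow> ubar t \<omega> \<in> U"
    by (auto simp: controls_def)
  have ubar4: "ubar \<in> LF_space M F T 4 4" and ubar2: "ubar \<in> LF_space M F T 2 2"
    using \<beta> T ubar_LF by (auto intro!: LF_space_antimono[of _ \<beta>])
  interpret robust_state M T W U b \<sigma> f h x0 ubar x
  proof
    show "solves_state M (augmented_filtration M W) W T x0 (b \<gamma>) (\<sigma> \<gamma>) ubar (x ubar \<gamma>)" for \<gamma>
      using state[OF ubar] F by simp
    show "(\<lambda>p. ubar (fst p) (snd p)) \<in> borel_measurable (time_interval T \<Otimes>\<^sub>M M)"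
      using ubar2 by (simp add: LF_space_def adapted_measurable_def case_prod_beta')
    show "(\<integral>\<^sup>+p. ennreal ((norm (ubar (fst p) (snd p)))\<^sup>2) \<partial>time_prob M T) < \<infinity>"
      using ubar2 by (simp add: LF_space_diagonal_iff)
  qed (use T A3 A4 ubar_U in auto)
  have "worst_case_measures M T f h \<Lambda> x ubar \<noteq> {}"
    by (rule worst_case_measures_nonempty[OF A2(4,3) expected_cost_continuous expected_cost_bounded])
  then obtain \<mu> where "\<mu> \<in> worst_case_measures M T f h \<Lambda> x ubar" by blast
  moreover have "(\<integral>\<gamma>. (\<integral>\<omega>. (LINT t:{0..T}|lborel. (S \<gamma> t \<omega> *v y \<gamma> v t \<omega>) \<bullet> v t \<omega>) \<partial>M) \<partial>\<mu>) \<le> 0"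
    if u: "u \<in> controls M F T U 4" and v: "v = (\<lambda>t \<omega>. u t \<omega> - ubar t \<omega>)" for u v
  proof -
    have "u \<in> LF_space M F T 4 4" using u by (simp add: controls_def)
    from A5[OF this ubar4]
    have "(\<integral>\<omega>. (LINT t:{0..T}|lborel. (S \<gamma> t \<omega> *v y \<gamma> v t \<omega>) \<bullet> v t \<omega>) \<partial>M) \<le> 0" for \<gamma>
      unfolding v by simp
    then have "0 \<le> (\<integral>\<gamma>. - (\<integral>\<omega>. (LINT t:{0..T}|lborel. (S \<gamma> t \<omega> *v y \<gamma> v t \<omega>) \<bullet> v t \<omega>) \<partial>M) \<partial>\<mu>)"
      by (intro integral_nonneg_AE AE_I2) simp
    then show ?thesis by simp
  qed
  ultimately show ?thesis by blast
qed

end
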